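(* Let $\mathbb{K}$ be a field and let $p,q\in\mathbb{K}^{\ast}$ with $p\neq 1$ and $q\neq 1$. Let $B=\mathcal{A}_p(1,1,\mathbb{K}_q[s,t])$. Then the following hold. (1) Each $\mathbb{K}$-algebra automorphism of $B$ is affine. Moreover: (a) if $p\neq -1$ and $q\neq -1$, then $\mathrm{Aut}_{\mathbb{K}}(B)=(\mathbb{K}^{\ast})^3$; (b) if $p=-1$ and $q\neq -1$, then $\mathrm{Aut}_{\mathbb{K}}(B)=\mathbb{Z}_2\ltimes(\mathbb{K}^{\ast})^3$; (c) if $p\neq -1$ and $q=-1$, then $\mathrm{Aut}_{\mathbb{K}}(B)=\mathbb{Z}_2\ltimes(\mathbb{K}^{\ast})^3$; (d) if $p=-1$ and $q=-1$, then $\mathrm{Aut}_{\mathbb{K}}(B)=\mathbb{Z}_2\ltimes(\mathbb{Z}_2\ltimes(\mathbb{K}^{\ast})^3)$. (2) Each $\mathbb{K}$-algebra automorphism $\varphi$ of $B[w]$ is triangular. In particular, any $\mathbb{K}$-algebra automorphism $\varphi$ of $B[w]$ is given by $$\varphi(x)=\varphi_0(x),\quad \varphi(y)=\varphi_0(y),\quad \varphi(s)=\varphi_0(s),\quad \varphi(t)=\varphi_0(t),\quad \varphi(w)=aw+b$$ for some $\mathbb{K}$-algebra automorphism $\varphi_0$ of $B$, some $b$ in the center of $B$, and some $a\in\mathbb{K}^{\ast}$. (3) If $\mathbb{Z}\subseteq\mathbb{K}$ (i.e. $\mathbb{K}$ has characteristic zero), then $\mathrm{LNDer}(B)=\{0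\}$.
   Context: $\mathcal{A}_p(1,1,\mathbb{K}_q[s,t])$ denotes the associative unital $\mathbb{K}$-algebra generated by $x,y,s,t$ subject to the relations $$xy-pyx=1,\quad st=qts,\quad sx=xs,\quad sy=ys,\quad tx=xt,\quad ty=yt.$$ It carries the standard filtration $F_n=(\mathbb{K}\oplus\mathbb{K}x\oplus\mathbb{K}y\oplus\mathbb{K}s\oplus\mathbb{K}t)^n$, with $x,y,s,t$ of degree $1$. A $\mathbb{K}$-algebra automorphism $g$ of $B$ is affine if $g(F_1)\subseteq F_1$. $\mathrm{Aut}_{\mathbb{K}}(B)$ is the group of $\mathbb{K}$-algebra automorphisms; the equalities with explicit groups are group isomorphisms, $\mathbb{Z}_2$ is the cyclic group of order $2$, and $\mathbb{Z}_2\ltimes N$ denotes a semidirect product with normal factor $N$. $B[w]=B\otimes_{\mathbb{K}}\mathbb{K}[w]$ (with $w$ central). A $\mathbb{K}$-algebra automorphism $h$ of $B[w]$ is triangular if there are $g\in\mathrm{Aut}_{\mathbb{K}}(B)$, $c\in\mathbb{K}^{\ast}$ and $r$ in the center of $B$ such that $h(w)=cw+r$ and $h(u)=g(u)\in B$ for all $u\in B$. $\mathrm{LNDer}(B)$ is the set of all locally nilpotent $\mathbb{K}$-linear derivations of $B$. *)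

theory Defs
  imports Complex_Main "HOL-Algebra.Bij" "HOL-Algebra.Elementary_Groups" "HOL-Library.Poly_Mapping"
begin

section \<open>Associative unital algebras over a field\<close>

text \<open>An algebra is a type of class \<open>ring_1\<close> together with a scalar multiplication
  by the field \<open>'k\<close>.\<close>

locale unital_algebra = vector_space scale
  for scale :: "'k::field \<Rightarrow> 'b::ring_1 \<Rightarrow> 'b" +
  assumes scale_mult_left: "scale a (u * v) = scale a u * v"
    and scale_mult_right: "scale a (u * v) = u * scale a v"

definition alg_aut :: "('k::field \<Rightarrow> 'b::ring_1 \<Rightarrow> 'b) \<Rightarrow> ('b \<Rightarrow> 'b) set" where
  "alg_aut scale =
     {f. bij f \<and> Vector_Spaces.linear scale scale f \<and> f 1 = 1 \<and> (\<forall>u v. f (u * v) = f u * f v)}"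

definition aut_group :: "('k::field \<Rightarrow> 'b::ring_1 \<Rightarrow> 'b) \<Rightarrow> ('b \<Rightarrow> 'b) monoid" where
  "aut_group scale = \<lparr>carrier = alg_aut scale, monoid.mult = (\<circ>), one = id\<rparr>"

definition ring_center :: "'b::ring_1 set" where
  "ring_center = {r. \<forall>u. r * u = u * r}"

definition derivations :: "('k::field \<Rightarrow> 'b::ring_1 \<Rightarrow> 'b) \<Rightarrow> ('b \<Rightarrow> 'b) set" where
  "derivations scale =
     {\<delta>. Vector_Spaces.linear scale scale \<delta> \<and> (\<forall>u v. \<delta> (u * v) = \<delta> u * v + u * \<delta> v)}"

definition LNDer :: "('k::field \<Rightarrow> 'b::ring_1 \<Rightarrow> 'b) \<Rightarrow> ('b \<Rightarrow> 'b) set" where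
  "LNDer scale = {\<delta> \<in> derivations scale. \<forall>u. \<exists>n. (\<delta> ^^ n) u = 0}"


section \<open>Presentations by generators and relations\<close>

text \<open>Words form the free monoid, written additively because the convolution product of
  \<open>'a \<Rightarrow>\<^sub>0 'b\<close> is based on \<open>monoid_add\<close>.  Hence \<open>'g word \<Rightarrow>\<^sub>0 'k\<close> is the free
  associative unital algebra on the generators \<open>'g\<close>.\<close>

datatype 'g word = Word (letters: "'g list")

instantiation word :: (type) monoid_add
begin

definition zero_word :: "'a word" where "zero_word = Word []"

definition plus_word :: "'a word \<Rightarrow> 'a word \<Rightarrow> 'a word" where
  "plus_word v w = Word (letters v @ letters w)"

instance by standard (simp_all add: zero_word_def plus_word_def)

end

type_synonym ('g, 'k) free_algebra = "'g word \<Rightarrow>\<^sub>0 'k"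

definition free_gen :: "'g \<Rightarrow> ('g, 'k::field) free_algebra" where
  "free_gen g = Poly_Mapping.single (Word [g]) 1"

definition free_const :: "'k::field \<Rightarrow> ('g, 'k) free_algebra" where
  "free_const c = Poly_Mapping.single 0 c"

definition free_eval ::
    "('k::field \<Rightarrow> 'b::ring_1 \<Rightarrow> 'b) \<Rightarrow> ('g \<Rightarrow> 'b) \<Rightarrow> ('g, 'k) free_algebra \<Rightarrow> 'b" where
  "free_eval scale \<gamma> f =
     (\<Sum>w\<in>Poly_Mapping.keys f. scale (Poly_Mapping.lookup f w) (prod_list (map \<gamma> (letters w))))"

definition two_sided_ideal :: "'a::ring_1 set \<Rightarrow> bool" where
  "two_sided_ideal I \<longleftrightarrow>
     0 \<in> I \<and> (\<forall>u\<in>I. \<forall>v\<in>I. u + v \<in> I) \<and> (\<forall>u\<in>I. \<forall>a. a * u \<in> I \<and> u * a \<in> I)"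

definition ideal_generated :: "'a::ring_1 set \<Rightarrow> 'a set" where
  "ideal_generated R = \<Inter>{I. two_sided_ideal I \<and> R \<subseteq> I}"

text \<open>The algebra is generated by the family \<open>\<gamma>\<close> subject to exactly the relations \<open>r = 0\<close>
  for \<open>r \<in> R\<close>: evaluation at \<open>\<gamma>\<close> identifies it with the quotient of the free algebra by the
  two-sided ideal generated by \<open>R\<close>.\<close>

definition presented_by ::
    "('k::field \<Rightarrow> 'b::ring_1 \<Rightarrow> 'b) \<Rightarrow> ('g \<Rightarrow> 'b) \<Rightarrow> ('g, 'k) free_algebra set \<Rightarrow> bool" where
  "presented_by scale \<gamma> R \<longleftrightarrow>
     unital_algebra scale \<and> surj (free_eval scale \<gamma>) \<and>
     {f. free_eval scale \<gamma> f = 0} = ideal_generated R"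

definition std_filtration ::
    "('k::field \<Rightarrow> 'b::ring_1 \<Rightarrow> 'b) \<Rightarrow> 'b set \<Rightarrow> nat \<Rightarrow> 'b set" where
  "std_filtration scale G n =
     module.span scale
       {prod_list us | us. length us = n \<and> set us \<subseteq> module.span scale (insert 1 G)}"

definition affine_map ::
    "('k::field \<Rightarrow> 'b::ring_1 \<Rightarrow> 'b) \<Rightarrow> 'b set \<Rightarrow> ('b \<Rightarrow> 'b) \<Rightarrow> bool" where
  "affine_map scale G g \<longleftrightarrow> g ` std_filtration scale G 1 \<subseteq> std_filtration scale G 1"


section \<open>The algebra \<open>A\<^sub>p(1,1,K\<^sub>q[s,t])\<close>\<close>

datatype gen = Gx | Gy | Gs | Gt

definition Apq_relations :: "'k::field \<Rightarrow> 'k \<Rightarrow> (gen, 'k) free_algebra set" where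
  "Apq_relations p q =
     (let x = free_gen Gx; y = free_gen Gy; s = free_gen Gs; t = free_gen Gt in
       {x * y - free_const p * y * x - 1,
        s * t - free_const q * t * s,
        s * x - x * s, s * y - y * s, t * x - x * t, t * y - y * t})"

definition is_Apq ::
    "('k::field \<Rightarrow> 'b::ring_1 \<Rightarrow> 'b) \<Rightarrow> 'k \<Rightarrow> 'k \<Rightarrow> 'b \<Rightarrow> 'b \<Rightarrow> 'b \<Rightarrow> 'b \<Rightarrow> bool" where
  "is_Apq scale p q x y s t \<longleftrightarrow> presented_by scale (case_gen x y s t) (Apq_relations p q)"


section \<open>Polynomials \<open>B[w]\<close> in a central variable\<close>

text \<open>The type \<open>nat \<Rightarrow>\<^sub>0 'b\<close> with its convolution product is \<open>B[w]\<close> also for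
  noncommutative \<open>'b\<close>, whereas \<open>'b poly\<close> is a ring only for commutative \<open>'b\<close>.\<close>

definition poly_scale ::
    "('k::field \<Rightarrow> 'b::ring_1 \<Rightarrow> 'b) \<Rightarrow> 'k \<Rightarrow> (nat \<Rightarrow>\<^sub>0 'b) \<Rightarrow> (nat \<Rightarrow>\<^sub>0 'b)" where
  "poly_scale scale c f = Poly_Mapping.map (scale c) f"

definition poly_const :: "'b::ring_1 \<Rightarrow> (nat \<Rightarrow>\<^sub>0 'b)" where
  "poly_const u = Poly_Mapping.single 0 u"

definition poly_var :: "nat \<Rightarrow>\<^sub>0 'b::ring_1" where
  "poly_var = Poly_Mapping.single 1 1"

definition triangular ::
    "('k::field \<Rightarrow> 'b::ring_1 \<Rightarrow> 'b) \<Rightarrow> ((nat \<Rightarrow>\<^sub>0 'b) \<Rightarrow> (nat \<Rightarrow>\<^sub>0 'b)) \<Rightarrow> bool" where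
  "triangular scale h \<longleftrightarrow>
     (\<exists>g\<in>alg_aut scale. \<exists>c. c \<noteq> 0 \<and> (\<exists>r\<in>ring_center.
        h poly_var = poly_scale scale c poly_var + poly_const r \<and>
        (\<forall>u. h (poly_const u) = poly_const (g u))))"

lemma lookup_poly_scale:
  assumes "unital_algebra scale"
  shows "Poly_Mapping.lookup (poly_scale scale c f) n = scale c (Poly_Mapping.lookup f n)"
proof -
  interpret unital_algebra scale by fact
  show ?thesis by (simp add: poly_scale_def Poly_Mapping.map.rep_eq when_def)
qed

lemma poly_scale_eq:
  assumes "unital_algebra scale"
  shows "poly_scale scale c f = poly_const (scale c 1) * f"
proof -
  interpret unital_algebra scale by fact
  have "scale c = (*) (scale c 1)"
    by (rule ext) (simp flip: scale_mult_left)
  then show ?thesis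
    unfolding poly_scale_def poly_const_def by (metis mult_map_scale_conv_mult)
qed

lemma unital_algebra_poly_scale:
  assumes "unital_algebra scale"
  shows "unital_algebra (poly_scale scale)"
proof -
  interpret unital_algebra scale by fact
  have central: "f * poly_const (scale c 1) = poly_const (scale c 1) * f" for c f
  proof (induction f rule: update_induct)
    case (update f k v)
    have "Poly_Mapping.update k v f = f + Poly_Mapping.single k v"
      using update.hyps by (intro poly_mapping_eqI)
        (auto simp: lookup_add lookup_single Poly_Mapping.update.rep_eq when_def in_keys_iff)
    with update.IH show ?case
      by (simp add: poly_const_def mult_single scale_mult_left[symmetric]
          scale_mult_right[symmetric] distrib_left distrib_right)
  qed simp
  show ?thesis
  proof
    fix a b :: 'a and f g :: "nat \<Rightarrow>\<^sub>0 'b"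
    show "poly_scale scale a (f + g) = poly_scale scale a f + poly_scale scale a g"
      "poly_scale scale (a + b) f = poly_scale scale a f + poly_scale scale b f"
      "poly_scale scale a (poly_scale scale b f) = poly_scale scale (a * b) f"
      "poly_scale scale 1 f = f"
      by (rule poly_mapping_eqI;
          simp add: lookup_poly_scale[OF assms] lookup_add scale_right_distrib scale_left_distrib)+
    show "poly_scale scale a (f * g) = poly_scale scale a f * g"
      by (simp add: poly_scale_eq[OF assms] mult.assoc)
    show "poly_scale scale a (f * g) = f * poly_scale scale a g"
      by (metis poly_scale_eq[OF assms] central mult.assoc)
  qed
qed


section \<open>Groups\<close>

definition unit_group :: "'k::field monoid" where
  "unit_group = \<lparr>carrier = UNIV - {0}, monoid.mult = (*), one = 1\<rparr>"

abbreviation torus3 :: "('k::field \<times> 'k \<times> 'k) monoid" where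
  "torus3 \<equiv> unit_group \<times>\<times> (unit_group \<times>\<times> unit_group)"

abbreviation Z2 :: "int monoid" where
  "Z2 \<equiv> integer_mod_group 2"

text \<open>\<open>semidirect G N \<theta>\<close> is \<open>G \<ltimes> N\<close>, the normal factor \<open>N\<close> being acted upon by \<open>G\<close> through
  \<open>\<theta> \<in> hom G (AutoGroup N)\<close>.\<close>

definition semidirect ::
    "('g, 'c) monoid_scheme \<Rightarrow> ('n, 'd) monoid_scheme \<Rightarrow> ('g \<Rightarrow> 'n \<Rightarrow> 'n) \<Rightarrow> ('g \<times> 'n) monoid" where
  "semidirect G N \<theta> =
     \<lparr>carrier = carrier G \<times> carrier N,
      monoid.mult = (\<lambda>(a, m) (b, n). (a \<otimes>\<^bsub>G\<^esub> b, m \<otimes>\<^bsub>N\<^esub> \<theta> a n)),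
      one = (\<one>\<^bsub>G\<^esub>, \<one>\<^bsub>N\<^esub>)\<rparr>"

lemma group_semidirect:
  assumes G: "group G" and N: "group N" and \<theta>: "\<theta> \<in> hom G (AutoGroup N)"
  shows "group (semidirect G N \<theta>)"
proof -
  interpret G: group G by fact
  interpret N: group N by fact
  interpret \<theta>: group_hom G "AutoGroup N" \<theta>
    by (simp add: group_hom_def group_hom_axioms_def G N.AutoGroup \<theta>)
  have auto: "\<theta> a \<in> auto N" if "a \<in> carrier G" for a
    using \<theta>.hom_closed[OF that] by (simp add: AutoGroup_def)
  have closed: "\<theta> a n \<in> carrier N" if "a \<in> carrier G" "n \<in> carrier N" for a n
    using auto[OF that(1)] that(2) by (auto simp: auto_def hom_def)
  have mult: "\<theta> a (m \<otimes>\<^bsub>N\<^esub> n) = \<theta> a m \<otimes>\<^bsub>N\<^esub> \<theta> a n"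
    if "a \<in> carrier G" "m \<in> carrier N" "n \<in> carrier N" for a m n
    using auto[OF that(1)] that(2,3) by (auto simp: auto_def hom_def)
  have comp: "\<theta> (a \<otimes>\<^bsub>G\<^esub> b) n = \<theta> a (\<theta> b n)"
    if "a \<in> carrier G" "b \<in> carrier G" "n \<in> carrier N" for a b n
    using \<theta>.hom_mult[OF that(1,2)] auto[OF that(1)] auto[OF that(2)] that(3)
    by (simp add: AutoGroup_def BijGroup_def auto_def compose_def)
  have one: "\<theta> \<one>\<^bsub>G\<^esub> n = n" if "n \<in> carrier N" for n
    using \<theta>.hom_one that by (simp add: AutoGroup_def BijGroup_def)
  show ?thesis
  proof (rule groupI)
    fix u assume "u \<in> carrier (semidirect G N \<theta>)"
    then obtain a n where u: "u = (a, n)" "a \<in> carrier G" "n \<in> carrier N"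
      by (auto simp: semidirect_def)
    let ?v = "(inv\<^bsub>G\<^esub> a, \<theta> (inv\<^bsub>G\<^esub> a) (inv\<^bsub>N\<^esub> n))"
    have "?v \<in> carrier (semidirect G N \<theta>)"
      using u closed[of "inv\<^bsub>G\<^esub> a" "inv\<^bsub>N\<^esub> n"] by (simp add: semidirect_def del: \<theta>.hom_inv)
    moreover have "?v \<otimes>\<^bsub>semidirect G N \<theta>\<^esub> u = \<one>\<^bsub>semidirect G N \<theta>\<^esub>"
      using u mult[of "inv\<^bsub>G\<^esub> a" "inv\<^bsub>N\<^esub> n" n]
        mult[of "inv\<^bsub>G\<^esub> a" "\<one>\<^bsub>N\<^esub>" "\<one>\<^bsub>N\<^esub>"] closed[of "inv\<^bsub>G\<^esub> a" "\<one>\<^bsub>N\<^esub>"]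
      by (simp add: semidirect_def del: \<theta>.hom_inv)
    ultimately show "\<exists>v\<in>carrier (semidirect G N \<theta>).
        v \<otimes>\<^bsub>semidirect G N \<theta>\<^esub> u = \<one>\<^bsub>semidirect G N \<theta>\<^esub>" by blast
  qed (auto simp: semidirect_def closed mult comp one G.m_assoc N.m_assoc
      simp del: \<theta>.hom_mult \<theta>.hom_one)
qed

lemma group_aut_group:
  assumes "unital_algebra scale"
  shows "group (aut_group scale)"
proof -
  interpret unital_algebra scale by fact
  show ?thesis
  proof (rule groupI)
    fix f assume f: "f \<in> carrier (aut_group scale)"
    then have bij: "bij f" and lin: "Vector_Spaces.linear scale scale f"
      and one: "f 1 = 1" and mult: "f (u * v) = f u * f v" for u v
      by (auto simp: aut_group_def alg_aut_def)
    interpret f: Vector_Spaces.linear scale scale f by fact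
    have inv: "inv_into UNIV f (f u) = u" "f (inv_into UNIV f u) = u" for u
      using bij by (simp_all add: bij_is_inj bij_is_surj surj_f_inv_f)
    have "Vector_Spaces.linear scale scale (inv_into UNIV f)"
    proof (intro linear_module_homI module_hom.intro module_hom_axioms.intro module_axioms)
      fix u v a
      have "f (inv_into UNIV f u + inv_into UNIV f v) = u + v"
        by (simp add: f.add inv)
      then show "inv_into UNIV f (u + v) = inv_into UNIV f u + inv_into UNIV f v"
        by (metis inv(1))
      have "f (scale a (inv_into UNIV f u)) = scale a u"
        by (simp add: f.scale inv)
      then show "inv_into UNIV f (scale a u) = scale a (inv_into UNIV f u)"
        by (metis inv(1))
    qed
    moreover have "inv_into UNIV f 1 = 1"
      "inv_into UNIV f (u * v) = inv_into UNIV f u * inv_into UNIV f v" for u v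
      by (metis inv one mult)+
    ultimately have "inv_into UNIV f \<in> carrier (aut_group scale)"
      using bij by (simp add: aut_group_def alg_aut_def bij_imp_bij_inv)
    moreover have "inv_into UNIV f \<otimes>\<^bsub>aut_group scale\<^esub> f = \<one>\<^bsub>aut_group scale\<^esub>"
      using inv by (auto simp: aut_group_def)
    ultimately show "\<exists>g\<in>carrier (aut_group scale).
        g \<otimes>\<^bsub>aut_group scale\<^esub> f = \<one>\<^bsub>aut_group scale\<^esub>" by blast
  qed (auto simp: aut_group_def alg_aut_def bij_comp linear_id Vector_Spaces.linear_compose comp_assoc)
qed

end

theory Submission
  imports Defs "HOL-Library.Product_Plus" "HOL-Library.Product_Lexorder"
begin

text \<open>Let \<open>z = xy - yx = 1 + (p - 1)yx\<close> and \<open>C = B[w]\<close>; the variable \<open>w\<close> is also written \<open>v\<close>. Both \<open>z\<close> and \<open>st\<close> are normal: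
  \<open>xz = p zx\<close>, \<open>zy = p yz\<close>, \<open>s(st) = q (st)s\<close>, \<open>(st)t = q t(st)\<close>, and each of them commutes with the
  two generators of the other pair. The heart of the proof is that every automorphism \<open>\<phi>\<close> of \<open>C\<close>
  multiplies \<open>z\<close> and \<open>st\<close> by scalars (\<open>aut_z\<close>, \<open>aut_st\<close>).

  Granted this, degrees take over. The algebra \<open>C\<close> is a domain on which total degree and degree in
  \<open>w\<close> are additive, and \<open>\<phi>(y)\<phi>(x) = (c z - 1)/(p - 1)\<close> has total degree two and no \<open>w\<close>. Neither factor
  is a scalar, so both are linear combinations of \<open>1, x, y, s, t\<close>; the same holds for \<open>\<phi>(s)\<close> and
  \<open>\<phi>(t)\<close>. Comparing how such combinations commute with \<open>z\<close> and \<open>st\<close> leaves the diagonal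
  substitutions, the exchange of \<open>x\<close> and \<open>y\<close> when \<open>p = -1\<close> and that of \<open>s\<close> and \<open>t\<close> when \<open>q = -1\<close>
  (\<open>aut_xy\<close>, \<open>aut_s_t\<close>).

  To see that \<open>\<phi>(z)\<close> is a multiple of \<open>z\<close>, embed \<open>C\<close> in the quantum torus with monomials
  \<open>z\<^sup>a x\<^sup>n s\<^sup>k t\<^sup>l w\<^sup>m\<close> by \<open>y = (z - 1)x\<^sup>-\<^sup>1/(p - 1)\<close>. For a translation invariant total order of the
  exponents the lowest term of a product is the product of the lowest terms. Order by the exponent of
  \<open>z\<close> first and by the joint exponent of \<open>s\<close> and \<open>t\<close> second. In any commutative quotient
  \<open>(1 - p)\<phi>(x)\<phi>(y) = 1\<close>, so \<open>\<phi>(x)\<close> does not vanish at \<open>x = 1, z = s = t = w = 0\<close>, and its lowest term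
  involves only \<open>x\<close> and \<open>w\<close>. If \<open>z\<close> did not divide \<open>\<phi>(z)\<close>, then the lowest term of \<open>\<phi>(z)\<close> would be free
  of \<open>z\<close>, hence commute with that of \<open>\<phi>(x)\<close>, against \<open>\<phi>(x)\<phi>(z) = p \<phi>(z)\<phi>(x)\<close>. Applied to \<open>\<phi>\<close> and its
  inverse this gives \<open>\<phi>(z) = c z\<close>, because the units of \<open>C\<close> are scalars.

  For \<open>st\<close> suppose that \<open>s\<close> does not divide \<open>\<phi>(st)\<close>. If \<open>\<phi>(s)\<close> or \<open>\<phi>(t)\<close> has a term without \<open>z\<close> and
  \<open>s\<close>, the same comparison contradicts \<open>q \<noteq> 1\<close>. Otherwise \<open>\<phi>(s)\<close> and \<open>\<phi>(t)\<close> vanish in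
  \<open>C/(z, s) = K[x, x\<^sup>-\<^sup>1, t, w]\<close>, which is then generated by the images of \<open>\<phi>(x)\<close>, its inverse and
  \<open>\<phi>(w)\<close>; but a cotangent space of this ring has dimension three (\<open>special_key\<close>). The same argument
  with \<open>s\<close> and \<open>t\<close> exchanged shows that \<open>t\<close> divides \<open>\<phi>(st)\<close>.

  All three parts follow from the statement about \<open>C\<close>. An automorphism of \<open>B\<close> extends to \<open>C\<close>
  coefficientwise. An automorphism of \<open>C\<close> preserves \<open>B\<close>, and comparing degrees in \<open>w\<close> shows that it is
  linear in \<open>w\<close> (\<open>alg_aut_poly\<close>). A locally nilpotent derivation \<open>\<delta>\<close> in characteristic zero gives the
  automorphism \<open>exp(w\<delta>)\<close> of \<open>C\<close>; as it maps \<open>u \<in> B\<close> into \<open>B\<close>, the coefficient \<open>\<delta> u\<close> of \<open>w\<close> is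
  zero (\<open>locally_nilpotent_zero\<close>).\<close>

abbreviation "keys \<equiv> Poly_Mapping.keys"
abbreviation "lookup \<equiv> Poly_Mapping.lookup"
abbreviation "single \<equiv> Poly_Mapping.single"

section \<open>Twisted group algebras and extremal terms\<close>

lemma poly_mapping_additive_induct [case_names single add]:
  fixes f :: "'a \<Rightarrow>\<^sub>0 'c::ab_group_add"
  assumes single: "\<And>k c. P (single k c)"
    and add: "\<And>f g. P f \<Longrightarrow> P g \<Longrightarrow> P (f + g)"
  shows "P f"
proof (induction f rule: update_induct)
  case const
  show ?case using single[of undefined 0] by simp
next
  case (update f k v)
  have "Poly_Mapping.update k v f = f + single k v"
    using update.hyps by (intro poly_mapping_eqI)
      (auto simp: lookup_add lookup_single Poly_Mapping.update.rep_eq when_def in_keys_iff)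
  with add[OF update.IH single] show ?case by simp
qed

definition (in vector_space) lincomb :: "('i \<Rightarrow> 'b) \<Rightarrow> ('i \<Rightarrow>\<^sub>0 'a) \<Rightarrow> 'b" where
  "lincomb b f = (\<Sum>i\<in>keys f. scale (lookup f i) (b i))"

context vector_space
begin

lemma lincomb_superset:
  assumes "finite A" "keys f \<subseteq> A"
  shows "lincomb b f = (\<Sum>i\<in>A. scale (lookup f i) (b i))"
  unfolding lincomb_def using assms
  by (intro sum.mono_neutral_left) (auto simp: in_keys_iff)

lemma lincomb_zero [simp]: "lincomb b 0 = 0"
  by (simp add: lincomb_def)

lemma lincomb_single [simp]: "lincomb b (single i c) = scale c (b i)"
  by (cases "c = 0") (simp_all add: lincomb_def)

lemma lincomb_add: "lincomb b (f + g) = lincomb b f + lincomb b g"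
proof -
  let ?A = "keys f \<union> keys g"
  have "lincomb b u = (\<Sum>i\<in>?A. scale (lookup u i) (b i))" if "u \<in> {f, g, f + g}" for u
    using that keys_add[of f g] by (intro lincomb_superset) auto
  then show ?thesis by (simp add: lookup_add scale_left_distrib sum.distrib)
qed

end

definition coeff_scale :: "'k::field \<Rightarrow> ('e \<Rightarrow>\<^sub>0 'k) \<Rightarrow> ('e \<Rightarrow>\<^sub>0 'k)" where
  "coeff_scale c f = Poly_Mapping.map ((*) c) f"

lemma lookup_coeff_scale [simp]:
  "lookup (coeff_scale c f) a = c * lookup f a"
  by (simp add: coeff_scale_def Poly_Mapping.map.rep_eq when_def)

lemma coeff_scale_single [simp]:
  "coeff_scale c (single a d) = single a (c * d)"
  by (rule poly_mapping_eqI) (simp add: lookup_single when_def)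

lemma vector_space_coeff_scale: "vector_space (coeff_scale :: 'k::field \<Rightarrow> ('e \<Rightarrow>\<^sub>0 'k) \<Rightarrow> _)"
  by standard (auto intro!: poly_mapping_eqI simp: lookup_add algebra_simps)

lemma (in vector_space) lincomb_coeff_scale: "lincomb b (coeff_scale c f) = scale c (lincomb b f)"
proof -
  have "lincomb b (coeff_scale c f) =
      (\<Sum>i\<in>keys f. scale (lookup (coeff_scale c f) i) (b i))"
    by (intro lincomb_superset) (auto simp: in_keys_iff)
  then show ?thesis by (simp add: lincomb_def scale_sum_right)
qed

definition pairing :: "('e \<Rightarrow> 'k) \<Rightarrow> ('e \<Rightarrow>\<^sub>0 'k::field) \<Rightarrow> 'k" where
  "pairing h f = (\<Sum>a\<in>keys f. lookup f a * h a)"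

lemma vector_space_mult: "vector_space ((*) :: 'k::field \<Rightarrow> 'k \<Rightarrow> 'k)"
  by standard (simp_all add: algebra_simps)

lemma pairing_eq_lincomb: "pairing h f = vector_space.lincomb (*) h f"
  by (simp add: pairing_def vector_space.lincomb_def[OF vector_space_mult])

lemma pairing_add: "pairing h (f + g) = pairing h f + pairing h g"
  by (simp add: pairing_eq_lincomb vector_space.lincomb_add[OF vector_space_mult])

lemma pairing_scale: "pairing h (coeff_scale c f) = c * pairing h f"
  by (simp add: pairing_eq_lincomb vector_space.lincomb_coeff_scale[OF vector_space_mult])

lemma pairing_single [simp]: "pairing h (single a c) = c * h a"
  by (simp add: pairing_eq_lincomb vector_space.lincomb_single[OF vector_space_mult])

lemma pairing_zero [simp]: "pairing h 0 = 0"
  by (simp add: pairing_def)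

text \<open>A bicharacter is a cocycle, so it twists the group algebra of \<open>'e\<close> into an associative algebra.
  The product depends on the parameters \<open>p\<close> and \<open>q\<close>, which rules out a ring type; it is therefore a
  plain operation on finitely supported functions.\<close>

locale bicharacter =
  fixes lam :: "'e::ab_group_add \<Rightarrow> 'e \<Rightarrow> 'k::field"
  assumes lam_nonzero [simp]: "lam a b \<noteq> 0"
    and lam_add_left: "lam (a + b) c = lam a c * lam b c"
    and lam_add_right: "lam a (b + c) = lam a b * lam a c"
begin

lemma lam_zero [simp]: "lam 0 a = 1" "lam a 0 = 1"
  using lam_add_left[of 0 0 a] lam_add_right[of a 0 0] by auto

definition tmul :: "('e \<Rightarrow>\<^sub>0 'k) \<Rightarrow> ('e \<Rightarrow>\<^sub>0 'k) \<Rightarrow> ('e \<Rightarrow>\<^sub>0 'k)" (infixl \<open>\<star>\<close> 70) where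
  "f \<star> g = (\<Sum>a\<in>keys f. \<Sum>b\<in>keys g.
     single (a + b) (lookup f a * lookup g b * lam a b))"

lemma tmul_superset:
  assumes "finite A" "keys f \<subseteq> A" "finite B" "keys g \<subseteq> B"
  shows "f \<star> g = (\<Sum>a\<in>A. \<Sum>b\<in>B.
     single (a + b) (lookup f a * lookup g b * lam a b))"
proof -
  have "(\<Sum>b\<in>keys g.
      single (a + b) (lookup f a * lookup g b * lam a b)) =
    (\<Sum>b\<in>B. single (a + b) (lookup f a * lookup g b * lam a b))" for a
    using assms by (intro sum.mono_neutral_left) (auto simp: in_keys_iff)
  then show ?thesis
    unfolding tmul_def using assms
    by (simp, intro sum.mono_neutral_left) (auto simp: in_keys_iff)
qed

lemma tmul_add_left: "(f + f') \<star> g = f \<star> g + f' \<star> g"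
proof -
  let ?A = "keys f \<union> keys f'"
  have "u \<star> g = (\<Sum>a\<in>?A. \<Sum>b\<in>keys g.
     single (a + b) (lookup u a * lookup g b * lam a b))"
    if "u \<in> {f, f', f + f'}" for u
    using that keys_add[of f f'] by (intro tmul_superset) auto
  then show ?thesis by (simp add: lookup_add distrib_right single_add sum.distrib)
qed

lemma tmul_add_right: "f \<star> (g + g') = f \<star> g + f \<star> g'"
proof -
  let ?B = "keys g \<union> keys g'"
  have "f \<star> u = (\<Sum>a\<in>keys f. \<Sum>b\<in>?B.
     single (a + b) (lookup f a * lookup u b * lam a b))"
    if "u \<in> {g, g', g + g'}" for u
    using that keys_add[of g g'] by (intro tmul_superset) auto
  then show ?thesis by (simp add: lookup_add distrib_left distrib_right single_add sum.distrib)
qed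

lemma tmul_single [simp]:
  "single a c \<star> single b d = single (a + b) (c * d * lam a b)"
  by (cases "c = 0"; cases "d = 0") (simp_all add: tmul_def)

lemma tmul_zero [simp]: "0 \<star> f = 0" "f \<star> 0 = 0"
  by (simp_all add: tmul_def)

lemma tmul_scale_left: "coeff_scale c f \<star> g = coeff_scale c (f \<star> g)"
proof (induction f rule: poly_mapping_additive_induct)
  case (single k d)
  show ?case
  proof (induction g rule: poly_mapping_additive_induct)
    case (add f g)
    then show ?case
      by (simp add: tmul_add_right vector_space.vector_space_assms[OF vector_space_coeff_scale])
  qed (simp add: mult.assoc)
next
  case (add f g)
  then show ?case
    by (simp add: tmul_add_left vector_space.vector_space_assms[OF vector_space_coeff_scale])
qed

lemma tmul_scale_right: "f \<star> coeff_scale c g = coeff_scale c (f \<star> g)"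
proof (induction f rule: poly_mapping_additive_induct)
  case (single k d)
  show ?case
  proof (induction g rule: poly_mapping_additive_induct)
    case (add f g)
    then show ?case
      by (simp add: tmul_add_right vector_space.vector_space_assms[OF vector_space_coeff_scale])
  qed (simp add: mult_ac)
next
  case (add f g)
  then show ?case
    by (simp add: tmul_add_left vector_space.vector_space_assms[OF vector_space_coeff_scale])
qed

lemma tmul_one [simp]: "1 \<star> f = f" "f \<star> 1 = f"
  by (induction f rule: poly_mapping_additive_induct)
    (simp_all add: tmul_add_left tmul_add_right flip: single_one)

lemma tmul_assoc: "(f \<star> g) \<star> h = f \<star> (g \<star> h)"
proof (induction f rule: poly_mapping_additive_induct)
  case (single a c)
  show ?case
  proof (induction g rule: poly_mapping_additive_induct)
    case (single b d)
    show ?case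
      by (induction h rule: poly_mapping_additive_induct)
        (simp_all add: tmul_add_right lam_add_left lam_add_right add.assoc mult_ac)
  qed (simp add: tmul_add_left tmul_add_right)
qed (simp add: tmul_add_left)

lemma lookup_tmul_unique:
  assumes "a \<in> keys f" "b \<in> keys g"
    and "\<And>a' b'. a' \<in> keys f \<Longrightarrow> b' \<in> keys g \<Longrightarrow>
      a' + b' = a + b \<Longrightarrow> a' = a \<and> b' = b"
  shows "lookup (f \<star> g) (a + b) =
    lookup f a * lookup g b * lam a b"
proof -
  have eq: "lookup (single (a' + b')
        (lookup f a' * lookup g b' * lam a' b')) (a + b) =
      (if b' = b then if a' = a then lookup f a * lookup g b * lam a b else 0 else 0)"
    if "a' \<in> keys f" "b' \<in> keys g" for a' b'
    using assms(3)[OF that] by (auto simp: lookup_single when_def)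
  show ?thesis
    unfolding tmul_def lookup_sum using assms(1,2)
    by (simp add: eq sum.delta cong: sum.cong)
qed

lemma keys_tmulE:
  assumes "c \<in> keys (f \<star> g)"
  obtains a b where "a \<in> keys f" "b \<in> keys g" "c = a + b"
proof -
  have "lookup (f \<star> g) c \<noteq> 0" using assms by (simp add: in_keys_iff)
  then obtain a where a: "a \<in> keys f"
    "(\<Sum>b\<in>keys g. lookup (single (a + b)
       (lookup f a * lookup g b * lam a b)) c) \<noteq> 0"
    unfolding tmul_def lookup_sum by (meson sum.not_neutral_contains_not_neutral)
  then obtain b where "b \<in> keys g" "lookup (single (a + b)
       (lookup f a * lookup g b * lam a b)) c \<noteq> 0"
    by (meson sum.not_neutral_contains_not_neutral)
  with a(1) that show ?thesis by (auto simp: lookup_single when_def split: if_splits)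
qed

lemma keys_tmul_subset:
  assumes "keys f \<subseteq> A" "keys g \<subseteq> B"
    and "\<And>a b. a \<in> A \<Longrightarrow> b \<in> B \<Longrightarrow> a + b \<in> C"
  shows "keys (f \<star> g) \<subseteq> C"
proof
  fix c assume "c \<in> keys (f \<star> g)"
  then obtain a b where "a \<in> keys f" "b \<in> keys g" "c = a + b"
    by (rule keys_tmulE)
  with assms show "c \<in> C" by blast
qed

end

text \<open>The order is given by an injection \<open>\<omega>\<close> into a linear order, because several orders of the same
  exponents are needed.\<close>

definition translation_order :: "('e::ab_group_add \<Rightarrow> 'o::linorder) \<Rightarrow> bool" where
  "translation_order \<omega> \<longleftrightarrow> inj \<omega> \<and> (\<forall>a b c. \<omega> a < \<omega> b \<longrightarrow> \<omega> (a + c) < \<omega> (b + c))"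

definition lowest :: "('e \<Rightarrow> 'o::linorder) \<Rightarrow> ('e \<Rightarrow>\<^sub>0 'k::zero) \<Rightarrow> 'e \<Rightarrow> bool" where
  "lowest \<omega> f a \<longleftrightarrow> a \<in> keys f \<and> (\<forall>b\<in>keys f. \<omega> a \<le> \<omega> b)"

lemma lowest_exists:
  assumes "f \<noteq> 0"
  shows "\<exists>a. lowest \<omega> f a"
proof -
  let ?M = "\<omega> ` keys f"
  have "Min ?M \<in> ?M" using assms by (intro Min_in) auto
  then obtain a where "a \<in> keys f" "\<omega> a = Min ?M" by auto
  then show ?thesis by (auto simp: lowest_def)
qed

text \<open>Translation invariance makes the sum of two lowest exponents smaller than every other sum of
  exponents of the factors, so this term of the product cannot cancel.\<close>

lemma (in bicharacter) lowest_tmul: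
  fixes \<omega> :: "'e \<Rightarrow> 'o::linorder"
  assumes \<omega>: "translation_order \<omega>" and a: "lowest \<omega> f a" and b: "lowest \<omega> g b"
  shows "lookup (f \<star> g) (a + b) =
      lookup f a * lookup g b * lam a b"
    and "lowest \<omega> (f \<star> g) (a + b)"
proof -
  have inj: "\<omega> u = \<omega> v \<Longrightarrow> u = v" and mono: "\<omega> u < \<omega> v \<Longrightarrow> \<omega> (u + w) < \<omega> (v + w)" for u v w
    using \<omega> by (auto simp: translation_order_def inj_def)
  have le: "\<omega> (a + b) \<le> \<omega> (a' + b')" and strict: "a' + b' = a + b \<Longrightarrow> a' = a \<and> b' = b"
    if "a' \<in> keys f" "b' \<in> keys g" for a' b'
  proof -
    have 1: "a = a' \<or> \<omega> a < \<omega> a'" "b = b' \<or> \<omega> b < \<omega> b'"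
      using a b that inj by (force simp: lowest_def le_less)+
    have 2: "a = a' \<or> \<omega> (a + b) < \<omega> (a' + b)" "b = b' \<or> \<omega> (a' + b) < \<omega> (a' + b')"
      using 1 mono[of a a' b] mono[of b b' a'] by (auto simp: add.commute)
    then show "\<omega> (a + b) \<le> \<omega> (a' + b')" by auto
    show "a' = a \<and> b' = b" if "a' + b' = a + b"
      using 2 that by auto
  qed
  show eq: "lookup (f \<star> g) (a + b) =
      lookup f a * lookup g b * lam a b"
    using a b strict by (intro lookup_tmul_unique) (auto simp: lowest_def)
  show "lowest \<omega> (f \<star> g) (a + b)"
    unfolding lowest_def
  proof
    show "a + b \<in> keys (f \<star> g)"
      using a b eq by (simp add: lowest_def in_keys_iff)
    show "\<forall>c\<in>keys (f \<star> g). \<omega> (a + b) \<le> \<omega> c"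
      using le by (auto elim: keys_tmulE)
  qed
qed

text \<open>Product rules can be checked on monomials. With \<open>h3 = 0\<close> and equal \<open>h\<close>, \<open>h1\<close>, \<open>h2\<close> the functional is
  multiplicative; with \<open>h = h1 = h4\<close> and \<open>h2 = h3\<close> it is a derivation at a point.\<close>

lemma (in bicharacter) pairing_tmul:
  assumes keys: "keys f \<subseteq> A" "keys g \<subseteq> A"
    and h: "\<And>a b. a \<in> A \<Longrightarrow> b \<in> A \<Longrightarrow> h (a + b) * lam a b = h1 a * h2 b + h3 a * h4 b"
  shows "pairing h (f \<star> g) = pairing h1 f * pairing h2 g + pairing h3 f * pairing h4 g"
proof -
  have sum: "pairing h (\<Sum>i\<in>I. F i) = (\<Sum>i\<in>I. pairing h (F i))" for F and I :: "'e set"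
    by (induction I rule: infinite_finite_induct) (simp_all add: pairing_add)
  have "pairing h (f \<star> g) = (\<Sum>a\<in>keys f. \<Sum>b\<in>keys g.
      lookup f a * lookup g b * (h (a + b) * lam a b))"
    by (simp add: tmul_def sum mult_ac)
  also have "\<dots> = (\<Sum>a\<in>keys f. \<Sum>b\<in>keys g.
      (lookup f a * h1 a) * (lookup g b * h2 b) +
      (lookup f a * h3 a) * (lookup g b * h4 b))"
    using keys h by (intro sum.cong) (auto simp: subset_iff algebra_simps)
  also have "\<dots> = pairing h1 f * pairing h2 g + pairing h3 f * pairing h4 g"
    by (simp add: pairing_def sum.distrib sum_product)
  finally show ?thesis .
qed

section \<open>Homomorphisms out of a presented algebra\<close>

text \<open>An algebra with an explicit product, so that the twisted group algebra and the algebras of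
  class \<open>ring_1\<close> can both be targets of homomorphisms.\<close>

locale explicit_algebra = vector_space scl
  for scl :: "'k::field \<Rightarrow> 'v::ab_group_add \<Rightarrow> 'v" +
  fixes mul :: "'v \<Rightarrow> 'v \<Rightarrow> 'v" and unit :: 'v
  assumes mul_add_left: "mul (u + v) w = mul u w + mul v w"
    and mul_add_right: "mul u (v + w) = mul u v + mul u w"
    and mul_scl_left: "mul (scl c u) v = scl c (mul u v)"
    and mul_scl_right: "mul u (scl c v) = scl c (mul u v)"
    and mul_assoc: "mul (mul u v) w = mul u (mul v w)"
    and mul_unit [simp]: "mul unit u = u" "mul u unit = u"
begin

definition word_eval :: "('g \<Rightarrow> 'v) \<Rightarrow> 'g word \<Rightarrow> 'v" where
  "word_eval \<delta> w = foldr (\<lambda>g. mul (\<delta> g)) (letters w) unit"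

definition eval :: "('g \<Rightarrow> 'v) \<Rightarrow> ('g, 'k) free_algebra \<Rightarrow> 'v" where
  "eval \<delta> = lincomb (word_eval \<delta>)"

lemma mul_zero: "mul 0 u = 0" "mul u 0 = 0"
  using mul_add_left[of 0 0 u] mul_add_right[of u 0 0] by auto

lemma word_eval_plus: "word_eval \<delta> (v + w) = mul (word_eval \<delta> v) (word_eval \<delta> w)"
proof -
  have "foldr (\<lambda>g. mul (\<delta> g)) (as @ bs) unit =
      mul (foldr (\<lambda>g. mul (\<delta> g)) as unit) (foldr (\<lambda>g. mul (\<delta> g)) bs unit)" for as bs
    by (induction as) (simp_all add: mul_assoc)
  then show ?thesis by (simp add: word_eval_def plus_word_def del: foldr_append)
qed

lemma eval_single: "eval \<delta> (single w c) = scl c (word_eval \<delta> w)"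
  by (simp add: eval_def)

lemma eval_add: "eval \<delta> (f + g) = eval \<delta> f + eval \<delta> g"
  by (simp add: eval_def lincomb_add)

lemma eval_zero: "eval \<delta> 0 = 0"
  by (simp add: eval_def)

lemma eval_diff: "eval \<delta> (f - g) = eval \<delta> f - eval \<delta> g"
  using eval_add[of \<delta> "f - g" g] by simp

lemma eval_mult: "eval \<delta> (f * g) = mul (eval \<delta> f) (eval \<delta> g)"
proof (induction f rule: poly_mapping_additive_induct)
  case (single v c)
  show ?case
  proof (induction g rule: poly_mapping_additive_induct)
    case (single w d)
    show ?case
      by (simp add: mult_single eval_single word_eval_plus mul_scl_left mul_scl_right)
  qed (simp add: distrib_left eval_add mul_add_right)
qed (simp add: distrib_right eval_add mul_add_left)

lemma eval_free_const: "eval \<delta> (free_const c) = scl c unit"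
  by (simp add: free_const_def eval_single word_eval_def zero_word_def)

lemma eval_one: "eval \<delta> 1 = unit"
  using eval_free_const[of \<delta> 1] by (simp add: free_const_def)

lemma eval_free_gen: "eval \<delta> (free_gen g) = \<delta> g"
  by (simp add: free_gen_def eval_single word_eval_def)

lemma eval_ideal_generated:
  assumes "\<And>r. r \<in> R \<Longrightarrow> eval \<delta> r = 0" and "f \<in> ideal_generated R"
  shows "eval \<delta> f = 0"
proof -
  have "two_sided_ideal {f. eval \<delta> f = 0}"
    by (simp add: two_sided_ideal_def eval_zero eval_add eval_mult mul_zero)
  with assms have "f \<in> {f. eval \<delta> f = 0}"
    unfolding ideal_generated_def by blast
  then show ?thesis by simp
qed

lemmas eval_simps = eval_add eval_diff eval_mult eval_free_const eval_one eval_free_gen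

end

lemma (in unital_algebra) explicit_algebra: "explicit_algebra scale (*) 1"
  by unfold_locales
    (simp_all add: distrib_left distrib_right mult.assoc flip: scale_mult_left scale_mult_right)

lemma (in unital_algebra) eval_eq_free_eval:
  "explicit_algebra.eval scale (*) 1 \<gamma> = free_eval scale \<gamma>"
proof
  interpret A: explicit_algebra scale "(*)" 1 by (rule explicit_algebra)
  have "foldr (\<lambda>g. (*) (\<gamma> g)) ws 1 = prod_list (map \<gamma> ws)" for ws
    by (induction ws) simp_all
  then show "A.eval \<gamma> f = free_eval scale \<gamma> f" for f
    by (simp add: A.eval_def lincomb_def A.word_eval_def free_eval_def)
qed

lemma (in bicharacter) explicit_algebra_tmul: "explicit_algebra coeff_scale tmul 1"
proof -
  interpret vector_space "coeff_scale :: 'k \<Rightarrow> ('e \<Rightarrow>\<^sub>0 'k) \<Rightarrow> _"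
    by (rule vector_space_coeff_scale)
  show ?thesis
    by unfold_locales
      (simp_all add: tmul_add_left tmul_add_right tmul_scale_left tmul_scale_right tmul_assoc)
qed

text \<open>The universal property: evaluation at \<open>\<delta>\<close> annihilates the ideal generated by \<open>R\<close>, which is the
  kernel of evaluation at \<open>\<gamma>\<close>, and hence factors through it.\<close>

lemma (in explicit_algebra) presented_by_hom:
  fixes scale :: "'k \<Rightarrow> 'b::ring_1 \<Rightarrow> 'b"
  assumes pres: "presented_by scale \<gamma> R" and rel: "\<And>r. r \<in> R \<Longrightarrow> eval \<delta> r = 0"
  obtains H where "\<And>u v. H (u + v) = H u + H v" "\<And>c u. H (scale c u) = scl c (H u)"
    "\<And>u v. H (u * v) = mul (H u) (H v)" "H 1 = unit" "\<And>g. H (\<gamma> g) = \<delta> g"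
proof -
  interpret B: unital_algebra scale using pres by (simp add: presented_by_def)
  interpret A: explicit_algebra scale "(*)" 1 by (rule B.explicit_algebra)
  have surj: "\<exists>f. A.eval \<gamma> f = u" for u
    using pres by (metis B.eval_eq_free_eval presented_by_def surjD)
  define H where "H u = eval \<delta> (SOME f. A.eval \<gamma> f = u)" for u
  have H: "H (A.eval \<gamma> f) = eval \<delta> f" for f
  proof -
    define g where "g = (SOME g. A.eval \<gamma> g = A.eval \<gamma> f)"
    have "A.eval \<gamma> g = A.eval \<gamma> f"
      unfolding g_def by (rule someI[of _ f]) simp
    then have "g - f \<in> ideal_generated R"
      using pres by (auto simp: presented_by_def A.eval_diff simp flip: B.eval_eq_free_eval)
    then have "eval \<delta> (g - f) = 0"
      using rel by (rule eval_ideal_generated[rotated])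
    then show ?thesis by (simp add: eval_diff H_def g_def)
  qed
  show ?thesis
  proof
    fix u v c g
    obtain f where u: "u = A.eval \<gamma> f" using surj by metis
    obtain f' where v: "v = A.eval \<gamma> f'" using surj by metis
    show "H (u + v) = H u + H v" "H (u * v) = mul (H u) (H v)"
      unfolding u v by (simp_all add: H eval_add eval_mult flip: A.eval_add A.eval_mult)
    have "scale c u = A.eval \<gamma> (free_const c * f)"
      by (simp add: A.eval_simps u flip: B.scale_mult_left)
    then show "H (scale c u) = scl c (H u)"
      by (simp add: H eval_simps mul_scl_left u)
    show "H 1 = unit" using H[of 1] by (simp add: eval_one A.eval_one)
    show "H (\<gamma> g) = \<delta> g" using H[of "free_gen g"] by (simp add: eval_free_gen A.eval_free_gen)
  qed
qed

lemma is_Apq_hom: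
  fixes scale :: "'k::field \<Rightarrow> 'b::ring_1 \<Rightarrow> 'b"
    and scl :: "'k \<Rightarrow> 'v::ab_group_add \<Rightarrow> 'v"
  assumes "is_Apq scale p q x y s t" and alg: "explicit_algebra scl mul unit"
    and rel: "mul X Y = scl p (mul Y X) + unit" "mul S T = scl q (mul T S)"
      "mul S X = mul X S" "mul S Y = mul Y S" "mul T X = mul X T" "mul T Y = mul Y T"
  obtains H where "\<And>u v. H (u + v) = H u + H v" "\<And>c u. H (scale c u) = scl c (H u)"
    "\<And>u v. H (u * v) = mul (H u) (H v)" "H 1 = unit" "H x = X" "H y = Y" "H s = S" "H t = T"
proof -
  interpret V: explicit_algebra scl mul unit by fact
  have rels: "V.eval (case_gen X Y S T) r = 0" if "r \<in> Apq_relations p q" for r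
    using that rel by (auto simp: Apq_relations_def Let_def V.eval_simps V.mul_scl_left)
  obtain H where H: "\<And>u v. H (u + v) = H u + H v" "\<And>c u. H (scale c u) = scl c (H u)"
    "\<And>u v. H (u * v) = mul (H u) (H v)" "H 1 = unit" "\<And>g. H (case_gen x y s t g) = case_gen X Y S T g"
    using V.presented_by_hom[OF assms(1)[unfolded is_Apq_def] rels] by blast
  show ?thesis
    using that[of H] H(1-4) H(5)[of Gx] H(5)[of Gy] H(5)[of Gs] H(5)[of Gt] by simp
qed

lemma is_Apq_relations:
  assumes "is_Apq scale p q x y s t"
  shows "unital_algebra scale" "x * y = scale p (y * x) + 1" "s * t = scale q (t * s)"
    "s * x = x * s" "s * y = y * s" "t * x = x * t" "t * y = y * t"
proof -
  have pres: "presented_by scale (case_gen x y s t) (Apq_relations p q)"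
    using assms by (simp add: is_Apq_def)
  then show "unital_algebra scale" by (simp add: presented_by_def)
  then interpret B: unital_algebra scale .
  interpret A: explicit_algebra scale "(*)" 1 by (rule B.explicit_algebra)
  have "Apq_relations p q \<subseteq> ideal_generated (Apq_relations p q)"
    unfolding ideal_generated_def by blast
  then have "\<forall>r\<in>Apq_relations p q. A.eval (case_gen x y s t) r = 0"
    using pres by (auto simp: presented_by_def B.eval_eq_free_eval)
  then show "x * y = scale p (y * x) + 1" "s * t = scale q (t * s)"
    "s * x = x * s" "s * y = y * s" "t * x = x * t" "t * y = y * t"
    by (simp_all add: Apq_relations_def Let_def A.eval_simps diff_eq_eq flip: B.scale_mult_left)
qed

text \<open>Left multiplication by generators suffices, since the words span.\<close>

lemma is_Apq_induct [consumes 1, case_names one add scale x y s t]: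
  fixes scale :: "'k::field \<Rightarrow> 'b::ring_1 \<Rightarrow> 'b"
  assumes "is_Apq scale p q x y s t"
    and one: "P 1" and add: "\<And>u v. P u \<Longrightarrow> P v \<Longrightarrow> P (u + v)"
    and scale: "\<And>c u. P u \<Longrightarrow> P (scale c u)"
    and gen: "\<And>u. P u \<Longrightarrow> P (x * u)" "\<And>u. P u \<Longrightarrow> P (y * u)"
      "\<And>u. P u \<Longrightarrow> P (s * u)" "\<And>u. P u \<Longrightarrow> P (t * u)"
  shows "P u"
proof -
  have pres: "presented_by scale (case_gen x y s t) (Apq_relations p q)"
    using assms(1) by (simp add: is_Apq_def)
  then interpret B: unital_algebra scale by (simp add: presented_by_def)
  interpret A: explicit_algebra scale "(*)" 1 by (rule B.explicit_algebra)
  obtain f where u: "u = A.eval (case_gen x y s t) f"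
    using pres by (metis B.eval_eq_free_eval presented_by_def surjD)
  have word: "P (foldr (\<lambda>g. (*) (case_gen x y s t g)) ws 1)" for ws
    by (induction ws) (auto intro: one gen split: gen.split)
  show ?thesis unfolding u
  proof (induction f rule: poly_mapping_additive_induct)
    case (single w c)
    show ?case using word by (simp add: A.eval_single A.word_eval_def scale)
  qed (simp add: A.eval_add add)
qed

section \<open>The quantum torus and the monomials\<close>

text \<open>The exponent \<open>(a, n, k, l, m)\<close> stands for \<open>z\<^sup>a x\<^sup>n s\<^sup>k t\<^sup>l v\<^sup>m\<close>, where \<open>v\<close> is the central
  variable.\<close>

type_synonym expo = "int \<times> int \<times> int \<times> int \<times> int"

text \<open>The structure constants come from \<open>x\<^sup>n z\<^sup>b = p\<^bsup>nb\<^esup> z\<^sup>b x\<^sup>n\<close> and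
  \<open>t\<^sup>l s\<^sup>k = q\<^bsup>-lk\<^esup> s\<^sup>k t\<^sup>l\<close>.\<close>

fun qlam :: "'k::field \<Rightarrow> 'k \<Rightarrow> expo \<Rightarrow> expo \<Rightarrow> 'k" where
  "qlam p q (a, n, k, l, m) (a', n', k', l', m') = p powi (n * a') * q powi (- (l * k'))"

lemma bicharacter_qlam:
  assumes "p \<noteq> 0" "q \<noteq> 0"
  shows "bicharacter (qlam p q)"
proof
  fix a b c :: expo
  show "qlam p q a b \<noteq> 0" using assms by (cases a; cases b) simp
  show "qlam p q (a + b) c = qlam p q a c * qlam p q b c"
    using assms by (cases a; cases b; cases c) (simp add: distrib_right power_int_add power_int_diff power_int_minus field_simps)
  show "qlam p q a (b + c) = qlam p q a b * qlam p q a c"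
    using assms by (cases a; cases b; cases c) (simp add: distrib_left power_int_add power_int_diff power_int_minus field_simps)
qed

text \<open>The weights decide first; the exponent itself breaks ties and makes the order total.\<close>

definition lexw :: "(expo \<Rightarrow> int) \<Rightarrow> (expo \<Rightarrow> int) \<Rightarrow> expo \<Rightarrow> int \<times> int \<times> expo" where
  "lexw w1 w2 a = (w1 a, w2 a, a)"

lemma expo_add_strict_mono: "(a::expo) < b \<Longrightarrow> a + c < b + c"
  by (cases a; cases b; cases c) auto

lemma translation_order_lexw:
  assumes "additive w1" "additive w2"
  shows "translation_order (lexw w1 w2)"
  using additive.add[OF assms(1)] additive.add[OF assms(2)] expo_add_strict_mono
  by (auto simp: translation_order_def lexw_def inj_def)

lemma lexw_le_D:
  "lexw w1 w2 a \<le> lexw w1 w2 b \<Longrightarrow> w1 a \<le> w1 b"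
  "lexw w1 w2 a \<le> lexw w1 w2 b \<Longrightarrow> w1 a = w1 b \<Longrightarrow> w2 a \<le> w2 b"
  by (auto simp: lexw_def)

text \<open>The exponent of \<open>x\<close> may be negative, since \<open>y\<close> involves the inverse of \<open>x\<close>.\<close>

definition cone :: "expo set" where
  "cone = {(a, n, k, l, m). 0 \<le> a \<and> 0 \<le> k \<and> 0 \<le> l \<and> 0 \<le> m}"

lemma cone_iff [simp]:
  "(a, n, k, l, m) \<in> cone \<longleftrightarrow> 0 \<le> a \<and> 0 \<le> k \<and> 0 \<le> l \<and> 0 \<le> m"
  by (simp add: cone_def)

abbreviation ez :: "expo \<Rightarrow> int" where "ez a \<equiv> fst a"
abbreviation es :: "expo \<Rightarrow> int" where "es a \<equiv> fst (snd (snd a))"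
abbreviation et :: "expo \<Rightarrow> int" where "et a \<equiv> fst (snd (snd (snd a)))"
abbreviation ev :: "expo \<Rightarrow> int" where "ev a \<equiv> snd (snd (snd (snd a)))"

text \<open>The generators \<open>x\<close>, \<open>y\<close>, \<open>s\<close>, \<open>t\<close>, \<open>v\<close> get degree one, so that \<open>z = 1 + (p - 1)yx\<close> gets degree two.\<close>

definition deg :: "expo \<Rightarrow> int" where
  "deg a = 2 * ez a + fst (snd a) + es a + et a + ev a"

lemma additive_weights:
  "additive fst" "additive (\<lambda>a::expo. - ez a)" "additive es" "additive et" "additive ev" "additive deg"
  "additive (\<lambda>a. es a + et a)"
  by (simp_all add: additive_def deg_def)

text \<open>The polynomial ring \<open>C = B[v]\<close>, described by its generators together with a homomorphism \<open>\<Phi>\<close> into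
  the quantum torus. The value of \<open>\<Phi> y\<close> is forced by \<open>yx = (z - 1)/(p - 1)\<close>. That \<open>\<Phi>\<close> is injective is
  a consequence (\<open>\<Phi>_eq_zero_iff\<close>).\<close>

locale Apq_poly = unital_algebra scale
  for scale :: "'k::field \<Rightarrow> 'c::ring_1 \<Rightarrow> 'c" +
  fixes p q :: 'k and x y s t v :: 'c and \<Phi> :: "'c \<Rightarrow> expo \<Rightarrow>\<^sub>0 'k"
  assumes p0: "p \<noteq> 0" and q0: "q \<noteq> 0" and p1: "p \<noteq> 1" and q1: "q \<noteq> 1"
    and xy: "x * y = scale p (y * x) + 1" and st: "s * t = scale q (t * s)"
    and sx: "s * x = x * s" and sy: "s * y = y * s" and tx: "t * x = x * t" and ty: "t * y = y * t"
    and v_central: "v * u = u * v"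
    and generated: "\<lbrakk>P 1; \<And>u w. P u \<Longrightarrow> P w \<Longrightarrow> P (u + w); \<And>c u. P u \<Longrightarrow> P (scale c u);
      \<And>u. P u \<Longrightarrow> P (x * u); \<And>u. P u \<Longrightarrow> P (y * u); \<And>u. P u \<Longrightarrow> P (s * u);
      \<And>u. P u \<Longrightarrow> P (t * u); \<And>u. P u \<Longrightarrow> P (v * u)\<rbrakk> \<Longrightarrow> P u"
    and \<Phi>_add: "\<Phi> (u + w) = \<Phi> u + \<Phi> w"
    and \<Phi>_scale: "\<Phi> (scale c u) = coeff_scale c (\<Phi> u)"
    and \<Phi>_mult: "\<Phi> (u * w) = bicharacter.tmul (qlam p q) (\<Phi> u) (\<Phi> w)"
    and \<Phi>_one: "\<Phi> 1 = 1"
    and \<Phi>_x: "\<Phi> x = single (0, 1, 0, 0, 0) 1"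
    and \<Phi>_y: "\<Phi> y = single (1, -1, 0, 0, 0) (inverse (p - 1))
      - single (0, -1, 0, 0, 0) (inverse (p - 1))"
    and \<Phi>_s: "\<Phi> s = single (0, 0, 1, 0, 0) 1"
    and \<Phi>_t: "\<Phi> t = single (0, 0, 0, 1, 0) 1"
    and \<Phi>_v: "\<Phi> v = single (0, 0, 0, 0, 1) 1"
begin

abbreviation supp :: "'c \<Rightarrow> expo set" where "supp u \<equiv> keys (\<Phi> u)"

sublocale E: bicharacter "qlam p q"
  using p0 q0 by (rule bicharacter_qlam)

lemmas scale_out = scale_mult_left[symmetric] scale_mult_right[symmetric]

definition z :: 'c where "z = x * y - y * x"

lemma z_eq: "z = 1 + scale (p - 1) (y * x)"
  by (simp add: z_def xy scale_left_diff_distrib)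

lemma p_diff_1: "p - 1 \<noteq> 0" using p1 by simp

lemma yx: "y * x = scale (inverse (p - 1)) (z - 1)"
  using p_diff_1 by (simp add: z_eq)

lemma xy_z: "x * y = scale (inverse (p - 1)) (scale p z - 1)"
proof -
  have "scale (p - 1) (x * y) = scale p z - 1"
    by (simp add: xy z_eq scale_right_distrib scale_left_diff_distrib scale_right_diff_distrib
        right_diff_distrib left_diff_distrib)
  then have "scale (inverse (p - 1)) (scale (p - 1) (x * y)) = scale (inverse (p - 1)) (scale p z - 1)"
    by simp
  then show ?thesis using p_diff_1 by simp
qed

lemma xz: "x * z = scale p (z * x)"
proof -
  have "x * z = x + scale (p - 1) (x * y * x)"
    by (simp add: z_eq distrib_left scale_out mult.assoc)
  also have "\<dots> = scale p (z * x)"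
    by (simp add: z_eq xy distrib_right scale_out scale_right_distrib scale_left_diff_distrib
        scale_right_diff_distrib algebra_simps)
  finally show ?thesis .
qed

lemma zy: "z * y = scale p (y * z)"
proof -
  have "z * y = y + scale (p - 1) (y * (x * y))"
    by (simp add: z_eq distrib_right scale_out mult.assoc)
  also have "\<dots> = scale p (y * z)"
    by (simp add: z_eq xy distrib_left scale_out scale_right_distrib scale_left_diff_distrib
        scale_right_diff_distrib algebra_simps)
  finally show ?thesis .
qed

lemma yz: "y * z = scale (inverse p) (z * y)"
  using p0 by (simp add: zy)

lemma commute_z:
  assumes "u * x = x * u" "u * y = y * u"
  shows "u * z = z * u"
proof -
  have "u * (g * h) = g * h * u" if "u * g = g * u" "u * h = h * u" for g h
    using that by (metis mult.assoc)
  then show ?thesis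
    using assms by (simp add: z_def left_diff_distrib right_diff_distrib)
qed

lemma sz: "s * z = z * s" and tz: "t * z = z * t"
  by (simp_all add: commute_z sx sy tx ty)

lemma ts: "t * s = scale (inverse q) (s * t)"
  using q0 by (simp add: st)

lemma \<Phi>_diff: "\<Phi> (u - w) = \<Phi> u - \<Phi> w"
  using \<Phi>_add[of "u - w" w] by (simp add: eq_diff_eq)

lemma \<Phi>_zero [simp]: "\<Phi> 0 = 0"
  using \<Phi>_add[of 0 0] by simp

lemma \<Phi>_sum: "\<Phi> (\<Sum>i\<in>I. f i) = (\<Sum>i\<in>I. \<Phi> (f i))"
  by (induction I rule: infinite_finite_induct) (simp_all add: \<Phi>_add)

lemma tmul_diff_left: "E.tmul (f - g) h = E.tmul f h - E.tmul g h"
  using E.tmul_add_left[of "f - g" g h] by (simp add: eq_diff_eq)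

lemma \<Phi>_z: "\<Phi> z = single (1, 0, 0, 0, 0) 1"
proof -
  have "\<Phi> (y * x) = single (1, 0, 0, 0, 0) (inverse (p - 1))
      - single 0 (inverse (p - 1))"
    by (simp add: \<Phi>_mult \<Phi>_y \<Phi>_x tmul_diff_left zero_prod_def)
  then have "\<Phi> z = 1 + coeff_scale (p - 1) (single (1, 0, 0, 0, 0) (inverse (p - 1))
      - single 0 (inverse (p - 1)))"
    by (simp only: z_eq \<Phi>_add \<Phi>_scale \<Phi>_one)
  also have "\<dots> = single (1, 0, 0, 0, 0) 1"
    using p_diff_1 by (intro poly_mapping_eqI)
      (auto simp: lookup_add lookup_minus lookup_single lookup_one when_def zero_prod_def)
  finally show ?thesis .
qed

text \<open>In \<open>C\<close> the role of the negative powers of \<open>x\<close> is played by the powers of \<open>y\<close>.\<close>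

definition x_power :: "int \<Rightarrow> 'c" where
  "x_power n = (if 0 \<le> n then x ^ nat n else y ^ nat (- n))"

fun mon :: "expo \<Rightarrow> 'c" where
  "mon (a, n, k, l, m) = z ^ nat a * x_power n * s ^ nat k * t ^ nat l * v ^ nat m"

lemma x_power_Suc: "x * x_power n = (if 0 \<le> n then x_power (n + 1)
    else scale (inverse (p - 1)) (scale p (z * x_power (n + 1)) - x_power (n + 1)))"
proof (cases "0 \<le> n")
  case True
  then show ?thesis by (simp add: x_power_def nat_add_distrib)
next
  case False
  then have "nat (- n) = Suc (nat (- (n + 1)))" by simp
  moreover have "x_power (n + 1) = y ^ nat (- (n + 1))" using False by (cases "n = -1") (auto simp: x_power_def)
  ultimately show ?thesis using False
    by (simp add: x_power_def scale_out left_diff_distrib flip: mult.assoc) (simp add: xy_z scale_out left_diff_distrib mult.assoc)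
qed

lemma x_power_pred: "y * x_power n = (if n \<le> 0 then x_power (n - 1)
    else scale (inverse (p - 1)) (z * x_power (n - 1) - x_power (n - 1)))"
proof (cases "n \<le> 0")
  case True
  then have "nat (1 - n) = Suc (nat (- n))" by simp
  moreover have "x_power n = y ^ nat (- n)" using True by (cases "n = 0") (auto simp: x_power_def)
  ultimately show ?thesis using True by (simp add: x_power_def)
next
  case False
  then have "nat n = Suc (nat (n - 1))" by simp
  then show ?thesis using False
    by (simp add: x_power_def scale_out left_diff_distrib flip: mult.assoc) (simp add: yx scale_out left_diff_distrib mult.assoc)
qed

lemma power_twist:
  assumes "u * w = scale c (w * u)"
  shows "u * w ^ n = scale (c ^ n) (w ^ n * u)"
proof (induction n)
  case (Suc n)
  have "u * w ^ Suc n = scale c (w * (u * w ^ n))"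
    by (simp add: assms scale_out flip: mult.assoc)
  with Suc show ?case by (simp add: scale_out mult.assoc)
qed simp

lemma power_comm:
  assumes "u * w = w * u"
  shows "u * (w ^ n * r) = w ^ n * (u * (r::'c))"
  using power_twist[of u w 1 n] assms by (simp flip: mult.assoc)

lemma x_power_comm:
  assumes "u * x = x * u" "u * y = y * u"
  shows "u * (x_power n * r) = x_power n * (u * r)"
  using assms by (simp add: x_power_def power_comm)

lemma x_mon: "x * mon (a, n, k, l, m) = scale (p ^ nat a) (z ^ nat a * (x * x_power n) * s ^ nat k * t ^ nat l * v ^ nat m)"
  using power_twist[OF xz, of "nat a"] by (simp add: scale_out flip: mult.assoc)

lemma y_mon: "y * mon (a, n, k, l, m) = scale (inverse p ^ nat a) (z ^ nat a * (y * x_power n) * s ^ nat k * t ^ nat l * v ^ nat m)"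
  using power_twist[OF yz, of "nat a"] by (simp add: scale_out flip: mult.assoc)

lemma z_mon: "0 \<le> a \<Longrightarrow> z * mon (a, n, k, l, m) = mon (a + 1, n, k, l, m)"
  by (simp add: nat_add_distrib mult.assoc)

lemma s_mon: "0 \<le> k \<Longrightarrow> s * mon (a, n, k, l, m) = mon (a, n, k + 1, l, m)"
  by (simp add: nat_add_distrib mult.assoc power_comm[OF sz] x_power_comm[OF sx sy])

lemma t_mon: "0 \<le> l \<Longrightarrow> t * mon (a, n, k, l, m) = scale (inverse q ^ nat k) (mon (a, n, k, l + 1, m))"
proof -
  assume "0 \<le> l"
  have "t * (s ^ nat k * r) = scale (inverse q ^ nat k) (s ^ nat k * (t * r))" for r
    using power_twist[OF ts, of "nat k"] by (simp add: scale_out flip: mult.assoc)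
  with \<open>0 \<le> l\<close> show ?thesis
    by (simp add: nat_add_distrib mult.assoc power_comm[OF tz] x_power_comm[OF tx ty] scale_out)
qed

lemma v_mon: "0 \<le> m \<Longrightarrow> v * mon (a, n, k, l, m) = mon (a, n, k, l, m + 1)"
  by (subst v_central) (simp add: nat_add_distrib mult.assoc power_commutes)

text \<open>The span of the monomials is stable under left multiplication by each generator. The only products
  that leave the list of monomials are those of \<open>x\<close> with a power of \<open>y\<close> and conversely, and they are
  rewritten by \<open>xy = (pz - 1)/(p - 1)\<close> and \<open>yx = (z - 1)/(p - 1)\<close>.\<close>

lemma span_mon: "u \<in> span (mon ` cone)"
proof (rule generated[of "\<lambda>u. u \<in> span (mon ` cone)"])
  let ?S = "span (mon ` cone)"
  have base: "mon a \<in> ?S" if "a \<in> cone" for a using that by (simp add: span_base)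
  have closed: "g * u \<in> ?S" if "u \<in> ?S" and g: "\<And>a. a \<in> cone \<Longrightarrow> g * mon a \<in> ?S" for g u
    using that(1)
  proof (induction rule: span_induct)
    case (base)
    show ?case by (auto simp: subspace_def distrib_left span_zero span_add span_scale scale_out)
  qed (use g in auto)
  have shift: "z ^ nat a * (scale b (scale c (z * w) - w)) * r1 * r2 * r3 =
      scale b (scale c (z ^ nat (a + 1) * w * r1 * r2 * r3) - z ^ nat a * w * r1 * r2 * r3)"
    if "0 \<le> a" for a b c w r1 r2 r3
    using that by (simp add: nat_add_distrib right_diff_distrib left_diff_distrib scale_out mult.assoc power_comm[of z z])
  have xm: "x * mon (a, n, k, l, m) \<in> ?S" if "(a, n, k, l, m) \<in> cone" for a n k l m
  proof -
    have mem: "mon (a, n + 1, k, l, m) \<in> ?S" "mon (a + 1, n + 1, k, l, m) \<in> ?S"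
      using that by (auto intro!: base simp del: mon.simps)
    then show ?thesis
      unfolding x_mon x_power_Suc using that shift[of a "inverse (p - 1)" p] mem
      by (auto intro!: span_scale span_diff)
  qed
  have ym: "y * mon (a, n, k, l, m) \<in> ?S" if "(a, n, k, l, m) \<in> cone" for a n k l m
  proof -
    have mem: "mon (a, n - 1, k, l, m) \<in> ?S" "mon (a + 1, n - 1, k, l, m) \<in> ?S"
      using that by (auto intro!: base simp del: mon.simps)
    then show ?thesis
      unfolding y_mon x_power_pred using that shift[of a "inverse (p - 1)" 1] mem
      by (auto intro!: span_scale span_diff)
  qed
  have stvm: "s * mon a \<in> ?S" "t * mon a \<in> ?S" "v * mon a \<in> ?S" if "a \<in> cone" for a
  proof -
    obtain a' n k l m where a: "a = (a', n, k, l, m)" by (cases a)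
    have "mon (a', n, k + 1, l, m) \<in> ?S" "mon (a', n, k, l + 1, m) \<in> ?S" "mon (a', n, k, l, m + 1) \<in> ?S"
      using that by (auto intro!: base simp: a simp del: mon.simps)
    then show "s * mon a \<in> ?S" "t * mon a \<in> ?S" "v * mon a \<in> ?S"
      using that unfolding a
      by (simp_all add: s_mon t_mon v_mon span_scale del: mon.simps)
  qed
  show "1 \<in> ?S" using base[of "(0, 0, 0, 0, 0)"] by (simp add: x_power_def)
  show "u + w \<in> ?S" if "u \<in> ?S" "w \<in> ?S" for u w using that by (rule span_add)
  show "scale c u \<in> ?S" if "u \<in> ?S" for c u using that by (rule span_scale)
  have xym: "x * mon a \<in> ?S" "y * mon a \<in> ?S" if "a \<in> cone" for a
    using that xm ym by (cases a; blast)+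
  show "x * u \<in> ?S" "y * u \<in> ?S" "s * u \<in> ?S" "t * u \<in> ?S" "v * u \<in> ?S" if "u \<in> ?S" for u
    using closed[OF that] xym stvm by blast+
qed

lemma expansion:
  obtains f where "keys f \<subseteq> cone" "u = lincomb mon f"
proof -
  have "\<exists>f. keys f \<subseteq> cone \<and> u = lincomb mon f"
    using span_mon[of u]
  proof (induction rule: span_induct)
    case base
    show ?case unfolding subspace_def
    proof (intro conjI ballI allI)
      show "0 \<in> {u. \<exists>f. keys f \<subseteq> cone \<and> u = lincomb mon f}"
        by (auto intro: exI[of _ 0])
    next
      fix u w
      assume "u \<in> {u. \<exists>f. keys f \<subseteq> cone \<and> u = lincomb mon f}"
        and "w \<in> {u. \<exists>f. keys f \<subseteq> cone \<and> u = lincomb mon f}"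
      then obtain f g where "keys f \<subseteq> cone" "u = lincomb mon f"
        "keys g \<subseteq> cone" "w = lincomb mon g" by blast
      then have "keys (f + g) \<subseteq> cone \<and> u + w = lincomb mon (f + g)"
        using keys_add[of f g] by (auto simp: lincomb_add)
      then show "u + w \<in> {u. \<exists>f. keys f \<subseteq> cone \<and> u = lincomb mon f}" by blast
    next
      fix c u
      assume "u \<in> {u. \<exists>f. keys f \<subseteq> cone \<and> u = lincomb mon f}"
      then obtain f where "keys f \<subseteq> cone" "u = lincomb mon f" by blast
      then have "keys (coeff_scale c f) \<subseteq> cone \<and> scale c u = lincomb mon (coeff_scale c f)"
        by (auto simp: lincomb_coeff_scale in_keys_iff)
      then show "scale c u \<in> {u. \<exists>f. keys f \<subseteq> cone \<and> u = lincomb mon f}" by blast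
    qed
  next
    case (step w)
    then obtain a where "a \<in> cone" "w = mon a" by auto
    then have "keys (single a (1::'k)) \<subseteq> cone \<and> w = lincomb mon (single a 1)"
      by simp
    then show ?case by blast
  qed
  then show ?thesis using that by blast
qed

end

section \<open>The monomial basis and its filtrations\<close>

context Apq_poly
begin

abbreviation low_order :: "expo \<Rightarrow> int \<times> int \<times> expo" where
  "low_order \<equiv> lexw fst fst"
abbreviation high_order :: "expo \<Rightarrow> int \<times> int \<times> expo" where
  "high_order \<equiv> lexw (\<lambda>a. - ez a) (\<lambda>a. - ez a)"

lemma lowest_mult:
  assumes "additive w1" "additive w2"
    and "lowest (lexw w1 w2) (\<Phi> u) a" "lowest (lexw w1 w2) (\<Phi> u') b"
  shows "lookup (\<Phi> (u * u')) (a + b) =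
      lookup (\<Phi> u) a * lookup (\<Phi> u') b * qlam p q a b"
    and "lowest (lexw w1 w2) (\<Phi> (u * u')) (a + b)"
  using E.lowest_tmul[OF translation_order_lexw[OF assms(1,2)] assms(3,4)] by (simp_all add: \<Phi>_mult)

text \<open>The image of \<open>u\<close> has exponents that differ only in the power of \<open>z\<close>, which ranges from that of \<open>a\<close> to
  that of \<open>b\<close>, both ends being attained. The image of a power of \<open>y\<close> is of this kind: up to a scalar it
  is a product of factors \<open>cz - 1\<close> times a power of \<open>x\<close>.\<close>

definition spread :: "'c \<Rightarrow> expo \<Rightarrow> expo \<Rightarrow> bool" where
  "spread u a b \<longleftrightarrow> lowest low_order (\<Phi> u) a \<and> lowest high_order (\<Phi> u) b \<and>
     (\<forall>c\<in>supp u. snd c = snd a)"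

lemma spread_mult:
  assumes "spread u a b" "spread u' a' b'"
  shows "spread (u * u') (a + a') (b + b')"
proof -
  have "snd c = snd (a + a')" if "c \<in> supp (u * u')" for c
    using that assms unfolding \<Phi>_mult spread_def by (metis E.keys_tmulE snd_add)
  then show ?thesis
    using assms lowest_mult(2)[OF additive_weights(1,1), of u a u' a']
      lowest_mult(2)[OF additive_weights(2,2), of u b u' b']
    unfolding spread_def by blast
qed

lemma spread_single:
  assumes "\<Phi> u = single a c" "c \<noteq> 0"
  shows "spread u a a"
  using assms by (simp add: spread_def lowest_def)

lemma spread_one: "spread 1 0 0"
  using spread_single[of 1 0 1] by (simp add: \<Phi>_one)

lemma spread_power:
  assumes "spread u (a, n, k, l, m) (b, n, k, l, m)"
  shows "spread (u ^ j) (int j * a, int j * n, int j * k, int j * l, int j * m)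
    (int j * b, int j * n, int j * k, int j * l, int j * m)"
proof (induction j)
  case 0
  show ?case using spread_one by (simp add: zero_prod_def)
next
  case (Suc j)
  have "(int (Suc j) * a, int (Suc j) * n, int (Suc j) * k, int (Suc j) * l, int (Suc j) * m) =
      (a, n, k, l, m) + (int j * a, int j * n, int j * k, int j * l, int j * m)" for a
    by (simp add: algebra_simps)
  then show ?case using spread_mult[OF assms Suc] by simp
qed

lemma keys_y: "supp y = {(0, -1, 0, 0, 0), (1, -1, 0, 0, 0)}"
  using p_diff_1 by (auto simp: \<Phi>_y in_keys_iff lookup_minus lookup_single when_def split: if_splits)

lemma spread_y: "spread y (0, -1, 0, 0, 0) (1, -1, 0, 0, 0)"
  by (simp add: spread_def lowest_def lexw_def keys_y)

fun top_expo :: "expo \<Rightarrow> expo" where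
  "top_expo (a, n, k, l, m) = (a + max 0 (- n), n, k, l, m)"

lemma spread_x_power: "spread (x_power n) (0, n, 0, 0, 0) (max 0 (- n), n, 0, 0, 0)"
proof (cases "0 \<le> n")
  case True
  then show ?thesis
    using spread_power[OF spread_single[OF \<Phi>_x], of "nat n"] by (simp add: x_power_def)
next
  case False
  then show ?thesis
    using spread_power[OF spread_y, of "nat (- n)"] by (simp add: x_power_def)
qed

lemma spread_mon:
  assumes "a \<in> cone"
  shows "spread (mon a) a (top_expo a)"
proof -
  obtain a' n k l m where a: "a = (a', n, k, l, m)" by (cases a)
  note pow = spread_power[OF spread_single]
  show ?thesis
    using spread_mult[OF spread_mult[OF spread_mult[OF spread_mult[OF pow[OF \<Phi>_z, of "nat a'"] spread_x_power[of n]]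
      pow[OF \<Phi>_s, of "nat k"]] pow[OF \<Phi>_t, of "nat l"]] pow[OF \<Phi>_v, of "nat m"]] assms
    by (simp add: a)
qed

text \<open>Among the monomials of an expansion that differ from a given one only in the power of \<open>z\<close>, the one
  of largest weight \<open>w\<close> has an extreme exponent \<open>h b\<close> which no other monomial reaches, so that it cannot
  cancel. The weight is the negative of the power of \<open>z\<close> for the lowest exponents and this power itself
  for the highest ones.\<close>

lemma extremal_key:
  fixes h :: "expo \<Rightarrow> expo" and w :: "expo \<Rightarrow> int"
  assumes f: "keys f \<subseteq> cone" and a: "a \<in> keys f"
    and key: "\<And>b. b \<in> cone \<Longrightarrow> h b \<in> supp (mon b)"
    and fibre: "\<And>b c. b \<in> cone \<Longrightarrow> c \<in> cone \<Longrightarrow> snd b = snd c \<Longrightarrow> h b \<in> supp (mon c) \<Longrightarrow>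
      w c \<le> w b \<Longrightarrow> b = c"
    and snd_h: "\<And>b. snd (h b) = snd b"
  obtains b where "b \<in> keys f" "snd b = snd a" "w a \<le> w b"
    "h b \<in> supp (lincomb mon f)"
proof -
  let ?K = "{b \<in> keys f. snd b = snd a}"
  have "?K \<noteq> {}" using a by blast
  then have "Max (w ` ?K) \<in> w ` ?K" by (intro Max_in) simp_all
  then obtain b where b: "b \<in> ?K" "w b = Max (w ` ?K)"
    by (metis (no_types, lifting) imageE)
  have max: "w c \<le> w b" if "c \<in> ?K" for c using that b(2) by simp
  have zero: "lookup (\<Phi> (mon c)) (h b) = 0"
    if "c \<in> keys f" "c \<noteq> b" for c
  proof (rule ccontr)
    assume "lookup (\<Phi> (mon c)) (h b) \<noteq> 0"
    then have c: "h b \<in> supp (mon c)" by (simp add: in_keys_iff)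
    have cone: "b \<in> cone" "c \<in> cone" using that b f by blast+
    have "snd (h b) = snd c"
      using c spread_mon[OF cone(2)] by (simp add: spread_def)
    then have snd: "snd b = snd c" using snd_h[of b] by simp
    then have "w c \<le> w b" using max[of c] b that(1) by simp
    with fibre[OF cone snd c] that(2) show False by simp
  qed
  have "lookup (\<Phi> (lincomb mon f)) (h b) =
      (\<Sum>c\<in>keys f. lookup f c * lookup (\<Phi> (mon c)) (h b))"
    by (simp add: lincomb_def \<Phi>_sum \<Phi>_scale lookup_sum)
  also have "\<dots> = (\<Sum>c\<in>keys f. if c = b then
      lookup f b * lookup (\<Phi> (mon b)) (h b) else 0)"
    using zero by (intro sum.cong) auto
  also have "\<dots> = lookup f b * lookup (\<Phi> (mon b)) (h b)"
    using b by simp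
  also have "\<dots> \<noteq> 0"
    using b key[of b] f by (metis (no_types, lifting) in_keys_iff mem_Collect_eq no_zero_divisors subsetD)
  finally have "h b \<in> supp (lincomb mon f)" by (simp add: in_keys_iff)
  moreover have "w a \<le> w b" using max[of a] a by simp
  ultimately show ?thesis using b by (intro that[of b]) simp_all
qed


lemma lowest_key:
  assumes "keys f \<subseteq> cone" "a \<in> keys f"
  obtains b where "b \<in> supp (lincomb mon f)" "snd b = snd a" "ez b \<le> ez a"
proof -
  have 1: "b \<in> supp (mon b)" if "b \<in> cone" for b
    using spread_mon[OF that] by (simp add: spread_def lowest_def)
  have 2: "b = c" if "c \<in> cone" "snd b = snd c" "b \<in> supp (mon c)" "- ez c \<le> - ez b" for b c
  proof (rule prod_eqI)
    have "low_order c \<le> low_order b"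
      using spread_mon[OF that(1)] that(3) by (simp add: spread_def lowest_def)
    from lexw_le_D(1)[OF this] show "ez b = ez c" using that(4) by simp
  qed fact
  obtain b where b: "b \<in> keys f" "snd b = snd a" "- ez a \<le> - ez b"
    "id b \<in> supp (lincomb mon f)"
    by (rule extremal_key[OF assms, of id "\<lambda>b. - ez b"]) (use 1 2 in \<open>simp_all only: id_apply\<close>)
  show ?thesis by (rule that[of b]) (use b in simp_all)
qed

lemma highest_key:
  assumes "keys f \<subseteq> cone" "a \<in> keys f"
  obtains b where "top_expo b \<in> supp (lincomb mon f)" "snd b = snd a" "ez a \<le> ez b"
proof -
  have snd_top: "snd (top_expo b) = snd b" for b by (cases b) simp
  have 1: "top_expo b \<in> supp (mon b)" if "b \<in> cone" for b
    using spread_mon[OF that] by (simp add: spread_def lowest_def)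
  have ez_top: "ez (top_expo b) \<le> ez (top_expo c) \<Longrightarrow> snd b = snd c \<Longrightarrow> ez b \<le> ez c" for b c
    by (cases b; cases c) simp
  have 2: "b = c" if "c \<in> cone" "snd b = snd c" "top_expo b \<in> supp (mon c)" "ez c \<le> ez b" for b c
  proof (rule prod_eqI)
    have "high_order (top_expo c) \<le> high_order (top_expo b)"
      using spread_mon[OF that(1)] that(3) by (simp add: spread_def lowest_def)
    from lexw_le_D(1)[OF this] have "ez (top_expo b) \<le> ez (top_expo c)" by simp
    from ez_top[OF this that(2)] show "ez b = ez c" using that(4) by simp
  qed fact
  obtain b where b: "b \<in> keys f" "snd b = snd a" "ez a \<le> ez b"
    "top_expo b \<in> supp (lincomb mon f)"
    by (rule extremal_key[OF assms, of top_expo ez]) (use 1 2 snd_top in \<open>assumption | blast\<close>)+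
  show ?thesis by (rule that[of b]) (use b in simp_all)
qed

text \<open>The degree of the highest exponent is the degree of the monomial in the generators, which is
  nonnegative although \<open>deg\<close> itself takes negative values.\<close>

lemma deg_top_expo: "deg (top_expo b) = 2 * ez b + \<bar>fst (snd b)\<bar> + es b + et b + ev b"
  by (cases b) (auto simp: deg_def)

lemma keys_cone: "supp u \<subseteq> cone"
proof -
  have add: "keys (f + g) \<subseteq> cone" if "keys f \<subseteq> cone" "keys g \<subseteq> cone"
    for f g :: "expo \<Rightarrow>\<^sub>0 'k" using that keys_add[of f g] by blast
  have cone_add: "a + b \<in> cone" if "a \<in> cone" "b \<in> cone" for a b
    using that by (cases a; cases b) auto
  have mult: "supp (u * w) \<subseteq> cone"
    if "supp u \<subseteq> cone" "supp w \<subseteq> cone" for u w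
    unfolding \<Phi>_mult by (rule E.keys_tmul_subset[OF that cone_add])
  have scale: "supp (scale c u) \<subseteq> cone" if "supp u \<subseteq> cone" for c u
    using that by (auto simp: \<Phi>_scale in_keys_iff)
  show ?thesis
    by (rule generated[of "\<lambda>u. supp u \<subseteq> cone"])
      (simp_all add: \<Phi>_add add mult scale keys_y \<Phi>_x \<Phi>_s \<Phi>_t \<Phi>_v \<Phi>_one zero_prod_def)
qed

lemma \<Phi>_eq_zero_iff [simp]: "\<Phi> u = 0 \<longleftrightarrow> u = 0"
proof
  assume 0: "\<Phi> u = 0"
  obtain f where f: "keys f \<subseteq> cone" "u = lincomb mon f" by (rule expansion)
  then have "keys f = {}"
    using 0 lowest_key[OF f(1)] by (metis all_not_in_conv keys_zero)
  with f show "u = 0" by simp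
qed simp

lemma domain_iff: "(u::'c) * w = 0 \<longleftrightarrow> u = 0 \<or> w = 0"
proof
  assume 0: "u * w = 0"
  show "u = 0 \<or> w = 0"
  proof (rule ccontr)
    assume "\<not> (u = 0 \<or> w = 0)"
    then obtain a b where "lowest low_order (\<Phi> u) a" "lowest low_order (\<Phi> w) b"
      using lowest_exists[of "\<Phi> u" low_order] lowest_exists[of "\<Phi> w" low_order] by auto
    from lowest_mult(2)[OF additive_weights(1,1) this] show False by (simp add: 0 lowest_def)
  qed
qed auto

lemma cancel_left: "(u::'c) * w = u * w' \<Longrightarrow> u \<noteq> 0 \<Longrightarrow> w = w'"
  using domain_iff[of u "w - w'"] by (simp add: right_diff_distrib)

lemma in_subspace:
  assumes "keys f \<subseteq> cone" "\<And>a. a \<in> keys f \<Longrightarrow> mon a \<in> S" "subspace S"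
  shows "lincomb mon f \<in> S"
  unfolding lincomb_def using assms by (intro subspace_sum subspace_scale) auto

lemma subspace_left_multiples: "subspace (range ((*) g))"
proof (rule subspaceI)
  show "0 \<in> range ((*) g)" by (rule range_eqI[of _ _ 0]) simp
  show "u + w \<in> range ((*) g)" if "u \<in> range ((*) g)" "w \<in> range ((*) g)" for u w
    using that by (auto simp flip: distrib_left)
  show "scale c u \<in> range ((*) g)" if "u \<in> range ((*) g)" for c u
    using that by (auto simp: scale_mult_right)
qed

text \<open>A lower bound for a weight on the support of \<open>\<Phi> u\<close> passes to the monomials of \<open>u\<close>, because the
  lowest exponent belonging to each of them survives in \<open>\<Phi> u\<close>.\<close>

lemma multiple_if:
  fixes w :: "expo \<Rightarrow> int"
  assumes "\<And>a. a \<in> cone \<Longrightarrow> 1 \<le> w a \<Longrightarrow> mon a \<in> range ((*) g)"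
    and keys: "\<And>a. a \<in> supp u \<Longrightarrow> 1 \<le> w a"
    and w: "\<And>a b. snd b = snd a \<Longrightarrow> ez b \<le> ez a \<Longrightarrow> w b \<le> w a"
  obtains u' where "u = g * u'"
proof -
  obtain f where f: "keys f \<subseteq> cone" "u = lincomb mon f" by (rule expansion)
  have "1 \<le> w a" if a: "a \<in> keys f" for a
  proof -
    obtain b where b: "b \<in> supp u" "snd b = snd a" "ez b \<le> ez a"
      unfolding f(2) by (rule lowest_key[OF f(1) a])
    from keys[OF b(1)] w[OF b(2,3)] show ?thesis by simp
  qed
  then have "u \<in> range ((*) g)"
    unfolding f(2) using assms(1) f(1) by (intro in_subspace subspace_left_multiples) auto
  with that show ?thesis by auto
qed

lemma z_multiple_if:
  assumes "\<And>a. a \<in> supp u \<Longrightarrow> 1 \<le> ez a"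
  obtains u' where "u = z * u'"
proof (rule multiple_if[of ez z u, OF _ assms])
  fix a assume a: "a \<in> cone" "1 \<le> ez a"
  obtain a' n k l m where "a = (a', n, k, l, m)" by (cases a)
  with a show "mon a \<in> range ((*) z)"
    using z_mon[of "a' - 1" n k l m] by (metis add_diff_cancel_right' diff_add_cancel diff_ge_0_iff_ge fst_conv rangeI)
qed (use that in auto)

lemma s_multiple_if:
  assumes "\<And>a. a \<in> supp u \<Longrightarrow> 1 \<le> es a"
  obtains u' where "u = s * u'"
proof (rule multiple_if[of es s u, OF _ assms])
  fix a assume a: "a \<in> cone" "1 \<le> es a"
  obtain a' n k l m where "a = (a', n, k, l, m)" by (cases a)
  with a show "mon a \<in> range ((*) s)"
    using s_mon[of "k - 1" a' n l m] by (simp del: mon.simps) (metis rangeI)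
qed (use that in auto)

lemma t_multiple_if:
  assumes "\<And>a. a \<in> supp u \<Longrightarrow> 1 \<le> et a"
  obtains u' where "u = t * u'"
proof (rule multiple_if[of et t u, OF _ assms])
  fix a assume a: "a \<in> cone" "1 \<le> et a"
  obtain a' n k l m where a': "a = (a', n, k, l, m)" by (cases a)
  then have "mon a = scale (q ^ nat k) (t * mon (a', n, k, l - 1, m))"
    using a q0 t_mon[of "l - 1" a' n k m] by (simp add: power_inverse del: mon.simps)
  then show "mon a \<in> range ((*) t)"
    by (simp only: scale_out(2)[symmetric] scale_mult_right) (rule rangeI)
qed (use that in auto)

lemma scalar_if:
  assumes "\<And>a. a \<in> supp u \<Longrightarrow> deg a \<le> 0"
  obtains c where "u = scale c 1"
proof -
  obtain f where f: "keys f \<subseteq> cone" "u = lincomb mon f" by (rule expansion)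
  have "u \<in> span {1}" unfolding f(2)
  proof (intro in_subspace f subspace_span)
    fix a assume a: "a \<in> keys f"
    obtain b where b: "top_expo b \<in> supp u" "snd b = snd a" "ez a \<le> ez b"
      unfolding f(2) by (rule highest_key[OF f(1) a])
    have "a \<in> cone" using a f(1) by blast
    then have "a = 0"
      using assms[OF b(1)] b(2,3) deg_top_expo[of b] by (cases a; cases b) (simp add: zero_prod_def, arith)
    then show "mon a \<in> span {1}" by (simp add: zero_prod_def x_power_def span_base)
  qed
  then show ?thesis using that by (auto simp: span_singleton)
qed

lemma linear_if:
  assumes "\<And>a. a \<in> supp u \<Longrightarrow> deg a \<le> 1"
    and "\<And>a. a \<in> supp u \<Longrightarrow> ev a \<le> 0"
  shows "u \<in> span {1, x, y, s, t}"
proof -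
  obtain f where f: "keys f \<subseteq> cone" "u = lincomb mon f" by (rule expansion)
  show ?thesis unfolding f(2)
  proof (intro in_subspace f subspace_span)
    fix a assume a: "a \<in> keys f"
    obtain b where b: "top_expo b \<in> supp u" "snd b = snd a" "ez a \<le> ez b"
      unfolding f(2) by (rule highest_key[OF f(1) a])
    obtain a1 n k l m where a': "a = (a1, n, k, l, m)" by (cases a)
    obtain b1 where b': "b = (b1, n, k, l, m)" using b(2) a' by (cases b) simp
    have "a \<in> cone" using a f(1) by blast
    then have "0 \<le> a1" "0 \<le> k" "0 \<le> l" "0 \<le> m" "m \<le> 0" "a1 \<le> b1"
      "2 * b1 + \<bar>n\<bar> + k + l + m \<le> 1"
      using assms[OF b(1)] b(3) deg_top_expo[of b] by (simp_all add: a' b')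
    then have "a1 = 0" "m = 0" "\<bar>n\<bar> + k + l \<le> 1" "0 \<le> k" "0 \<le> l" by linarith+
    moreover from this have "n = -1 \<or> n = 0 \<or> n = 1" "k = 0 \<or> k = 1" "l = 0 \<or> l = 1" by linarith+
    ultimately have "a \<in> {(0, 0, 0, 0, 0), (0, 1, 0, 0, 0), (0, -1, 0, 0, 0), (0, 0, 1, 0, 0), (0, 0, 0, 1, 0)}"
      unfolding a' by (elim disjE; simp)
    then have "mon a \<in> {1, x, y, s, t}" by (auto simp: x_power_def)
    then show "mon a \<in> span {1, x, y, s, t}" by (rule span_base)
  qed
qed

lemma key_deg_nonneg:
  assumes "u \<noteq> 0"
  obtains a where "a \<in> supp u" "0 \<le> deg a"
proof -
  obtain f where f: "keys f \<subseteq> cone" "u = lincomb mon f" by (rule expansion)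
  then have "f \<noteq> 0" using assms by auto
  then obtain a where a: "a \<in> keys f" by (metis all_not_in_conv keys_eq_empty)
  obtain b where b: "top_expo b \<in> supp u" "snd b = snd a" "ez a \<le> ez b"
    unfolding f(2) by (rule highest_key[OF f(1) a])
  have "a \<in> cone" using a f(1) by blast
  then have "0 \<le> deg (top_expo b)"
    using b(2,3) deg_top_expo[of b] by (cases a; cases b) simp
  with b(1) that show ?thesis by blast
qed

text \<open>Terms of top weight multiply without cancellation in the quantum torus: they contain the lowest
  terms for the order given by the negative weight.\<close>

lemma weight_split:
  fixes w :: "expo \<Rightarrow> int"
  assumes "additive w" "u \<noteq> 0" "u' \<noteq> 0"
  obtains a b where "a \<in> supp u" "\<forall>c\<in>supp u. w c \<le> w a"
    "b \<in> supp u'" "\<forall>c\<in>supp u'. w c \<le> w b"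
    "a + b \<in> supp (u * u')"
proof -
  have add: "additive (\<lambda>a. - w a)" using assms(1) by (simp add: additive_def)
  let ?o = "lexw (\<lambda>a. - w a) (\<lambda>a. - w a)"
  obtain a b where ab: "lowest ?o (\<Phi> u) a" "lowest ?o (\<Phi> u') b"
    using lowest_exists[of "\<Phi> u" ?o] lowest_exists[of "\<Phi> u'" ?o] assms by auto
  show ?thesis
  proof
    show "a + b \<in> supp (u * u')"
      using lowest_mult(2)[OF add add ab] by (simp add: lowest_def)
    show "\<forall>c\<in>supp u. w c \<le> w a"
    proof
      fix c assume "c \<in> supp u"
      then show "w c \<le> w a"
        using ab(1) lexw_le_D(1)[of "\<lambda>a. - w a" "\<lambda>a. - w a" a c] by (simp add: lowest_def)
    qed
    show "\<forall>c\<in>supp u'. w c \<le> w b"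
    proof
      fix c assume "c \<in> supp u'"
      then show "w c \<le> w b"
        using ab(2) lexw_le_D(1)[of "\<lambda>a. - w a" "\<lambda>a. - w a" b c] by (simp add: lowest_def)
    qed
  qed (use ab in \<open>simp_all add: lowest_def\<close>)
qed

text \<open>Degrees are additive and the top degree of a nonzero element is at least zero.\<close>

lemma unit_scalar:
  assumes "u * u' = 1"
  obtains c where "c \<noteq> 0" "u = scale c 1"
proof -
  have 1: "(1::'c) \<noteq> 0" using \<Phi>_one by force
  then have nz: "u \<noteq> 0" "u' \<noteq> 0" using assms by auto
  obtain a b where ab: "\<forall>c\<in>supp u. deg c \<le> deg a"
    "\<forall>c\<in>supp u'. deg c \<le> deg b"
    "a + b \<in> supp (u * u')"
    by (rule weight_split[OF additive_weights(6) nz])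
  have "a + b = 0" using ab(3) by (simp add: assms \<Phi>_one)
  then have "deg a + deg b = 0"
    using additive.add[OF additive_weights(6), of a b] by (simp add: deg_def)
  moreover have "0 \<le> deg b"
  proof -
    obtain c where "c \<in> supp u'" "0 \<le> deg c" by (rule key_deg_nonneg[OF nz(2)])
    with bspec[OF ab(2), of c] show ?thesis by simp
  qed
  ultimately have "deg c \<le> 0" if "c \<in> supp u" for c
    using bspec[OF ab(1) that] by simp
  then obtain c where "u = scale c 1" using scalar_if by metis
  with nz(1) that show ?thesis by (metis scale_zero_left)
qed

end

section \<open>Automorphisms preserve the two commutators\<close>

lemma two_equations_three_unknowns:
  fixes d1 :: "'k::field"
  obtains c1 c2 c3 where "c1 \<noteq> 0 \<or> c2 \<noteq> 0 \<or> c3 \<noteq> 0"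
    "c1 * d1 + c2 * d2 + c3 * d3 = 0" "c1 * e1 + c2 * e2 + c3 * e3 = 0"
proof -
  have elim: "\<exists>c1 c2 c3. (c1 \<noteq> 0 \<or> c2 \<noteq> 0 \<or> c3 \<noteq> 0) \<and>
      c1 * d1 + c2 * d2 + c3 * d3 = 0 \<and> c1 * e1 + c2 * e2 + c3 * e3 = 0"
    if "d3 \<noteq> 0" for d1 d2 d3 e1 e2 e3 :: 'k
  proof -
    let ?f1 = "e1 * d3 - d1 * e3" and ?f2 = "e2 * d3 - d2 * e3"
    obtain c1 c2 where c: "c1 \<noteq> 0 \<or> c2 \<noteq> 0" "c1 * ?f1 + c2 * ?f2 = 0"
    proof (cases "?f1 = 0")
      case True then show ?thesis using that[of 1 0] by simp
    next
      case False then show ?thesis using that[of ?f2 "- ?f1"] by (simp add: algebra_simps)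
    qed
    let ?c3 = "- (c1 * d1 + c2 * d2) / d3"
    have "c1 * d1 + c2 * d2 + ?c3 * d3 = 0" using that by simp
    moreover have "(c1 * e1 + c2 * e2 + ?c3 * e3) * d3 = 0"
      using c(2) that by (simp add: field_simps)
    ultimately show ?thesis using c(1) that by (metis mult_eq_0_iff)
  qed
  have "\<exists>c1 c2 c3. (c1 \<noteq> 0 \<or> c2 \<noteq> 0 \<or> c3 \<noteq> 0) \<and>
      c1 * d1 + c2 * d2 + c3 * d3 = 0 \<and> c1 * e1 + c2 * e2 + c3 * e3 = 0"
  proof (cases "d3 = 0 \<and> e3 = 0")
    case True
    then show ?thesis by (intro exI[of _ 0] exI[of _ 1]) simp
  next
    case False
    then show ?thesis using elim[of d3 d1 d2 e1 e2 e3] elim[of e3 e1 e2 d1 d2 d3] by blast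
  qed
  with that show ?thesis by blast
qed

lemma alg_autI:
  assumes "unital_algebra scale"
    and hom: "\<And>u w. f (u + w) = f u + f w" "\<And>c u. f (scale c u) = scale c (f u)"
      "\<And>u w. f (u * w) = f u * f w" "f 1 = 1"
    and "bij f"
  shows "f \<in> alg_aut scale"
proof -
  interpret unital_algebra scale by fact
  have "Vector_Spaces.linear scale scale f"
    by (intro linear_module_homI module_hom.intro module_hom_axioms.intro module_axioms hom)
  with assms show ?thesis by (simp add: alg_aut_def)
qed

lemma alg_autD:
  assumes "unital_algebra scale" "f \<in> alg_aut scale"
  shows "f (u + w) = f u + f w" "f (scale c u) = scale c (f u)" "f (u * w) = f u * f w" "f 1 = 1"
    "f (u - w) = f u - f w" "f 0 = 0" "f u = f w \<longleftrightarrow> u = w"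
proof -
  interpret unital_algebra scale by fact
  interpret f: Vector_Spaces.linear scale scale f using assms(2) by (simp add: alg_aut_def)
  show "f (u + w) = f u + f w" "f (scale c u) = scale c (f u)" "f (u - w) = f u - f w" "f 0 = 0"
    by (rule f.add f.scale f.diff f.zero)+
  show "f (u * w) = f u * f w" "f 1 = 1" "f u = f w \<longleftrightarrow> u = w"
    using assms(2) by (auto simp: alg_aut_def bij_def inj_eq)
qed

lemma alg_aut_inverse:
  assumes "unital_algebra scale" "f \<in> alg_aut scale"
  obtains g where "g \<in> alg_aut scale" "\<And>u. g (f u) = u" "\<And>u. f (g u) = u"
proof -
  interpret G: group "aut_group scale" by (rule group_aut_group) fact
  have f: "f \<in> carrier (aut_group scale)" using assms(2) by (simp add: aut_group_def)
  define g where "g = inv\<^bsub>aut_group scale\<^esub> f"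
  have "g \<in> carrier (aut_group scale)" "g \<circ> f = id" "f \<circ> g = id"
    using G.inv_closed[OF f] G.l_inv[OF f] G.r_inv[OF f] by (simp_all add: g_def aut_group_def)
  then show ?thesis using that[of g] by (auto simp: aut_group_def fun_eq_iff)
qed

text \<open>The functional of \<open>trivial_at\<close> evaluates at \<open>x = 1\<close>, \<open>z = s = t = v = 0\<close>.\<close>

definition trivial_at :: "expo \<Rightarrow> 'k::field" where
  "trivial_at a = (if ez a = 0 \<and> es a = 0 \<and> et a = 0 \<and> ev a = 0 then 1 else 0)"

text \<open>For \<open>\<kappa>\<close> and \<open>\<kappa>'\<close> the exponents of \<open>s\<close> and \<open>t\<close>, in either order, the functional of \<open>tangent\<close> is the
  derivation \<open>c1 \<partial>\<^sub>x + c2 \<partial> + c3 \<partial>\<^sub>v\<close> at the point \<open>x = 1\<close>, \<open>z = s = t = v = 0\<close>, where \<open>\<partial>\<close>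
  differentiates with respect to the variable of \<open>\<kappa>'\<close>, after setting \<open>z\<close> and the variable of \<open>\<kappa>\<close> to
  zero.\<close>

definition tangent ::
    "(expo \<Rightarrow> int) \<Rightarrow> (expo \<Rightarrow> int) \<Rightarrow> 'k \<Rightarrow> 'k \<Rightarrow> 'k \<Rightarrow> expo \<Rightarrow> 'k::field" where
  "tangent \<kappa> \<kappa>' c1 c2 c3 a =
     (if ez a = 0 \<and> \<kappa> a = 0 then
        if \<kappa>' a = 0 \<and> ev a = 0 then c1 * of_int (fst (snd a))
        else if \<kappa>' a = 1 \<and> ev a = 0 then c2
        else if \<kappa>' a = 0 \<and> ev a = 1 then c3 else 0
      else 0)"

lemma pairing_tangent:
  "pairing (tangent \<kappa> \<kappa>' c1 c2 c3) f = c1 * pairing (tangent \<kappa> \<kappa>' 1 0 0) f +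
     c2 * pairing (tangent \<kappa> \<kappa>' 0 1 0) f + c3 * pairing (tangent \<kappa> \<kappa>' 0 0 1) f"
  unfolding pairing_def sum_distrib_left sum.distrib[symmetric]
  by (intro sum.cong) (auto simp: tangent_def)

context Apq_poly
begin

definition point :: "'c \<Rightarrow> 'k" where "point u = pairing trivial_at (\<Phi> u)"

lemma point_mult: "point (u * w) = point u * point w"
proof -
  have "trivial_at (a + b) * qlam p q a b = trivial_at a * trivial_at b + 0 * 0"
    if "a \<in> cone" "b \<in> cone" for a b
    using that by (cases a; cases b) (auto simp: trivial_at_def add_nonneg_eq_0_iff)
  from E.pairing_tmul[OF keys_cone[of u] keys_cone[of w] this] show ?thesis
    by (simp add: point_def \<Phi>_mult pairing_def[of "\<lambda>_. 0"])
qed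

lemma point_simps [simp]: "point (u + w) = point u + point w" "point (scale c u) = c * point u"
  "point 1 = 1"
  using pairing_single[of "trivial_at" "0 :: expo" 1]
  by (simp_all add: point_def \<Phi>_add \<Phi>_scale \<Phi>_one pairing_add pairing_scale trivial_at_def)

lemma tangent_mult:
  assumes "(\<kappa>, \<kappa>') \<in> {(es, et), (et, es)}"
  shows "pairing (tangent \<kappa> \<kappa>' c1 c2 c3) (\<Phi> (u * w)) =
    pairing (tangent \<kappa> \<kappa>' c1 c2 c3) (\<Phi> u) * point w +
    point u * pairing (tangent \<kappa> \<kappa>' c1 c2 c3) (\<Phi> w)"
proof -
  have "tangent \<kappa> \<kappa>' c1 c2 c3 (a + b) * qlam p q a b =
      tangent \<kappa> \<kappa>' c1 c2 c3 a * trivial_at b + trivial_at a * tangent \<kappa> \<kappa>' c1 c2 c3 b"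
    if "a \<in> cone" "b \<in> cone" for a b
  proof -
    obtain a' n k l m where a: "a = (a', n, k, l, m)" by (cases a)
    obtain b' n' k' l' m' where b: "b = (b', n', k', l', m')" by (cases b)
    have 0: "i + j = 0 \<longleftrightarrow> i = 0 \<and> j = 0" "i + j = 1 \<longleftrightarrow> i = 0 \<and> j = 1 \<or> i = 1 \<and> j = 0"
      if "0 \<le> i" "0 \<le> j" for i j :: int using that by arith+
    have "0 \<le> a'" "0 \<le> k" "0 \<le> l" "0 \<le> m" "0 \<le> b'" "0 \<le> k'" "0 \<le> l'" "0 \<le> m'"
      using that by (simp_all add: a b)
    note sums = 0[OF this(1,5)] 0[OF this(2,6)] 0[OF this(3,7)] 0[OF this(4,8)]
    note defs = a b tangent_def trivial_at_def fst_conv snd_conv add_Pair qlam.simps sums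
    have zero: "tangent \<kappa> \<kappa>' c1 c2 c3 (a + b) * qlam p q a b =
        tangent \<kappa> \<kappa>' c1 c2 c3 a * trivial_at b + trivial_at a * tangent \<kappa> \<kappa>' c1 c2 c3 b"
      if "ez (a + b) \<noteq> 0 \<or> \<kappa> (a + b) \<noteq> 0"
        "(ez a \<noteq> 0 \<or> \<kappa> a \<noteq> 0) \<or> (ez b \<noteq> 0 \<or> \<kappa> b \<noteq> 0)"
    proof -
      have 1: "tangent \<kappa> \<kappa>' c1 c2 c3 c = 0" "trivial_at c = (0::'k)" if "ez c \<noteq> 0 \<or> \<kappa> c \<noteq> 0" for c
        using that assms by (auto simp: tangent_def trivial_at_def)
      show ?thesis using 1[OF that(1)] that(2) 1[of a] 1[of b] by (elim disjE) simp_all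
    qed
    consider "\<kappa> = es" "\<kappa>' = et" | "\<kappa> = et" "\<kappa>' = es" using assms by blast
    then show ?thesis
    proof cases
      case 1
      show ?thesis
      proof (cases "a' = 0 \<and> b' = 0 \<and> k = 0 \<and> k' = 0")
        case True
        then show ?thesis unfolding 1 defs
          by (cases "l = 0"; cases "l' = 0"; cases "m = 0"; cases "m' = 0") (simp_all add: distrib_left)
      next
        case False
        then show ?thesis using sums by (intro zero) (auto simp: 1 a b)
      qed
    next
      case 2
      show ?thesis
      proof (cases "a' = 0 \<and> b' = 0 \<and> l = 0 \<and> l' = 0")
        case True
        then show ?thesis unfolding 2 defs
          by (cases "k = 0"; cases "k' = 0"; cases "m = 0"; cases "m' = 0") (simp_all add: distrib_left)
      next
        case False
        then show ?thesis using sums by (intro zero) (auto simp: 2 a b)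
      qed
    qed
  qed
  from E.pairing_tmul[OF keys_cone[of u] keys_cone[of w] this] show ?thesis
    by (simp add: point_def \<Phi>_mult)
qed

text \<open>Evaluation turns \<open>\<phi>(x)\<phi>(y) = p \<phi>(y)\<phi>(x) + 1\<close> into \<open>(1 - p) point(\<phi> x) point(\<phi> y) = 1\<close>.\<close>

lemma point_aut_x:
  assumes "\<phi> \<in> alg_aut scale"
  shows "point (\<phi> x) \<noteq> 0"
proof
  assume 0: "point (\<phi> x) = 0"
  have "point (\<phi> (x * y)) = point (\<phi> (scale p (y * x) + 1))" by (simp add: xy)
  with 0 show False
    by (simp add: alg_autD[OF unital_algebra_axioms assms] point_mult)
qed

text \<open>If some term of \<open>\<phi> z\<close> has no \<open>z\<close>, then the lowest terms of \<open>\<phi> z\<close> and \<open>\<phi> x\<close> commute, whereas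
  \<open>\<phi> x \<phi> z = p \<phi> z \<phi> x\<close>.\<close>

lemma aut_z_multiple:
  assumes \<phi>: "\<phi> \<in> alg_aut scale"
  obtains u where "\<phi> z = z * u"
proof (rule z_multiple_if[of "\<phi> z"])
  note aut = alg_autD[OF unital_algebra_axioms \<phi>]
  let ?w2 = "\<lambda>a. es a + et a"
  let ?o = "lexw ez ?w2"
  fix a0 assume a0: "a0 \<in> supp (\<phi> z)"
  show "1 \<le> ez a0"
  proof (rule ccontr)
    assume neg: "\<not> 1 \<le> ez a0"
    have "\<Phi> (\<phi> z) \<noteq> 0" using a0 by auto
    then obtain a where a: "lowest ?o (\<Phi> (\<phi> z)) a" using lowest_exists by blast
    \<comment> \<open>As \<open>point (\<phi> x)\<close> is nonzero, \<open>\<phi> x\<close> has a term in \<open>x\<close> alone; it bounds the lowest one.\<close>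
    obtain b0 where b0: "b0 \<in> supp (\<phi> x)" "ez b0 = 0" "es b0 = 0" "et b0 = 0"
    proof -
      have "\<exists>b\<in>supp (\<phi> x). trivial_at b \<noteq> (0::'k)"
        using point_aut_x[OF \<phi>] unfolding point_def pairing_def
        by (metis (no_types, lifting) mult_zero_right sum.neutral)
      with that show ?thesis by (auto simp: trivial_at_def split: if_splits)
    qed
    then have "\<Phi> (\<phi> x) \<noteq> 0" by auto
    then obtain b where b: "lowest ?o (\<Phi> (\<phi> x)) b" using lowest_exists by blast
    obtain a' n k l m where a': "a = (a', n, k, l, m)" by (cases a)
    obtain b' n' k' l' m' where b': "b = (b', n', k', l', m')" by (cases b)
    have cone: "a \<in> cone" "b \<in> cone" using a b keys_cone by (auto simp: lowest_def)
    have ab_le: "?o a \<le> ?o a0" "?o b \<le> ?o b0" using a b a0 b0(1) by (simp_all add: lowest_def)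
    have "a' = 0" using lexw_le_D(1)[OF ab_le(1)] neg cone by (simp add: a')
    have "b' = 0" using lexw_le_D(1)[OF ab_le(2)] b0 cone by (simp add: b')
    then have "k' + l' \<le> 0" using lexw_le_D(2)[OF ab_le(2)] b0 by (simp add: b')
    then have "k' = 0" "l' = 0" using cone by (simp_all add: b')
    have "\<phi> x * \<phi> z = scale p (\<phi> z * \<phi> x)"
      by (simp add: xz flip: aut)
    then have "lookup (\<Phi> (\<phi> x * \<phi> z)) (b + a) =
        p * lookup (\<Phi> (\<phi> z * \<phi> x)) (a + b)"
      by (simp add: \<Phi>_scale add.commute)
    then have "qlam p q b a = p * qlam p q a b"
      using a b lowest_mult(1)[OF additive_weights(1,7) a b] lowest_mult(1)[OF additive_weights(1,7) b a]
      by (simp add: lowest_def in_keys_iff)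
    then show False
      using p1 by (simp add: a' b' \<open>a' = 0\<close> \<open>b' = 0\<close> \<open>k' = 0\<close> \<open>l' = 0\<close>)
  qed
qed (use that in auto)

text \<open>If both \<open>\<phi>\<close> and its inverse map \<open>g\<close> to a multiple of \<open>g\<close>, then the two cofactors are units.\<close>

lemma scalar_from_inverse:
  assumes \<phi>: "\<phi> \<in> alg_aut scale" and "g \<noteq> 0"
    and multiple: "\<forall>\<psi>\<in>alg_aut scale. \<exists>u. \<psi> g = g * u"
  shows "\<exists>c. c \<noteq> 0 \<and> \<phi> g = scale c g"
proof -
  note aut = alg_autD[OF unital_algebra_axioms \<phi>]
  obtain \<psi> where \<psi>: "\<psi> \<in> alg_aut scale" "\<And>u. \<phi> (\<psi> u) = u"
    using alg_aut_inverse[OF unital_algebra_axioms \<phi>] by blast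
  obtain u where u: "\<phi> g = g * u" using multiple \<phi> by blast
  obtain w where w: "\<psi> g = g * w" using multiple \<psi>(1) by blast
  have "g * (u * \<phi> w) = g * 1"
    using \<psi>(2)[of g] by (simp add: w aut u mult.assoc)
  then have "u * \<phi> w = 1" using \<open>g \<noteq> 0\<close> by (rule cancel_left)
  then obtain c where "c \<noteq> 0" "u = scale c 1" by (rule unit_scalar)
  with u show ?thesis by (metis mult.right_neutral scale_mult_right)
qed

lemma z_nonzero: "z \<noteq> 0"
  using \<Phi>_z by (metis \<Phi>_zero one_neq_zero single_zero inj_single injD lookup_single_eq lookup_zero)

lemma aut_z:
  assumes "\<phi> \<in> alg_aut scale"
  obtains c where "c \<noteq> 0" "\<phi> z = scale c z"
proof -
  have "\<forall>\<psi>\<in>alg_aut scale. \<exists>u. \<psi> (z) = z * u"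
    using aut_z_multiple by blast
  from scalar_from_inverse[of \<phi> z, OF assms z_nonzero this] that show ?thesis by blast
qed

text \<open>Otherwise \<open>\<phi> s\<close> and \<open>\<phi> t\<close> vanish in the ring obtained by setting \<open>z\<close> and the variable of \<open>\<kappa>\<close> to zero.
  The tangent space of this ring has dimension three, so some nonzero tangent vector annihilates \<open>\<phi> x\<close>
  and \<open>\<phi> v\<close>. It then annihilates the images of all generators, hence everything, because \<open>\<phi>\<close> is
  surjective.\<close>

lemma special_key:
  assumes \<phi>: "\<phi> \<in> alg_aut scale" and \<kappa>: "(\<kappa>, \<kappa>') \<in> {(es, et), (et, es)}"
  obtains g a where "g \<in> {s, t}" "a \<in> supp (\<phi> g)" "ez a = 0" "\<kappa> a = 0"
proof -
  note aut = alg_autD[OF unital_algebra_axioms \<phi>]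
  have "\<exists>g\<in>{s, t}. \<exists>a\<in>supp (\<phi> g). ez a = 0 \<and> \<kappa> a = 0"
  proof (rule ccontr)
    assume neg: "\<not> ?thesis"
    obtain c1 c2 c3 where c: "c1 \<noteq> 0 \<or> c2 \<noteq> 0 \<or> c3 \<noteq> 0"
      "pairing (tangent \<kappa> \<kappa>' c1 c2 c3) (\<Phi> (\<phi> x)) = 0"
      "pairing (tangent \<kappa> \<kappa>' c1 c2 c3) (\<Phi> (\<phi> v)) = 0"
    proof -
      let ?d = "\<lambda>c1 c2 c3 u. pairing (tangent \<kappa> \<kappa>' c1 c2 c3) (\<Phi> (\<phi> u))"
      obtain c1 c2 c3 where "c1 \<noteq> 0 \<or> c2 \<noteq> 0 \<or> c3 \<noteq> 0"
        "c1 * ?d 1 0 0 x + c2 * ?d 0 1 0 x + c3 * ?d 0 0 1 x = 0"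
        "c1 * ?d 1 0 0 v + c2 * ?d 0 1 0 v + c3 * ?d 0 0 1 v = 0"
        by (rule two_equations_three_unknowns)
      then show ?thesis
        using that[of c1 c2 c3] by (simp only: pairing_tangent[of \<kappa> \<kappa>' c1 c2 c3])
    qed
    define D where "D u = pairing (tangent \<kappa> \<kappa>' c1 c2 c3) (\<Phi> u)" for u
    have D_mult: "D (u * w) = D u * point w + point u * D w" for u w
      unfolding D_def by (rule tangent_mult[OF \<kappa>])
    have D_simps: "D (u + w) = D u + D w" "D (scale b u) = b * D u" for u w b
      by (simp_all add: D_def \<Phi>_add \<Phi>_scale pairing_add pairing_scale)
    have D_one: "D 1 = 0" using D_mult[of 1 1]
      by (simp only: point_simps mult_1_left mult_1_right add_cancel_right_right)
    have zero: "D (\<phi> g) = 0 \<and> point (\<phi> g) = 0" if "g \<in> {s, t}" for g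
    proof -
      have "tangent \<kappa> \<kappa>' c1 c2 c3 a = 0 \<and> trivial_at a = (0::'k)" if "a \<in> supp (\<phi> g)" for a
      proof -
        have "\<not> (ez a = 0 \<and> \<kappa> a = 0)" using neg that \<open>g \<in> {s, t}\<close> by blast
        moreover have "\<kappa> = es \<or> \<kappa> = et" using \<kappa> by blast
        ultimately show ?thesis by (auto simp: tangent_def trivial_at_def)
      qed
      then show ?thesis by (simp add: D_def point_def pairing_def)
    qed
    have Dx: "D (\<phi> x) = 0" and Dv: "D (\<phi> v) = 0" using c by (simp_all add: D_def)
    \<comment> \<open>The relation between \<open>x\<close> and \<open>y\<close> makes \<open>\<phi> y\<close> the inverse of \<open>\<phi> x\<close> up to a scalar, to first order.\<close>
    have Dy: "D (\<phi> y) = 0"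
    proof -
      have "D (\<phi> (x * y)) = D (\<phi> (scale p (y * x) + 1))" by (simp add: xy)
      then have "(1 - p) * (point (\<phi> x) * D (\<phi> y)) = 0"
        by (simp add: aut D_mult D_simps Dx D_one algebra_simps)
      then show ?thesis using point_aut_x[OF \<phi>] p1 by simp
    qed
    have "D (\<phi> u) = 0" for u
      by (rule generated[of "\<lambda>u. D (\<phi> u) = 0"])
        (simp_all add: aut D_simps D_mult D_one Dx Dy Dv zero)
    then have D0: "D u = 0" for u
      using alg_aut_inverse[OF unital_algebra_axioms \<phi>] by metis
    have "c1 = 0" "c3 = 0" "c2 = 0"
      using D0[of x] D0[of v] D0[of s] D0[of t] \<kappa>
      by (auto simp: D_def \<Phi>_x \<Phi>_v \<Phi>_s \<Phi>_t tangent_def)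
    with c(1) show False by simp
  qed
  with that show ?thesis by blast
qed

lemma s_st: "s * (s * t) = scale q (s * t * s)"
proof -
  have "s * (s * t) = s * scale q (t * s)" by (simp only: st)
  then show ?thesis by (simp add: scale_out mult.assoc)
qed

lemma t_st: "t * (s * t) = scale (inverse q) (s * t * t)"
  by (simp add: ts scale_out flip: mult.assoc)

text \<open>By \<open>special_key\<close> the image of \<open>s\<close> or of \<open>t\<close> has a term free of \<open>z\<close> and of the variable of \<open>\<kappa>\<close>. If
  \<open>\<phi>(st)\<close> had a term free of the latter, the lowest terms of the two would commute, although the
  elements commute up to \<open>q\<close> or its inverse.\<close>

lemma aut_st_keys:
  assumes \<phi>: "\<phi> \<in> alg_aut scale" and \<kappa>: "(\<kappa>, \<kappa>') \<in> {(es, et), (et, es)}"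
    and a0: "a0 \<in> supp (\<phi> (s * t))"
  shows "1 \<le> \<kappa> a0"
proof (rule ccontr)
  assume neg: "\<not> 1 \<le> \<kappa> a0"
  note aut = alg_autD[OF unital_algebra_axioms \<phi>]
  let ?o = "lexw \<kappa> ez"
  have add: "additive \<kappa>" "additive ez" using \<kappa> additive_weights by auto
  obtain g b0 where g: "g \<in> {s, t}" and b0: "b0 \<in> supp (\<phi> g)" "ez b0 = 0" "\<kappa> b0 = 0"
    using special_key[OF \<phi> \<kappa>] by blast
  obtain r where r: "r \<noteq> 1" "g * (s * t) = scale r (s * t * g)"
    using g s_st t_st q1 by (metis inverse_eq_1_iff insertE singletonD)
  have "\<Phi> (\<phi> (s * t)) \<noteq> 0" "\<Phi> (\<phi> g) \<noteq> 0" using a0 b0 by auto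
  then obtain a b where a: "lowest ?o (\<Phi> (\<phi> (s * t))) a" and b: "lowest ?o (\<Phi> (\<phi> g)) b"
    using lowest_exists by metis
  obtain a' n k l m where a': "a = (a', n, k, l, m)" by (cases a)
  obtain b' n' k' l' m' where b': "b = (b', n', k', l', m')" by (cases b)
  have cone: "a \<in> cone" "b \<in> cone" using a b keys_cone by (auto simp: lowest_def)
  have nonneg: "0 \<le> \<kappa> a" "0 \<le> \<kappa> b" using cone \<kappa> by (auto simp: a' b')
  have ab_le: "?o a \<le> ?o a0" "?o b \<le> ?o b0" using a b a0 b0(1) by (simp_all add: lowest_def)
  have "\<kappa> a = 0" using lexw_le_D(1)[OF ab_le(1)] neg nonneg by simp
  have "\<kappa> b = 0" using lexw_le_D(1)[OF ab_le(2)] b0 nonneg by simp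
  then have "b' = 0" using lexw_le_D(2)[OF ab_le(2)] b0 cone by (simp add: b')
  \<comment> \<open>The term of \<open>\<phi> (s * t)\<close> may contain \<open>z\<close>. It still commutes with that of \<open>\<phi> g\<close>, because
  \<open>\<phi> g\<close> commutes with \<open>z\<close>.\<close>
  have "p powi n' = 1"
  proof -
    obtain c where c: "c \<noteq> 0" "\<phi> z = scale c z" using aut_z[OF \<phi>] by blast
    have "\<phi> (g * z) = \<phi> (z * g)" using g sz tz by auto
    then have "scale c (\<phi> g * z) = scale c (z * \<phi> g)" by (simp add: aut c scale_out)
    then have gz: "\<phi> g * z = z * \<phi> g" using c by simp
    have lz: "lowest ?o (\<Phi> z) (1, 0, 0, 0, 0)" by (simp add: \<Phi>_z lowest_def)
    have "qlam p q b (1, 0, 0, 0, 0) = qlam p q (1, 0, 0, 0, 0) b"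
      using lowest_mult(1)[OF add b lz] lowest_mult(1)[OF add lz b] b
      by (simp add: gz \<Phi>_z lowest_def in_keys_iff add.commute)
    then show ?thesis by (simp add: b')
  qed
  then have pn: "p powi (n' * a') = 1" by (simp add: power_int_mult)
  have "\<phi> g * \<phi> (s * t) = scale r (\<phi> (s * t) * \<phi> g)"
    by (metis aut(2,3) r(2))
  then have "lookup (\<Phi> (\<phi> g * \<phi> (s * t))) (b + a) =
      r * lookup (\<Phi> (\<phi> (s * t) * \<phi> g)) (a + b)"
    by (simp add: \<Phi>_scale add.commute)
  then have "qlam p q b a = r * qlam p q a b"
    using a b lowest_mult(1)[OF add a b] lowest_mult(1)[OF add b a]
    by (simp add: lowest_def in_keys_iff)
  moreover have "qlam p q b a = 1" "qlam p q a b = 1"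
    using \<kappa> pn \<open>\<kappa> a = 0\<close> \<open>\<kappa> b = 0\<close> \<open>b' = 0\<close> by (auto simp: a' b')
  ultimately show False using r(1) by simp
qed

lemma \<Phi>_st: "\<Phi> (s * t) = single (0, 0, 1, 1, 0) 1"
  by (simp add: \<Phi>_mult \<Phi>_s \<Phi>_t)

lemma aut_st_multiple:
  assumes \<phi>: "\<phi> \<in> alg_aut scale"
  obtains u where "\<phi> (s * t) = s * t * u"
proof -
  obtain u where u: "\<phi> (s * t) = s * u"
    using s_multiple_if aut_st_keys[OF \<phi>, of es et] by blast
  have "1 \<le> et a" if a: "a \<in> supp u" for a
  proof -
    have "lookup (\<Phi> (s * u)) ((0, 0, 1, 0, 0) + a) =
        lookup (\<Phi> s) (0, 0, 1, 0, 0) * lookup (\<Phi> u) a * qlam p q (0, 0, 1, 0, 0) a"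
      unfolding \<Phi>_mult using a by (intro E.lookup_tmul_unique) (auto simp: \<Phi>_s)
    then have "(0, 0, 1, 0, 0) + a \<in> supp (s * u)"
      using a by (simp add: in_keys_iff \<Phi>_s)
    then show ?thesis
      using aut_st_keys[OF \<phi>, of et es] unfolding u by fastforce
  qed
  then obtain u' where "u = t * u'" using t_multiple_if by blast
  with u that show ?thesis by (simp add: mult.assoc)
qed

lemma st_nonzero: "s * t \<noteq> 0"
  using \<Phi>_st by (metis \<Phi>_zero lookup_single_eq lookup_zero one_neq_zero)

lemma aut_st:
  assumes "\<phi> \<in> alg_aut scale"
  obtains c where "c \<noteq> 0" "\<phi> (s * t) = scale c (s * t)"
proof -
  have "\<forall>\<psi>\<in>alg_aut scale. \<exists>u. \<psi> (s * t) = s * t * u"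
    using aut_st_multiple by blast
  from scalar_from_inverse[of \<phi> "s * t", OF assms st_nonzero this] that show ?thesis by blast
qed


section \<open>Classification of the automorphisms\<close>

lemma gens_nonscalar:
  assumes "g \<in> {x, y, s, t}"
  shows "g \<noteq> scale c 1"
proof
  assume "g = scale c 1"
  then have "supp g \<subseteq> {0}"
    by (auto simp: \<Phi>_scale \<Phi>_one in_keys_iff lookup_one when_def split: if_splits)
  then show False
    using assms by (auto simp: \<Phi>_x keys_y \<Phi>_s \<Phi>_t zero_prod_def)
qed

text \<open>Degrees are additive, a nonscalar has degree at least one, and no exponent of \<open>v\<close> is negative.\<close>

lemma factor_linear:
  assumes nonscalar: "\<And>c. u \<noteq> scale c 1" "\<And>c. u' \<noteq> scale c 1" and "u * u' \<noteq> 0"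
    and keys: "\<And>a. a \<in> supp (u * u') \<Longrightarrow> deg a \<le> 2 \<and> ev a \<le> 0"
  shows "u \<in> span {1, x, y, s, t}" "u' \<in> span {1, x, y, s, t}"
proof -
  have nz: "u \<noteq> 0" "u' \<noteq> 0" using assms(3) by auto
  obtain a b where a: "a \<in> supp u" "\<forall>c\<in>supp u. deg c \<le> deg a"
    and b: "b \<in> supp u'" "\<forall>c\<in>supp u'. deg c \<le> deg b"
    and ab: "a + b \<in> supp (u * u')"
    by (rule weight_split[OF additive_weights(6) nz])
  have "deg a + deg b \<le> 2" using keys[OF ab] additive.add[OF additive_weights(6), of a b] by simp
  moreover have "\<not> deg a \<le> 0"
  proof
    assume "deg a \<le> 0"
    then have "deg c \<le> 0" if "c \<in> supp u" for c
      using bspec[OF a(2) that] by simp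
    with scalar_if[of u] nonscalar(1) show False by blast
  qed
  moreover have "\<not> deg b \<le> 0"
  proof
    assume "deg b \<le> 0"
    then have "deg c \<le> 0" if "c \<in> supp u'" for c
      using bspec[OF b(2) that] by simp
    with scalar_if[of u'] nonscalar(2) show False by blast
  qed
  ultimately have deg: "deg a \<le> 1" "deg b \<le> 1" by simp_all
  obtain a' b' where a': "a' \<in> supp u" "\<forall>c\<in>supp u. ev c \<le> ev a'"
    and b': "b' \<in> supp u'" "\<forall>c\<in>supp u'. ev c \<le> ev b'"
    and ab': "a' + b' \<in> supp (u * u')"
    by (rule weight_split[OF additive_weights(5) nz])
  have cone: "a' \<in> cone" "b' \<in> cone" using a'(1) b'(1) keys_cone by blast+
  have "ev a' + ev b' \<le> 0" using keys[OF ab'] by simp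
  moreover have "0 \<le> ev c" if "c \<in> cone" for c using that by (cases c) simp
  note this[OF cone(1)] this[OF cone(2)]
  ultimately have ev: "ev a' \<le> 0" "ev b' \<le> 0" by simp_all
  show "u \<in> span {1, x, y, s, t}"
  proof (rule linear_if)
    fix c assume c: "c \<in> supp u"
    show "deg c \<le> 1" using bspec[OF a(2) c] deg(1) by simp
    show "ev c \<le> 0" using bspec[OF a'(2) c] ev(1) by simp
  qed
  show "u' \<in> span {1, x, y, s, t}"
  proof (rule linear_if)
    fix c assume c: "c \<in> supp u'"
    show "deg c \<le> 1" using bspec[OF b(2) c] deg(2) by simp
    show "ev c \<le> 0" using bspec[OF b'(2) c] ev(2) by simp
  qed
qed

lemma aut_gens_linear:
  assumes \<phi>: "\<phi> \<in> alg_aut scale" and "g \<in> {x, y, s, t}"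
  shows "\<phi> g \<in> span {1, x, y, s, t}"
proof -
  note aut = alg_autD[OF unital_algebra_axioms \<phi>]
  have nonscalar: "\<phi> g \<noteq> scale c 1" if "g \<in> {x, y, s, t}" for g c
    using gens_nonscalar[OF that, of c] aut(2)[of c 1] aut(4,7) by metis
  have nz: "\<phi> g \<noteq> 0" if "g \<in> {x, y, s, t}" for g
    using nonscalar[OF that, of 0] by simp
  obtain c where c: "c \<noteq> 0" "\<phi> z = scale c z" using aut_z[OF \<phi>] by blast
  obtain d where d: "d \<noteq> 0" "\<phi> (s * t) = scale d (s * t)" using aut_st[OF \<phi>] by blast
  have yx_keys: "deg a \<le> 2 \<and> ev a \<le> 0" if "a \<in> supp (\<phi> y * \<phi> x)" for a
  proof -
    have "\<phi> y * \<phi> x = scale (inverse (p - 1)) (scale c z - 1)"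
      by (simp add: yx c aut flip: aut(3))
    then have "a \<in> {(1, 0, 0, 0, 0), 0}"
      using that by (auto simp: \<Phi>_scale \<Phi>_diff \<Phi>_z \<Phi>_one in_keys_iff lookup_minus lookup_single
          lookup_one when_def split: if_splits)
    then show ?thesis by (auto simp: deg_def)
  qed
  have st_keys: "deg a \<le> 2 \<and> ev a \<le> 0" if "a \<in> supp (\<phi> s * \<phi> t)" for a
  proof -
    have "\<phi> s * \<phi> t = scale d (s * t)" by (simp add: d flip: aut(3))
    then have "a = (0, 0, 1, 1, 0)"
      using that by (auto simp: \<Phi>_scale \<Phi>_st in_keys_iff lookup_single when_def split: if_splits)
    then show ?thesis by (simp add: deg_def)
  qed
  have "\<phi> y \<in> span {1, x, y, s, t}" "\<phi> x \<in> span {1, x, y, s, t}"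
    using factor_linear[OF nonscalar[of y] nonscalar[of x] _ yx_keys] nz by (simp_all add: domain_iff)
  moreover have "\<phi> s \<in> span {1, x, y, s, t}" "\<phi> t \<in> span {1, x, y, s, t}"
    using factor_linear[OF nonscalar[of s] nonscalar[of t] _ st_keys] nz by (simp_all add: domain_iff)
  ultimately show ?thesis using assms(2) by auto
qed

definition lin :: "'k \<Rightarrow> 'k \<Rightarrow> 'k \<Rightarrow> 'k \<Rightarrow> 'k \<Rightarrow> 'c" where
  "lin a b c d e = scale a 1 + scale b x + scale c y + scale d s + scale e t"

lemma span_lin:
  assumes "u \<in> span {1, x, y, s, t}"
  obtains a b c d e where "u = lin a b c d e"
proof -
  obtain a b c d e where "u - scale a 1 - scale b x - scale c y - scale d s - scale e t = 0"
    using assms by (auto simp: span_breakdown_eq)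
  then have "u = lin a b c d e" by (simp add: lin_def algebra_simps)
  with that show ?thesis .
qed

lemma mon_independent:
  assumes "keys f \<subseteq> cone" "lincomb mon f = 0"
  shows "f = 0"
  using lowest_key[OF assms(1)] assms(2) by (metis \<Phi>_zero all_not_in_conv keys_eq_empty keys_zero)

lemma lin_inject:
  assumes "lin a b c d e = lin a' b' c' d' e'"
  shows "a = a' \<and> b = b' \<and> c = c' \<and> d = d' \<and> e = e'"
proof -
  let ?f = "single (0, 0, 0, 0, 0) (a - a') + single (0, 1, 0, 0, 0) (b - b') +
    single (0, -1, 0, 0, 0) (c - c') + single (0, 0, 1, 0, 0) (d - d') +
    single (0, 0, 0, 1, 0) (e - e') :: expo \<Rightarrow>\<^sub>0 'k"
  have "lincomb mon ?f = lin a b c d e - lin a' b' c' d' e'"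
    by (simp add: lincomb_add lin_def x_power_def scale_left_diff_distrib)
  then have "?f = 0"
    using assms by (intro mon_independent)
      (auto simp: in_keys_iff lookup_add lookup_single when_def split: if_splits)
  then have "lookup ?f k = 0" for k by simp
  from this[of "(0, 0, 0, 0, 0)"] this[of "(0, 1, 0, 0, 0)"] this[of "(0, -1, 0, 0, 0)"]
    this[of "(0, 0, 1, 0, 0)"] this[of "(0, 0, 0, 1, 0)"]
  show ?thesis by (simp add: lookup_add lookup_single)
qed

lemma lin_scale: "scale r (lin a b c d e) = lin (r * a) (r * b) (r * c) (r * d) (r * e)"
  by (simp add: lin_def scale_right_distrib)

lemma lin_z: "lin a b c d e * z = z * lin a (p * b) (inverse p * c) d e"
  by (simp add: lin_def distrib_left distrib_right scale_out xz yz sz tz mult.commute)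

lemma lin_st: "lin a b c d e * (s * t) = s * t * lin a b c (q * d) (inverse q * e)"
proof -
  have "x * (s * t) = s * t * x" "y * (s * t) = s * t * y"
    by (metis mult.assoc sx tx, metis mult.assoc sy ty)
  then show ?thesis
    by (simp add: lin_def distrib_left distrib_right scale_out s_st t_st mult.commute del: mult.assoc)
qed

text \<open>Since \<open>\<phi> z\<close> is a multiple of \<open>z\<close>, the image \<open>\<phi> g\<close> commutes with \<open>z\<close> in the same way as \<open>g\<close> does, which
  is compared coefficientwise. Each coefficient either vanishes or satisfies a condition on \<open>p\<close>.\<close>

lemma twist_z:
  assumes \<phi>: "\<phi> \<in> alg_aut scale" and g: "g * z = scale r (z * g)" and lin: "\<phi> g = lin a b c d e"
  shows "a = r * a" "p * b = r * b" "inverse p * c = r * c" "d = r * d" "e = r * e"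
proof -
  note aut = alg_autD[OF unital_algebra_axioms \<phi>]
  obtain k where k: "k \<noteq> 0" "\<phi> z = scale k z" using aut_z[OF \<phi>] by blast
  have "scale k (\<phi> g * z) = \<phi> (g * z)" by (simp add: aut k scale_out)
  also have "\<dots> = scale k (scale r (z * \<phi> g))" by (simp add: g aut k scale_out mult.commute)
  finally have "\<phi> g * z = scale r (z * \<phi> g)" using k(1) scale_left_imp_eq by blast
  then have "z * lin a (p * b) (inverse p * c) d e = z * scale r (lin a b c d e)"
    by (simp only: lin lin_z scale_out)
  from lin_inject[OF cancel_left[OF this z_nonzero, unfolded lin_scale]]
  show "a = r * a" "p * b = r * b" "inverse p * c = r * c" "d = r * d" "e = r * e" by simp_all
qed

lemma twist_st:
  assumes \<phi>: "\<phi> \<in> alg_aut scale" and g: "g * (s * t) = scale r (s * t * g)" and lin: "\<phi> g = lin a b c d e"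
  shows "a = r * a" "b = r * b" "c = r * c" "q * d = r * d" "inverse q * e = r * e"
proof -
  note aut = alg_autD[OF unital_algebra_axioms \<phi>]
  obtain k where k: "k \<noteq> 0" "\<phi> (s * t) = scale k (s * t)" using aut_st[OF \<phi>] by blast
  have "scale k (\<phi> g * (s * t)) = \<phi> (g * (s * t))" by (simp only: aut(3)[of g] k scale_out)
  also have "\<dots> = scale k (scale r (s * t * \<phi> g))"
    by (simp only: g aut(2) aut(3)[of "s * t"] k scale_out scale_scale mult.commute)
  finally have "\<phi> g * (s * t) = scale r (s * t * \<phi> g)" using k(1) scale_left_imp_eq by blast
  then have "s * t * lin a b c (q * d) (inverse q * e) = s * t * scale r (lin a b c d e)"
    by (simp only: lin lin_st scale_out)
  from lin_inject[OF cancel_left[OF this st_nonzero, unfolded lin_scale]]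
  show "a = r * a" "b = r * b" "c = r * c" "q * d = r * d" "inverse q * e = r * e" by simp_all
qed

lemma inverse_eq_self_iff:
  assumes "(r::'k) \<noteq> 0" "r \<noteq> 1"
  shows "inverse r = r \<longleftrightarrow> r = -1"
proof -
  have "inverse r = r \<longleftrightarrow> r\<^sup>2 = 1"
    using assms by (auto simp: power2_eq_square field_simps)
  then show ?thesis using assms(2) by (simp add: power2_eq_1_iff)
qed

lemma fixed_zero: "(a::'k) = r * a \<Longrightarrow> r \<noteq> 1 \<Longrightarrow> a = 0"
  by (metis mult_cancel_right2)

lemma scale_twice: "scale (c * (d * 2)) u = scale (c * d) u + scale (c * d) u"
proof -
  have "c * (d * 2) = c * d + c * d" by (simp only: mult_2_right distrib_left)
  then show ?thesis by (simp only: scale_left_distrib)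
qed

lemma double_zero:
  assumes "r = -1" "(r::'k) \<noteq> 1" "c + c = 0"
  shows "(c::'k) = 0"
proof (rule ccontr)
  assume "c \<noteq> 0"
  moreover have "c * (1 + 1) = 0" using assms(3) by (simp only: distrib_left mult_1_right)
  ultimately have "(1::'k) = -1" by (simp add: eq_neg_iff_add_eq_0 del: one_add_one)
  with assms show False by simp
qed

text \<open>The twist against \<open>z\<close> kills the coefficients at \<open>1\<close>, \<open>s\<close> and \<open>t\<close>, and mixes \<open>x\<close> and \<open>y\<close> only if the inverse
  of \<open>p\<close> is \<open>p\<close>, that is \<open>p = -1\<close>. In this case the squares of \<open>x\<close> and \<open>y\<close> in the defining relation rule
  out proper mixtures.\<close>

lemma aut_xy:
  assumes \<phi>: "\<phi> \<in> alg_aut scale"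
  obtains a where "a \<noteq> 0" "\<phi> x = scale a x" "\<phi> y = scale (inverse a) y"
  | a where "p = -1" "a \<noteq> 0" "\<phi> x = scale a y" "\<phi> y = scale (inverse a) x"
proof -
  note aut = alg_autD[OF unital_algebra_axioms \<phi>]
  obtain x0 a b x3 x4 where x: "\<phi> x = lin x0 a b x3 x4"
    using span_lin aut_gens_linear[OF \<phi>, of x] by blast
  obtain y0 b' a' y3 y4 where y: "\<phi> y = lin y0 b' a' y3 y4"
    using span_lin aut_gens_linear[OF \<phi>, of y] by blast
  note tx = twist_z[OF \<phi> xz x] and ty = twist_z[OF \<phi> yz y]
  have pinv: "inverse p \<noteq> 1" using p1 by simp
  have b0: "b = 0" "b' = 0" if "p \<noteq> -1"
    using tx(3) ty(2) inverse_eq_self_iff[OF p0 p1] that by auto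
  have X: "\<phi> x = scale a x + scale b y"
    using fixed_zero[OF tx(1) p1] fixed_zero[OF tx(4) p1] fixed_zero[OF tx(5) p1] by (simp add: x lin_def)
  have Y: "\<phi> y = scale a' y + scale b' x"
    using fixed_zero[OF ty(1) pinv] fixed_zero[OF ty(4) pinv] fixed_zero[OF ty(5) pinv] by (simp add: y lin_def)
  have "\<phi> x * \<phi> y - scale p (\<phi> y * \<phi> x) = 1"
    by (simp add: xy aut flip: aut(3))
  then have rel: "scale (a * a') (x * y) + scale (b * b') (y * x) + scale (a * b') (x * x) + scale (b * a') (y * y)
      - scale p (scale (a * a') (y * x) + scale (b * b') (x * y) + scale (a * b') (x * x) + scale (b * a') (y * y)) = 1"
    unfolding X Y by (simp add: distrib_left distrib_right scale_out algebra_simps scale_right_distrib)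
  show ?thesis
  proof (cases "p = -1")
    case False
    have "scale (a * a') 1 = scale 1 1"
      using rel by (simp add: b0[OF False] xy scale_right_distrib mult.commute)
    then have "a * a' = 1"
      using lin_inject[of "a * a'" 0 0 0 0 1 0 0 0 0] by (simp add: lin_def)
    then have "a \<noteq> 0" "a' = inverse a" by (auto simp: inverse_unique)
    with X Y b0[OF False] that(1) show ?thesis by simp
  next
    case True
    let ?f = "single (0, 0, 0, 0, 0) (a * a' + b * b' - 1) +
      single (0, 2, 0, 0, 0) (a * b' + a * b') + single (0, -2, 0, 0, 0) (b * a' + b * a') :: expo \<Rightarrow>\<^sub>0 'k"
    have "lincomb mon ?f = scale (a * a' + b * b' - 1) 1 + scale (a * b' + a * b') (x * x) + scale (b * a' + b * a') (y * y)"
      by (simp add: lincomb_add x_power_def power2_eq_square)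
    also have "\<dots> = 0"
      using rel by (simp add: True xy scale_right_distrib scale_left_distrib scale_left_diff_distrib
          scale_twice algebra_simps)
    finally have "?f = 0"
      by (intro mon_independent)
        (auto simp: in_keys_iff lookup_add lookup_single when_def split: if_splits)
    then have "lookup ?f k = 0" for k by simp
    from this[of "(0, 0, 0, 0, 0)"] this[of "(0, 2, 0, 0, 0)"] this[of "(0, -2, 0, 0, 0)"]
    have "a * a' + b * b' = 1" "a * b' + a * b' = 0" "b * a' + b * a' = 0"
      by (simp_all add: lookup_add lookup_single)
    with double_zero[OF True p1, of "a * b'"] double_zero[OF True p1, of "b * a'"]
    have "a * a' + b * b' = 1" "a * b' = 0" "b * a' = 0" by blast+
    then consider "b = 0" "b' = 0" "a * a' = 1" | "a = 0" "a' = 0" "b * b' = 1"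
      by force
    then show ?thesis
    proof cases
      case 1
      then have "a \<noteq> 0" "a' = inverse a" by (auto simp: inverse_unique)
      with X Y 1 that(1) show ?thesis by simp
    next
      case 2
      then have "b \<noteq> 0" "b' = inverse b" by (auto simp: inverse_unique)
      with X Y 2 True that(2) show ?thesis by simp
    qed
  qed
qed

text \<open>The same argument with \<open>st\<close> in place of \<open>z\<close>.\<close>

lemma aut_s_t:
  assumes \<phi>: "\<phi> \<in> alg_aut scale"
  obtains a b where "a \<noteq> 0" "b \<noteq> 0" "\<phi> s = scale a s" "\<phi> t = scale b t"
  | a b where "q = -1" "a \<noteq> 0" "b \<noteq> 0" "\<phi> s = scale a t" "\<phi> t = scale b s"
proof -
  note aut = alg_autD[OF unital_algebra_axioms \<phi>]
  obtain s0 s1 s2 a b where s: "\<phi> s = lin s0 s1 s2 a b"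
    using span_lin aut_gens_linear[OF \<phi>, of s] by blast
  obtain t0 t1 t2 b' a' where t: "\<phi> t = lin t0 t1 t2 b' a'"
    using span_lin aut_gens_linear[OF \<phi>, of t] by blast
  note ts = twist_st[OF \<phi> s_st s] and tt = twist_st[OF \<phi> t_st t]
  have qinv: "inverse q \<noteq> 1" using q1 by simp
  have b0: "b = 0" "b' = 0" if "q \<noteq> -1"
    using ts(5) tt(4) inverse_eq_self_iff[OF q0 q1] that by auto
  have S: "\<phi> s = scale a s + scale b t"
    using fixed_zero[OF ts(1) q1] fixed_zero[OF ts(2) q1] fixed_zero[OF ts(3) q1] by (simp add: s lin_def)
  have T: "\<phi> t = scale a' t + scale b' s"
    using fixed_zero[OF tt(1) qinv] fixed_zero[OF tt(2) qinv] fixed_zero[OF tt(3) qinv] by (simp add: t lin_def)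
  have nz: "\<phi> s \<noteq> 0" "\<phi> t \<noteq> 0"
    using st_nonzero aut(6,7) by (metis mult_zero_left, metis mult_zero_right)
  show ?thesis
  proof (cases "q = -1")
    case False
    with S T nz b0[OF False] that(1)[of a a'] show ?thesis by auto
  next
    case True
    have "\<phi> s * \<phi> t + \<phi> t * \<phi> s = 0"
    proof -
      have "\<phi> (s * t) = \<phi> (scale q (t * s))" by (simp only: st)
      then have "\<phi> s * \<phi> t = scale q (\<phi> t * \<phi> s)" by (simp only: aut(2,3))
      then show ?thesis by (simp add: True)
    qed
    then have rel: "scale (a * b' + a * b') (s * s) + scale (b * a' + b * a') (t * t) = 0"
      unfolding S T
      by (simp add: distrib_left distrib_right scale_out scale_left_distrib scale_right_distrib
          scale_twice st True algebra_simps)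
    let ?f = "single (0, 0, 2, 0, 0) (a * b' + a * b') +
      single (0, 0, 0, 2, 0) (b * a' + b * a') :: expo \<Rightarrow>\<^sub>0 'k"
    have "lincomb mon ?f = 0"
      using rel by (simp add: lincomb_add x_power_def power2_eq_square)
    then have "?f = 0"
      by (intro mon_independent)
        (auto simp: in_keys_iff lookup_add lookup_single when_def split: if_splits)
    then have "lookup ?f k = 0" for k by simp
    from this[of "(0, 0, 2, 0, 0)"] this[of "(0, 0, 0, 2, 0)"]
    have "a * b' + a * b' = 0" "b * a' + b * a' = 0"
      by (simp_all add: lookup_add lookup_single)
    with double_zero[OF True q1, of "a * b'"] double_zero[OF True q1, of "b * a'"]
    have "a * b' = 0" "b * a' = 0" by blast+
    then show ?thesis
      using S T nz True that(1)[of a a'] that(2)[of b b'] by (cases "a = 0"; cases "a' = 0") auto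
  qed
qed

end

section \<open>Homomorphisms out of a polynomial ring\<close>

lemma poly_const_simps:
  "poly_const (u + w) = poly_const u + poly_const w" "poly_const (u - w) = poly_const u - poly_const w"
  "poly_const (u * w) = poly_const u * poly_const w" "poly_const 1 = 1" "poly_const 0 = 0"
  by (simp_all add: poly_const_def single_add single_diff mult_single)

lemma poly_scale_single:
  assumes "unital_algebra scale"
  shows "poly_scale scale c (single m u) = single m (scale c u)"
proof -
  interpret unital_algebra scale by fact
  show ?thesis
    by (rule poly_mapping_eqI) (simp add: lookup_poly_scale[OF assms] lookup_single when_def)
qed

lemma poly_scale_const:
  "unital_algebra scale \<Longrightarrow> poly_scale scale c (poly_const u) = poly_const (scale c u)"
  by (simp add: poly_const_def poly_scale_single)

lemma poly_const_inject: "poly_const u = poly_const w \<longleftrightarrow> u = w"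
  by (simp add: poly_const_def) (metis lookup_single_eq)

lemma poly_var_central: "poly_var * F = F * poly_var"
  by (induction F rule: poly_mapping_additive_induct)
    (simp_all add: poly_var_def mult_single distrib_left distrib_right)

lemma poly_var_power: "poly_var ^ m = single m 1"
  by (induction m) (simp_all add: poly_var_def mult_single)

lemma single_eq_const_var: "single m u = poly_const u * poly_var ^ m"
  by (simp add: poly_var_power poly_const_def mult_single)

lemma lookup_const_mult [simp]: "lookup (poly_const u * F) m = u * lookup F m"
  by (induction F rule: poly_mapping_additive_induct)
    (simp_all add: poly_const_def mult_single lookup_single lookup_add distrib_left when_def)

lemma lookup_mult_const [simp]: "lookup (F * poly_const u) m = lookup F m * u"
  by (induction F rule: poly_mapping_additive_induct)
    (simp_all add: poly_const_def mult_single lookup_single lookup_add distrib_right when_def)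

lemma lookup_mult_var_power:
  "lookup (F * poly_var ^ i) m = (if i \<le> m then lookup F (m - i) else 0)"
  by (induction F rule: poly_mapping_additive_induct)
    (auto simp: poly_var_power mult_single lookup_single lookup_add distrib_right when_def)

lemma lookup_poly_mult:
  fixes F G :: "nat \<Rightarrow>\<^sub>0 'b::ring_1"
  shows "lookup (F * G) n =
    (\<Sum>k\<le>n. lookup F k * lookup G (n - k))"
proof (induction F rule: poly_mapping_additive_induct)
  case (single i c)
  have "(\<Sum>k\<le>n. lookup (single i c) k * lookup G (n - k)) =
      (\<Sum>k\<le>n. if k = i then c * lookup G (n - i) else 0)"
    by (intro sum.cong) (auto simp: lookup_single when_def)
  also have "\<dots> = (if i \<le> n then c * lookup G (n - i) else 0)"
    by (simp add: sum.delta)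
  also have "\<dots> = lookup (poly_const c * G * poly_var ^ i) n"
    by (simp add: lookup_mult_var_power)
  also have "poly_const c * G * poly_var ^ i = single i c * G"
  proof -
    have "poly_var ^ i * G = G * poly_var ^ i"
      by (induction i) (simp_all add: mult.assoc poly_var_central, metis mult.assoc poly_var_central)
    then show ?thesis by (simp add: single_eq_const_var mult.assoc)
  qed
  finally show ?case by simp
qed (simp add: lookup_add distrib_right sum.distrib)

lemma poly_mapping_sum_singles:
  "F = (\<Sum>i\<in>keys F. single i (lookup F i))"
  by (rule poly_mapping_eqI) (simp add: lookup_sum lookup_single when_def in_keys_iff)

lemma poly_expansion: "F = (\<Sum>i\<in>keys F. poly_const (lookup F i) * poly_var ^ i)"
  unfolding single_eq_const_var[symmetric] by (rule poly_mapping_sum_singles)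

context explicit_algebra
begin

text \<open>The extension of \<open>e\<close> that maps the variable to \<open>V\<close>; it serves both the embedding into the quantum
  torus and the exponential of a derivation.\<close>

definition poly_ext :: "('b::ring_1 \<Rightarrow> 'v) \<Rightarrow> 'v \<Rightarrow> (nat \<Rightarrow>\<^sub>0 'b) \<Rightarrow> 'v" where
  "poly_ext e V F = (\<Sum>m\<in>keys F. mul (e (lookup F m)) ((mul V ^^ m) unit))"

context
  fixes scale :: "'k \<Rightarrow> 'b::ring_1 \<Rightarrow> 'b" and e :: "'b \<Rightarrow> 'v" and V :: 'v
  assumes alg: "unital_algebra scale"
    and e: "\<And>u w. e (u + w) = e u + e w" "\<And>c u. e (scale c u) = scl c (e u)"
      "\<And>u w. e (u * w) = mul (e u) (e w)" "e 1 = unit"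
    and central: "\<And>u. mul V u = mul u V"
begin

lemma e_zero: "e 0 = 0"
  using e(1)[of 0 0] by simp

lemma poly_ext_single: "poly_ext e V (single m u) = mul (e u) ((mul V ^^ m) unit)"
  by (cases "u = 0") (simp_all add: poly_ext_def e_zero mul_zero)

lemma poly_ext_add: "poly_ext e V (F + G) = poly_ext e V F + poly_ext e V G"
proof -
  let ?A = "keys F \<union> keys G"
  have "poly_ext e V H = (\<Sum>m\<in>?A. mul (e (lookup H m)) ((mul V ^^ m) unit))"
    if "H \<in> {F, G, F + G}" for H
    unfolding poly_ext_def using that keys_add[of F G]
    by (intro sum.mono_neutral_left) (auto simp: in_keys_iff e_zero mul_zero)
  then show ?thesis by (simp add: lookup_add e mul_add_left sum.distrib)
qed

lemma poly_ext_scale: "poly_ext e V (poly_scale scale c F) = scl c (poly_ext e V F)"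
proof (induction F rule: poly_mapping_additive_induct)
  case (single k d)
  show ?case by (simp add: poly_scale_single[OF alg] poly_ext_single e mul_scl_left)
next
  case (add f g)
  have "poly_scale scale c (f + g) = poly_scale scale c f + poly_scale scale c g"
    using unital_algebra_poly_scale[OF alg]
    by (simp add: unital_algebra_def vector_space.vector_space_assms)
  with add show ?case by (simp add: poly_ext_add scale_right_distrib)
qed

lemma power_unit: "mul u ((mul V ^^ m) unit) = (mul V ^^ m) u"
proof (induction m)
  case (Suc m)
  have "mul u (mul V w) = mul V (mul u w)" for w
    by (metis central mul_assoc)
  with Suc show ?case by simp
qed simp

lemma poly_ext_mult: "poly_ext e V (F * G) = mul (poly_ext e V F) (poly_ext e V G)"
proof (induction F rule: poly_mapping_additive_induct)
  case (single k u)
  show ?case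
  proof (induction G rule: poly_mapping_additive_induct)
    case (single l w)
    have pow: "mul ((mul V ^^ m) r) r' = (mul V ^^ m) (mul r r')" for m r r'
      by (induction m) (simp_all add: mul_assoc)
    have pow': "mul r ((mul V ^^ m) r') = (mul V ^^ m) (mul r r')" for m r r'
      by (metis mul_assoc power_unit)
    have pow'': "(mul V ^^ m) ((mul V ^^ n) r) = (mul V ^^ (m + n)) r" for m n r
      by (simp add: funpow_add)
    show ?case
      by (simp add: mult_single poly_ext_single e power_unit pow pow' pow'' add.commute)
  qed (simp add: distrib_left poly_ext_add mul_add_right)
qed (simp add: distrib_right poly_ext_add mul_add_left)

lemma poly_ext_const: "poly_ext e V (poly_const u) = e u"
  by (simp add: poly_const_def poly_ext_single)

lemma poly_ext_one: "poly_ext e V 1 = unit"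
  using poly_ext_const[of 1] by (simp add: poly_const_simps e)

lemma poly_ext_var: "poly_ext e V poly_var = V"
  by (simp add: poly_var_def poly_ext_single e)

end

end

section \<open>Embedding the polynomial ring in the quantum torus\<close>

lemma poly_induct_Apq:
  fixes scale :: "'k::field \<Rightarrow> 'b::ring_1 \<Rightarrow> 'b"
  assumes Apq: "is_Apq scale p q x y s t"
    and one: "P 1" and add: "\<And>u w. P u \<Longrightarrow> P w \<Longrightarrow> P (u + w)"
    and scale: "\<And>c u. P u \<Longrightarrow> P (poly_scale scale c u)"
    and gen: "\<And>u. P u \<Longrightarrow> P (poly_const x * u)" "\<And>u. P u \<Longrightarrow> P (poly_const y * u)"
      "\<And>u. P u \<Longrightarrow> P (poly_const s * u)" "\<And>u. P u \<Longrightarrow> P (poly_const t * u)"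
      "\<And>u. P u \<Longrightarrow> P (poly_var * u)"
  shows "P F"
proof -
  note alg = is_Apq_relations(1)[OF Apq]
  have const: "P (poly_const u)" for u
    using Apq
  proof (induction u rule: is_Apq_induct)
    case (scale c u)
    then show ?case using assms(4) by (simp flip: poly_scale_const[OF alg])
  qed (use one add gen in \<open>simp_all add: poly_const_simps\<close>)
  have "P (poly_var ^ m * poly_const u)" for m u
    by (induction m) (simp_all add: const gen mult.assoc)
  moreover have "poly_var ^ m * F = F * poly_var ^ m" for m and F :: "nat \<Rightarrow>\<^sub>0 'b"
    by (induction m) (simp_all add: poly_var_central mult.assoc, metis mult.assoc poly_var_central)
  ultimately have "P (single m u)" for m u
    by (simp add: single_eq_const_var)
  then show ?thesis
    using add by (induction F rule: poly_mapping_additive_induct) simp_all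
qed

text \<open>The homomorphism comes from the universal property of \<open>B\<close>, extended by \<open>v\<close>. The last condition
  allows degrees in the polynomial variable to be read off in the quantum torus.\<close>

lemma Apq_poly_exists:
  fixes scale :: "'k::field \<Rightarrow> 'b::ring_1 \<Rightarrow> 'b"
  assumes Apq: "is_Apq scale p q x y s t" and pq: "p \<noteq> 0" "q \<noteq> 0" "p \<noteq> 1" "q \<noteq> 1"
  obtains \<Phi> where "Apq_poly (poly_scale scale) p q (poly_const x) (poly_const y) (poly_const s) (poly_const t)
      poly_var \<Phi>"
    "\<forall>F. ev ` keys (\<Phi> F) = int ` keys F"
proof -
  note rels = is_Apq_relations[OF Apq]
  interpret B: unital_algebra scale by (rule rels)
  interpret C: unital_algebra "poly_scale scale" by (rule unital_algebra_poly_scale) (rule rels)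
  interpret bicharacter "qlam p q" by (rule bicharacter_qlam) fact+
  interpret E: explicit_algebra coeff_scale tmul 1 by (rule explicit_algebra_tmul)
  let ?X = "single (0, 1, 0, 0, 0) 1 :: expo \<Rightarrow>\<^sub>0 'k"
  let ?Y = "single (1, -1, 0, 0, 0) (inverse (p - 1))
      - single (0, -1, 0, 0, 0) (inverse (p - 1)) :: expo \<Rightarrow>\<^sub>0 'k"
  let ?S = "single (0, 0, 1, 0, 0) 1 :: expo \<Rightarrow>\<^sub>0 'k"
  let ?T = "single (0, 0, 0, 1, 0) 1 :: expo \<Rightarrow>\<^sub>0 'k"
  let ?V = "single (0, 0, 0, 0, 1) 1 :: expo \<Rightarrow>\<^sub>0 'k"
  have diff_left: "tmul (f - g) h = tmul f h - tmul g h" for f g h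
    using tmul_add_left[of "f - g" g h] by (simp add: eq_diff_eq)
  have diff_right: "tmul h (f - g) = tmul h f - tmul h g" for f g h
    using tmul_add_right[of h "f - g" g] by (simp add: eq_diff_eq)
  have "tmul ?X ?Y = coeff_scale p (tmul ?Y ?X) + 1"
    using pq(3) by (intro poly_mapping_eqI)
      (auto simp: diff_left diff_right lookup_add lookup_minus lookup_single lookup_one when_def zero_prod_def
        field_simps)
  moreover have "tmul ?S ?T = coeff_scale q (tmul ?T ?S)"
    using pq(2) by (simp add: power_int_minus)
  moreover have "tmul ?S ?X = tmul ?X ?S" "tmul ?S ?Y = tmul ?Y ?S" "tmul ?T ?X = tmul ?X ?T"
    "tmul ?T ?Y = tmul ?Y ?T"
    by (simp_all add: diff_left diff_right)
  ultimately obtain H where H: "\<And>u v. H (u + v) = H u + H v" "\<And>c u. H (scale c u) = coeff_scale c (H u)"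
    "\<And>u v. H (u * v) = tmul (H u) (H v)" "H 1 = 1" "H x = ?X" "H y = ?Y" "H s = ?S" "H t = ?T"
    using is_Apq_hom[OF Apq explicit_algebra_tmul] by blast
  have V_central: "tmul ?V f = tmul f ?V" for f
  proof (induction f rule: poly_mapping_additive_induct)
    case (single k c)
    show ?case by (cases k) (simp add: add.commute)
  qed (simp add: tmul_add_left tmul_add_right)
  define \<Phi> where "\<Phi> = E.poly_ext H ?V"
  note ext = E.poly_ext_add[OF rels(1) H(1-4) V_central, folded \<Phi>_def] E.poly_ext_scale[OF rels(1) H(1-4) V_central, folded \<Phi>_def]
    E.poly_ext_mult[OF rels(1) H(1-4) V_central, folded \<Phi>_def] E.poly_ext_one[OF rels(1) H(1-4) V_central, folded \<Phi>_def]
    E.poly_ext_const[OF rels(1) H(1-4) V_central, folded \<Phi>_def] E.poly_ext_var[OF rels(1) H(1-4) V_central, folded \<Phi>_def]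
  have "Apq_poly (poly_scale scale) p q (poly_const x) (poly_const y) (poly_const s) (poly_const t)
      poly_var \<Phi>"
  proof (unfold_locales)
    show "poly_const x * poly_const y = poly_scale scale p (poly_const y * poly_const x) + 1"
      "poly_const s * poly_const t = poly_scale scale q (poly_const t * poly_const s)"
      "poly_const s * poly_const x = poly_const x * poly_const s"
      "poly_const s * poly_const y = poly_const y * poly_const s"
      "poly_const t * poly_const x = poly_const x * poly_const t"
      "poly_const t * poly_const y = poly_const y * poly_const t"
      by (simp_all add: rels poly_scale_const poly_const_simps flip: poly_const_simps(3))
  qed (fact pq poly_var_central poly_induct_Apq[OF Apq] | simp add: ext H)+
  then interpret A: Apq_poly "poly_scale scale" p q "poly_const x" "poly_const y" "poly_const s" "poly_const t"
      poly_var \<Phi> .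
  let ?K = "\<lambda>m. {a :: expo. ev a = int m}"
  have K: "a + b \<in> ?K m" if "a \<in> ?K 0" "b \<in> ?K m" for a b m
    using that by simp
  have K0: "keys (tmul f g) \<subseteq> ?K 0"
    if "keys f \<subseteq> ?K 0" "keys g \<subseteq> ?K 0" for f g
    by (rule keys_tmul_subset[OF that K])
  have H0: "keys (H u) \<subseteq> ?K 0" for u
    using Apq
  proof (induction u rule: is_Apq_induct)
    case (add u w)
    then show ?case using keys_add[of "H u" "H w"] by (simp only: H) blast
  next
    case (scale c u)
    have "keys (coeff_scale c (H u)) \<subseteq> keys (H u)"
      by (auto simp: in_keys_iff)
    with scale show ?case by (simp only: H)
  next
    case (y u)
    have "keys ?Y \<subseteq> ?K 0"
      using A.keys_y by (simp add: ext H)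
    from K0[OF this y] show ?case by (simp only: H)
  next
    case (x u)
    have "keys ?X \<subseteq> ?K 0" by simp
    from K0[OF this x] show ?case by (simp only: H)
  next
    case (s u)
    have "keys ?S \<subseteq> ?K 0" by simp
    from K0[OF this s] show ?case by (simp only: H)
  next
    case (t u)
    have "keys ?T \<subseteq> ?K 0" by simp
    from K0[OF this t] show ?case by (simp only: H)
  qed (simp add: H zero_prod_def)
  have V_power: "(tmul ?V ^^ m) 1 = single (0, 0, 0, 0, int m) 1" for m
  proof (induction m)
    case 0
    show ?case by (simp flip: zero_prod_def)
  qed simp
  have single_keys: "keys (\<Phi> (single m u)) \<subseteq> ?K m" for m u
  proof -
    have "keys (single (0, 0, 0, 0, int m) (1::'k)) \<subseteq> ?K m" by simp
    from keys_tmul_subset[OF H0 this K] show ?thesis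
      by (simp only: \<Phi>_def E.poly_ext_single[OF rels(1) H(1-4) V_central] V_power)
  qed
  have sum: "lookup (\<Phi> F) a = (\<Sum>i\<in>keys F.
      lookup (\<Phi> (single i (lookup F i))) a)" for F a
  proof -
    have "\<Phi> F = \<Phi> (\<Sum>i\<in>keys F. single i (lookup F i))"
      by (rule arg_cong[OF poly_mapping_sum_singles])
    from arg_cong[OF this, of "\<lambda>f. lookup f a"] show ?thesis
      by (simp only: A.\<Phi>_sum lookup_sum)
  qed
  have "ev ` keys (\<Phi> F) = int ` keys F" for F
  proof
    show "ev ` keys (\<Phi> F) \<subseteq> int ` keys F"
    proof
      fix j assume "j \<in> ev ` keys (\<Phi> F)"
      then obtain a where a: "j = ev a" "lookup (\<Phi> F) a \<noteq> 0"
        unfolding in_keys_iff[symmetric] by (rule imageE)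
      then obtain i where i: "i \<in> keys F"
        "lookup (\<Phi> (single i (lookup F i))) a \<noteq> 0"
        unfolding sum[of F a] by (meson sum.not_neutral_contains_not_neutral)
      then have "a \<in> ?K i" using single_keys unfolding in_keys_iff[symmetric] by blast
      with i(1) a(1) show "j \<in> int ` keys F" by simp
    qed
    show "int ` keys F \<subseteq> ev ` keys (\<Phi> F)"
    proof
      fix j assume "j \<in> int ` keys F"
      then obtain m where m: "j = int m" "m \<in> keys F" by blast
      have "single m (lookup F m) \<noteq> 0"
        using m(2) by (metis in_keys_iff lookup_single_eq lookup_zero)
      then have "\<Phi> (single m (lookup F m)) \<noteq> 0"
        by simp
      then obtain a where a: "a \<in> keys (\<Phi> (single m (lookup F m)))"
        by (metis all_not_in_conv keys_eq_empty)
      then have ev_a: "ev a = int m" using single_keys by blast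
      have zero: "lookup (\<Phi> (single i (lookup F i))) a = 0" if "i \<noteq> m" for i
      proof (rule ccontr)
        assume "lookup (\<Phi> (single i (lookup F i))) a \<noteq> 0"
        then have "a \<in> ?K i" using single_keys unfolding in_keys_iff[symmetric] by blast
        with ev_a that show False by simp
      qed
      have "lookup (\<Phi> F) a = lookup (\<Phi> (single m (lookup F m))) a"
        unfolding sum[of F a] using m(2) zero by (subst sum.remove[of _ m]) (simp_all add: sum.neutral)
      then have "a \<in> keys (\<Phi> F)" using a by (simp add: in_keys_iff)
      with ev_a m(1) show "j \<in> ev ` keys (\<Phi> F)" by (metis imageI)
    qed
  qed
  then show ?thesis using that A.Apq_poly_axioms by blast
qed

section \<open>Automorphisms of the polynomial ring\<close>

locale Apq_algebra =
  fixes scale :: "'k::field \<Rightarrow> 'b::ring_1 \<Rightarrow> 'b" and p q :: 'k and x y s t :: 'b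
  assumes Apq: "is_Apq scale p q x y s t"
    and pq: "p \<noteq> 0" "q \<noteq> 0" "p \<noteq> 1" "q \<noteq> 1"
begin

lemma alg: "unital_algebra scale"
  by (rule is_Apq_relations(1)[OF Apq])

sublocale unital_algebra scale
  by (rule alg)

lemmas poly_alg = unital_algebra_poly_scale[OF alg]

definition embedding :: "(nat \<Rightarrow>\<^sub>0 'b) \<Rightarrow> expo \<Rightarrow>\<^sub>0 'k" where
  "embedding = (SOME \<Phi>. Apq_poly (poly_scale scale) p q (poly_const x) (poly_const y) (poly_const s)
      (poly_const t) poly_var \<Phi> \<and> (\<forall>F. ev ` keys (\<Phi> F) = int ` keys F))"

lemma embedding:
  shows embedding_Apq_poly: "Apq_poly (poly_scale scale) p q (poly_const x) (poly_const y) (poly_const s)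
      (poly_const t) poly_var embedding"
    and ev_embedding: "ev ` keys (embedding F) = int ` keys F"
proof -
  have "\<exists>\<Phi>. Apq_poly (poly_scale scale) p q (poly_const x) (poly_const y) (poly_const s)
      (poly_const t) poly_var \<Phi> \<and> (\<forall>F. ev ` keys (\<Phi> F) = int ` keys F)"
    by (rule Apq_poly_exists[OF Apq pq]) (intro exI conjI)
  from someI_ex[OF this, folded embedding_def]
  show "Apq_poly (poly_scale scale) p q (poly_const x) (poly_const y) (poly_const s)
      (poly_const t) poly_var embedding"
    "ev ` keys (embedding F) = int ` keys F" by simp_all
qed

sublocale A: Apq_poly "poly_scale scale" p q "poly_const x" "poly_const y" "poly_const s"
    "poly_const t" poly_var embedding
  by (rule embedding_Apq_poly)

text \<open>The classification maps each generator of \<open>B\<close> to a multiple of a generator of \<open>B\<close>.\<close>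

lemma alg_aut_const:
  assumes \<phi>: "\<phi> \<in> alg_aut (poly_scale scale)"
  shows "\<phi> (poly_const u) \<in> range poly_const"
proof -
  note aut = alg_autD[OF poly_alg \<phi>]
  have closed: "F * G \<in> range poly_const" "F + G \<in> range poly_const"
    if FG: "F \<in> range poly_const" "G \<in> range poly_const" for F G :: "nat \<Rightarrow>\<^sub>0 'b"
  proof -
    obtain u w where "F = poly_const u" "G = poly_const w" using FG by blast
    then have "F * G = poly_const (u * w)" "F + G = poly_const (u + w)"
      by (simp_all add: poly_const_simps)
    then show "F * G \<in> range poly_const" "F + G \<in> range poly_const" by blast+
  qed
  have closed_scale: "poly_scale scale c F \<in> range poly_const" if "F \<in> range poly_const" for c F
    using that by (auto simp: poly_scale_const[OF alg])
  have gens: "\<phi> (poly_const x) \<in> range poly_const \<and> \<phi> (poly_const y) \<in> range poly_const"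
    by (rule A.aut_xy[OF \<phi>]) (simp_all add: closed_scale)
  have gens': "\<phi> (poly_const s) \<in> range poly_const \<and> \<phi> (poly_const t) \<in> range poly_const"
    by (rule A.aut_s_t[OF \<phi>]) (simp_all add: closed_scale)
  show ?thesis
    using Apq
  proof (induction u rule: is_Apq_induct)
    case one
    show ?case using rangeI[of poly_const 1] by (simp add: poly_const_simps aut)
  next
    case (scale c u)
    have "\<phi> (poly_const (scale c u)) = poly_scale scale c (\<phi> (poly_const u))"
      by (simp only: aut flip: poly_scale_const[OF alg])
    with scale closed_scale show ?case by simp
  qed (use gens gens' in \<open>simp_all add: poly_const_simps aut closed\<close>)
qed

lemma alg_aut_const_eq:
  assumes "\<phi> \<in> alg_aut (poly_scale scale)"
  shows "\<phi> (poly_const u) = poly_const (lookup (\<phi> (poly_const u)) 0)"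
proof -
  obtain w where "\<phi> (poly_const u) = poly_const w" using alg_aut_const[OF assms, of u] by blast
  then show ?thesis by (simp add: poly_const_def)
qed

lemma unit_is_scalar:
  assumes "u * w = 1"
  obtains c where "c \<noteq> 0" "u = scale c 1"
proof -
  have "poly_const u * poly_const w = 1" using assms by (simp flip: poly_const_simps)
  then obtain c where "c \<noteq> 0" "poly_const u = poly_scale scale c 1" by (rule A.unit_scalar)
  moreover have "poly_scale scale c 1 = poly_const (scale c 1)" for c
    using poly_scale_const[OF alg, of c 1] by (simp add: poly_const_simps)
  ultimately show ?thesis using that by (simp add: poly_const_inject)
qed

text \<open>Degrees in the variable are additive, since they can be read off in the quantum torus.\<close>

lemma Max_keys_mult:
  fixes F G :: "nat \<Rightarrow>\<^sub>0 'b"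
  assumes nz: "F \<noteq> 0" "G \<noteq> 0"
  shows "Max (keys F) + Max (keys G) \<in> keys (F * G)"
    and "i \<in> keys (F * G) \<Longrightarrow> i \<le> Max (keys F) + Max (keys G)"
proof -
  have Max: "ev a = int (Max (keys H))"
    if a: "a \<in> keys (embedding H)" and max: "\<forall>c\<in>keys (embedding H). ev c \<le> ev a" for a H
  proof -
    have "ev a \<in> int ` keys H" using imageI[OF a, of ev] by (simp only: ev_embedding)
    then obtain i where i: "i \<in> keys H" "ev a = int i" by blast
    have "j \<le> i" if "j \<in> keys H" for j
    proof -
      have "int j \<in> ev ` keys (embedding H)" using that by (simp add: ev_embedding)
      then obtain c where c: "c \<in> keys (embedding H)" "int j = ev c" by (rule imageE)
      with bspec[OF max c(1)] i(2) show ?thesis by simp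
    qed
    then have "Max (keys H) = i" using i(1) by (intro Max_eqI) simp_all
    with i(2) show ?thesis by simp
  qed
  obtain a b where a: "a \<in> keys (embedding F)" "\<forall>c\<in>keys (embedding F). ev c \<le> ev a"
    and b: "b \<in> keys (embedding G)" "\<forall>c\<in>keys (embedding G). ev c \<le> ev b"
    and ab: "a + b \<in> keys (embedding (F * G))"
    by (rule A.weight_split[OF additive_weights(5) nz])
  have "ev (a + b) \<in> int ` keys (F * G)" using imageI[OF ab, of ev] by (simp only: ev_embedding)
  then show "Max (keys F) + Max (keys G) \<in> keys (F * G)"
    using Max[OF a] Max[OF b] by (auto simp flip: of_nat_add)
  show "i \<le> Max (keys F) + Max (keys G)" if i: "i \<in> keys (F * G)"
  proof -
    obtain j k where "i = j + k" "j \<in> keys F" "k \<in> keys G"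
      using i keys_mult[of F G] by blast
    then show ?thesis by (simp add: add_mono)
  qed
qed

lemma Max_keys_power:
  fixes F :: "nat \<Rightarrow>\<^sub>0 'b"
  assumes "F \<noteq> 0"
  shows "F ^ i \<noteq> 0" "Max (keys (F ^ i)) = i * Max (keys F)"
proof -
  have 1: "(1 :: nat \<Rightarrow>\<^sub>0 'b) \<noteq> 0"
    using assms by (metis mult_zero_left mult_1_left)
  have "F ^ i \<noteq> 0 \<and> Max (keys (F ^ i)) = i * Max (keys F)"
  proof (induction i)
    case 0
    have "keys (1 :: nat \<Rightarrow>\<^sub>0 'b) = {0}" using 1 by (metis keys_one one_neq_zero)
    with 1 show ?case by simp
  next
    case (Suc i)
    then have nz: "F ^ i \<noteq> 0" by simp
    have "Max (keys (F * F ^ i)) = Max (keys F) + Max (keys (F ^ i))"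
      using Max_keys_mult[OF assms nz] by (intro Max_eqI) simp_all
    moreover have "F * F ^ i \<noteq> 0" using Max_keys_mult(1)[OF assms nz] by auto
    ultimately show ?case using Suc by simp
  qed
  then show "F ^ i \<noteq> 0" "Max (keys (F ^ i)) = i * Max (keys F)" by simp_all
qed

lemma alg_aut_expansion:
  assumes \<phi>: "\<phi> \<in> alg_aut (poly_scale scale)"
  shows "\<phi> F = (\<Sum>i\<in>keys F. \<phi> (poly_const (lookup F i)) * \<phi> poly_var ^ i)"
proof -
  note aut = alg_autD[OF poly_alg \<phi>]
  have sum: "\<phi> (\<Sum>i\<in>I. f i) = (\<Sum>i\<in>I. \<phi> (f i))" for f and I :: "nat set"
    by (induction I rule: infinite_finite_induct) (simp_all add: aut)
  have power: "\<phi> (poly_var ^ i) = \<phi> poly_var ^ i" for i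
    by (induction i) (simp_all add: aut)
  have "\<phi> F = \<phi> (\<Sum>i\<in>keys F. poly_const (lookup F i) * poly_var ^ i)"
    by (rule arg_cong[OF poly_expansion])
  then show ?thesis by (simp only: sum aut(3) power)
qed

text \<open>As \<open>\<phi>\<close> preserves \<open>B\<close>, it multiplies degrees in the variable by the degree \<open>d\<close> of the image \<open>V\<close> of the
  variable. The variable itself is an image and has degree one, so \<open>d = 1\<close>; its preimage is linear as
  well, and comparing the coefficients of degree one shows that the leading coefficient of \<open>V\<close> is a
  unit.\<close>

lemma alg_aut_var:
  assumes \<phi>: "\<phi> \<in> alg_aut (poly_scale scale)"
  obtains a b where "a \<noteq> 0" "\<phi> poly_var = poly_scale scale a poly_var + poly_const b"
proof -
  note aut = alg_autD[OF poly_alg \<phi>]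
  let ?V = "\<phi> poly_var" and ?d = "Max (keys (\<phi> poly_var))"
  have one: "(1::'b) \<noteq> 0"
  proof
    assume "(1::'b) = 0"
    then have "u = w" for u w :: 'b by (metis mult_1_right mult_zero_right)
    then have 2: "F = G" for F G :: "nat \<Rightarrow>\<^sub>0 'b" by (metis poly_mapping_eqI)
    show False using A.z_nonzero 2 by blast
  qed
  have var_keys: "keys (poly_var :: nat \<Rightarrow>\<^sub>0 'b) = {1}" using one by (simp add: poly_var_def)
  then have V0: "?V \<noteq> 0" using aut(6,7) by (metis insert_not_empty keys_zero)
  obtain \<psi> where \<psi>: "\<And>u. \<phi> (\<psi> u) = u" using alg_aut_inverse[OF poly_alg \<phi>] by metis
  define F where "F = \<psi> poly_var"
  have \<phi>F: "\<phi> F = poly_var" by (simp add: F_def \<psi>)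
  define g where "g u = lookup (\<phi> (poly_const u)) 0" for u
  have g: "\<phi> (poly_const u) = poly_const (g u)" for u
    unfolding g_def by (rule alg_aut_const_eq[OF \<phi>])
  have const0: "poly_const u = 0 \<longleftrightarrow> u = 0" for u :: 'b
    using poly_const_inject[of u 0] by (simp add: poly_const_simps(5))
  have g0: "g u = 0 \<longleftrightarrow> u = 0" for u
    using aut(7)[of "poly_const u" "poly_const 0"]
    by (simp add: g aut(6) poly_const_simps(5) const0)
  have lookup_F: "lookup (\<phi> F) j =
      (\<Sum>i\<in>keys F. g (lookup F i) * lookup (?V ^ i) j)" for j
    using arg_cong[OF alg_aut_expansion[OF \<phi>, of F], of "\<lambda>G. lookup G j"]
    by (simp add: lookup_sum g)
  have small: "lookup (?V ^ i) j = 0" if "i * ?d < j" for i j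
  proof (rule ccontr)
    assume "lookup (?V ^ i) j \<noteq> 0"
    then have "j \<in> keys (?V ^ i)" by (simp add: in_keys_iff)
    then have "j \<le> Max (keys (?V ^ i))" by simp
    with Max_keys_power(2)[OF V0] that show False by simp
  qed
  let ?N = "Max (keys F)"
  have "F \<noteq> 0" using \<phi>F aut(6) var_keys by (metis insert_not_empty keys_zero)
  then have N: "?N \<in> keys F" by (intro Max_in) simp_all
  have "?d \<noteq> 0"
  proof
    assume "?d = 0"
    then have "lookup (\<phi> F) 1 = 0"
      unfolding lookup_F by (intro sum.neutral) (simp add: small)
    then show False using one by (simp add: \<phi>F poly_var_def)
  qed
  have "lookup (\<phi> F) (?N * ?d) =
      g (lookup F ?N) * lookup (?V ^ ?N) (?N * ?d)"
  proof -
    have "g (lookup F i) * lookup (?V ^ i) (?N * ?d) = 0"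
      if i: "i \<in> keys F - {?N}" for i
    proof -
      have "i < ?N" using i by (metis DiffD1 DiffD2 Max_ge finite_keys insertI1 le_neq_implies_less)
      then have "i * ?d < ?N * ?d" using \<open>?d \<noteq> 0\<close> by simp
      then show ?thesis by (simp add: small)
    qed
    then show ?thesis unfolding lookup_F using N by (subst sum.remove[of _ ?N]) simp_all
  qed
  also have "\<dots> \<noteq> 0"
  proof -
    have g_nz: "g (lookup F ?N) \<noteq> 0"
      using N g0 by (simp add: in_keys_iff)
    then have nz: "poly_const (g (lookup F ?N)) \<noteq> 0"
      by (simp add: const0)
    have "Max (keys (poly_const (g (lookup F ?N)))) = 0"
      using g_nz by (simp add: poly_const_def)
    with Max_keys_mult(1)[OF nz Max_keys_power(1)[OF V0, of ?N]] Max_keys_power(2)[OF V0, of ?N]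
    show ?thesis by (simp add: in_keys_iff)
  qed
  finally have "?N * ?d \<in> keys (poly_var :: nat \<Rightarrow>\<^sub>0 'b)" by (simp add: in_keys_iff \<phi>F)
  then have N1: "?N = 1" and d1: "?d = 1" by (simp_all add: var_keys)
  have "j = 0 \<or> j = 1" if "j \<in> keys ?V" for j
    using Max_ge[OF finite_keys that] d1 by auto
  then have V: "?V = single 1 (lookup ?V 1) + poly_const (lookup ?V 0)"
    by (intro poly_mapping_eqI) (auto simp: lookup_add lookup_single poly_const_def when_def in_keys_iff)
  have "lookup (\<phi> F) 1 = g (lookup F 1) * lookup ?V 1"
  proof -
    have "g (lookup F i) * lookup (?V ^ i) 1 = 0"
      if i: "i \<in> keys F - {1}" for i
    proof -
      have "i \<le> 1" using i N1 by (metis DiffD1 Max_ge finite_keys)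
      with i have "i = 0" by auto
      then show ?thesis by (simp add: lookup_one)
    qed
    then show ?thesis unfolding lookup_F using N N1 by (subst sum.remove[of _ 1]) simp_all
  qed
  then have 1: "g (lookup F 1) * lookup ?V 1 = 1"
    by (simp add: \<phi>F poly_var_def)
  then obtain c where c: "c \<noteq> 0" "g (lookup F 1) = scale c 1" by (rule unit_is_scalar)
  have "scale c (lookup ?V 1) = 1"
    using 1 unfolding c(2) by (simp flip: scale_mult_left)
  then have "scale (inverse c) (scale c (lookup ?V 1)) = scale (inverse c) 1"
    by (rule arg_cong)
  then have "lookup ?V 1 = scale (inverse c) 1" using c by simp
  then have "?V = poly_scale scale (inverse c) poly_var + poly_const (lookup ?V 0)"
    using V by (simp add: poly_var_def poly_scale_single[OF alg])
  with c that show ?thesis by (metis inverse_nonzero_iff_nonzero)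
qed

lemma alg_aut_restrict:
  assumes \<phi>: "\<phi> \<in> alg_aut (poly_scale scale)"
  obtains g where "g \<in> alg_aut scale" "\<forall>u. \<phi> (poly_const u) = poly_const (g u)"
proof -
  note aut = alg_autD[OF poly_alg \<phi>]
  obtain \<psi> where \<psi>: "\<psi> \<in> alg_aut (poly_scale scale)" "\<And>u. \<psi> (\<phi> u) = u" "\<And>u. \<phi> (\<psi> u) = u"
    using alg_aut_inverse[OF poly_alg \<phi>] by metis
  define g where "g u = lookup (\<phi> (poly_const u)) 0" for u
  have g: "\<phi> (poly_const u) = poly_const (g u)" for u
    unfolding g_def by (rule alg_aut_const_eq[OF \<phi>])
  define h where "h u = lookup (\<psi> (poly_const u)) 0" for u
  have h: "\<psi> (poly_const u) = poly_const (h u)" for u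
    unfolding h_def by (rule alg_aut_const_eq[OF \<psi>(1)])
  have "h (g u) = u" "g (h u) = u" for u
    using \<psi>(2)[of "poly_const u"] \<psi>(3)[of "poly_const u"] by (simp_all add: g h poly_const_inject)
  then have "bij g" by (metis bijI')
  moreover have "g (u + w) = g u + g w" "g (scale c u) = scale c (g u)" "g (u * w) = g u * g w" "g 1 = 1" for u w c
    using aut(1)[of "poly_const u" "poly_const w"] aut(2)[of c "poly_const u"]
      aut(3)[of "poly_const u" "poly_const w"] aut(4)
    by (simp_all add: g poly_scale_const[OF alg] poly_const_inject flip: poly_const_simps)
  ultimately have "g \<in> alg_aut scale" by (intro alg_autI[OF alg])
  with g that show ?thesis by blast
qed

lemma alg_aut_poly:
  assumes \<phi>: "\<phi> \<in> alg_aut (poly_scale scale)"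
  obtains g a b where "g \<in> alg_aut scale" "\<forall>u. \<phi> (poly_const u) = poly_const (g u)" "a \<noteq> 0"
    "b \<in> ring_center" "\<phi> poly_var = poly_scale scale a poly_var + poly_const b"
proof -
  note aut = alg_autD[OF poly_alg \<phi>]
  obtain g where g: "g \<in> alg_aut scale" "\<forall>u. \<phi> (poly_const u) = poly_const (g u)"
    by (rule alg_aut_restrict[OF \<phi>])
  obtain a b where ab: "a \<noteq> 0" "\<phi> poly_var = poly_scale scale a poly_var + poly_const b"
    by (rule alg_aut_var[OF \<phi>])
  have b: "lookup (\<phi> poly_var) 0 = b"
    unfolding ab(2) by (simp add: lookup_add lookup_poly_scale[OF alg] poly_var_def poly_const_def lookup_single)
  have "b * g u = g u * b" for u
  proof -
    have "\<phi> poly_var * \<phi> (poly_const u) = \<phi> (poly_const u) * \<phi> poly_var"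
      by (metis aut(3) poly_var_central)
    from arg_cong[OF this, of "\<lambda>F. lookup F 0"] show ?thesis
      by (simp add: g b)
  qed
  moreover have "surj g" using g(1) by (simp add: alg_aut_def bij_is_surj)
  ultimately have "b * u = u * b" for u by (metis surjD)
  then have "b \<in> ring_center" by (simp add: ring_center_def)
  with g ab that show ?thesis by blast
qed

section \<open>From the algebra to the polynomial ring\<close>

text \<open>This transports the classification from \<open>C\<close> to \<open>B\<close>.\<close>

lemma map_alg_aut:
  assumes g: "g \<in> alg_aut scale"
  shows "Poly_Mapping.map g \<in> alg_aut (poly_scale scale)"
proof -
  note aut = alg_autD[OF alg g]
  obtain h where h: "h \<in> alg_aut scale" "\<And>u. h (g u) = u" "\<And>u. g (h u) = u"
    using alg_aut_inverse[OF alg g] by metis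
  note auth = alg_autD[OF alg h(1)]
  have lookup: "lookup (Poly_Mapping.map f F) i = f (lookup F i)" if "f 0 = 0" for f F i
    using that by (simp add: Poly_Mapping.map.rep_eq when_def)
  have add: "Poly_Mapping.map g (F + G) = Poly_Mapping.map g F + Poly_Mapping.map g G" for F G
    by (rule poly_mapping_eqI) (simp add: lookup aut lookup_add)
  show ?thesis
  proof (rule alg_autI[OF poly_alg add])
    show "Poly_Mapping.map g (poly_scale scale c F) = poly_scale scale c (Poly_Mapping.map g F)" for c F
      by (rule poly_mapping_eqI) (simp add: lookup aut lookup_poly_scale[OF alg])
    show "Poly_Mapping.map g (F * G) = Poly_Mapping.map g F * Poly_Mapping.map g G" for F G
    proof (induction F rule: poly_mapping_additive_induct)
      case (single k c)
      show ?case
        by (induction G rule: poly_mapping_additive_induct)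
          (simp_all add: mult_single aut add distrib_left)
    qed (simp add: add distrib_right)
    show "Poly_Mapping.map g 1 = 1"
      by (rule poly_mapping_eqI) (simp add: lookup aut lookup_one when_def)
    have "Poly_Mapping.map h (Poly_Mapping.map g F) = F" "Poly_Mapping.map g (Poly_Mapping.map h F) = F" for F
      by (rule poly_mapping_eqI; simp add: lookup aut auth h)+
    then show "bij (Poly_Mapping.map g)" by (metis bijI')
  qed
qed

lemma aut_generators:
  assumes g: "g \<in> alg_aut scale"
  shows "(\<exists>a. a \<noteq> 0 \<and> (g x = scale a x \<and> g y = scale (inverse a) y \<or>
      p = -1 \<and> g x = scale a y \<and> g y = scale (inverse a) x)) \<and>
    (\<exists>b c. b \<noteq> 0 \<and> c \<noteq> 0 \<and> (g s = scale b s \<and> g t = scale c t \<or>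
      q = -1 \<and> g s = scale b t \<and> g t = scale c s))"
proof -
  have map: "Poly_Mapping.map g (poly_const u) = poly_const (g u)" for u
    by (simp add: poly_const_def alg_autD[OF alg g])
  note eqs = map poly_scale_const[OF alg] poly_const_inject
  show ?thesis
  proof
    show "\<exists>a. a \<noteq> 0 \<and> (g x = scale a x \<and> g y = scale (inverse a) y \<or>
        p = -1 \<and> g x = scale a y \<and> g y = scale (inverse a) x)"
      by (rule A.aut_xy[OF map_alg_aut[OF g]]) (auto simp: eqs)
    show "\<exists>b c. b \<noteq> 0 \<and> c \<noteq> 0 \<and> (g s = scale b s \<and> g t = scale c t \<or>
        q = -1 \<and> g s = scale b t \<and> g t = scale c s)"
      by (rule A.aut_s_t[OF map_alg_aut[OF g]]) (auto simp: eqs)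
  qed
qed


section \<open>Locally nilpotent derivations\<close>

context
  fixes \<delta> :: "'b \<Rightarrow> 'b"
  assumes char0: "CHAR('k) = 0" and LND: "\<delta> \<in> LNDer scale"
begin

lemma deriv_simps:
  "\<delta> (u + w) = \<delta> u + \<delta> w" "\<delta> (scale c u) = scale c (\<delta> u)" "\<delta> 0 = 0"
  "\<delta> (\<Sum>i\<in>I. f i) = (\<Sum>i\<in>I. \<delta> (f i))" "\<delta> (u * w) = \<delta> u * w + u * \<delta> w"
proof -
  interpret \<delta>: Vector_Spaces.linear scale scale \<delta> using LND by (simp add: LNDer_def derivations_def)
  show "\<delta> (u + w) = \<delta> u + \<delta> w" "\<delta> (scale c u) = scale c (\<delta> u)" "\<delta> 0 = 0"
    "\<delta> (\<Sum>i\<in>I. f i) = (\<Sum>i\<in>I. \<delta> (f i))"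
    by (rule \<delta>.add \<delta>.scale \<delta>.zero \<delta>.sum)+
  show "\<delta> (u * w) = \<delta> u * w + u * \<delta> w"
    using LND by (simp add: LNDer_def derivations_def)
qed

lemma nilpotent: "\<exists>n. (\<delta> ^^ n) u = 0"
  using LND by (simp add: LNDer_def)

lemma of_nat_nonzero: "n \<noteq> 0 \<Longrightarrow> (of_nat n :: 'k) \<noteq> 0"
  using char0 by (simp add: of_nat_eq_0_iff_char_dvd)

text \<open>The divided powers of \<open>\<delta>\<close> are the coefficients of \<open>exp(w\<delta>)\<close>.\<close>

definition divided :: "nat \<Rightarrow> 'b \<Rightarrow> 'b" where
  "divided n u = scale (inverse (of_nat (fact n))) ((\<delta> ^^ n) u)"

lemma divided_0 [simp]: "divided 0 u = u"
  by (simp add: divided_def)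

lemma deriv_divided: "\<delta> (divided n u) = scale (of_nat (Suc n)) (divided (Suc n) u)"
proof -
  have "(of_nat (fact (Suc n)) :: 'k) = of_nat (Suc n) * of_nat (fact n)"
    by (simp only: fact_Suc of_nat_mult of_nat_id)
  then have "of_nat (Suc n) * inverse (of_nat (fact (Suc n))) = (inverse (of_nat (fact n)) :: 'k)"
    using of_nat_nonzero[of "Suc n"] by (simp del: of_nat_Suc fact_Suc)
  then show ?thesis by (simp add: divided_def deriv_simps del: of_nat_Suc fact_Suc)
qed

lemma divided_linear:
  "divided n (u + w) = divided n u + divided n w" "divided n (scale c u) = scale c (divided n u)"
proof -
  have "(\<delta> ^^ n) (u + w) = (\<delta> ^^ n) u + (\<delta> ^^ n) w" "(\<delta> ^^ n) (scale c u) = scale c ((\<delta> ^^ n) u)"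
    by (induction n) (simp_all add: deriv_simps)
  then show "divided n (u + w) = divided n u + divided n w" "divided n (scale c u) = scale c (divided n u)"
    by (simp_all add: divided_def scale_right_distrib mult.commute)
qed

text \<open>The Leibniz rule for divided powers has no binomial coefficients. In the induction step \<open>\<delta>\<close> is
  applied to the sum for \<open>n\<close>, and \<open>k + (Suc n - k) = Suc n\<close> collects the two shifted sums.\<close>

lemma divided_mult: "divided n (u * w) = (\<Sum>k\<le>n. divided k u * divided (n - k) w)"
proof (induction n)
  case (Suc n)
  let ?f = "\<lambda>k. divided k u * divided (Suc n - k) w"
  have "scale (of_nat (Suc n)) (divided (Suc n) (u * w)) = \<delta> (\<Sum>k\<le>n. divided k u * divided (n - k) w)"
    using deriv_divided[of n "u * w"] Suc by simp
  also have "\<dots> = (\<Sum>k\<le>n. scale (of_nat (Suc k)) (?f (Suc k))) + (\<Sum>k\<le>n. scale (of_nat (Suc n - k)) (?f k))"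
    unfolding deriv_simps sum.distrib deriv_divided
    by (intro arg_cong2[of _ _ _ _ plus] sum.cong)
      (auto simp: Suc_diff_le simp flip: scale_mult_left scale_mult_right simp del: of_nat_Suc)
  also have "(\<Sum>k\<le>n. scale (of_nat (Suc k)) (?f (Suc k))) = (\<Sum>k\<le>Suc n. scale (of_nat k) (?f k))"
    by (subst sum.atMost_Suc_shift) simp
  also have "(\<Sum>k\<le>n. scale (of_nat (Suc n - k)) (?f k)) = (\<Sum>k\<le>Suc n. scale (of_nat (Suc n - k)) (?f k))"
    by simp
  also have "(\<Sum>k\<le>Suc n. scale (of_nat k) (?f k)) + (\<Sum>k\<le>Suc n. scale (of_nat (Suc n - k)) (?f k)) =
      (\<Sum>k\<le>Suc n. scale (of_nat (Suc n)) (?f k))"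
    unfolding sum.distrib[symmetric]
    by (intro sum.cong) (auto simp flip: scale_left_distrib of_nat_add simp del: of_nat_Suc)
  also have "\<dots> = scale (of_nat (Suc n)) (\<Sum>k\<le>Suc n. ?f k)"
    by (simp only: scale_sum_right)
  finally show ?case
    using of_nat_nonzero[of "Suc n"] scale_left_imp_eq by blast
qed simp

lemma divided_finite: "finite {n. divided n u \<noteq> 0}"
proof -
  obtain N where N: "(\<delta> ^^ N) u = 0" using nilpotent by blast
  have "(\<delta> ^^ (N + k)) u = 0" for k
    by (induction k) (simp_all add: N deriv_simps)
  then have zero: "divided n u = 0" if "N \<le> n" for n
    using that by (metis divided_def le_add_diff_inverse scale_zero_right)
  have "{n. divided n u \<noteq> 0} \<subseteq> {..<N}"
    using zero by (auto simp flip: not_le)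
  then show ?thesis by (rule finite_subset) simp
qed

definition flow :: "'b \<Rightarrow> nat \<Rightarrow>\<^sub>0 'b" where
  "flow u = Abs_poly_mapping (\<lambda>n. divided n u)"

lemma lookup_flow [simp]: "lookup (flow u) n = divided n u"
  unfolding flow_def using divided_finite by (simp add: lookup_Abs_poly_mapping)

lemma flow_hom:
  "flow (u + w) = flow u + flow w" "flow (scale c u) = poly_scale scale c (flow u)"
  "flow (u * w) = flow u * flow w" "flow 1 = 1"
proof -
  show "flow (u + w) = flow u + flow w" "flow (scale c u) = poly_scale scale c (flow u)"
    by (rule poly_mapping_eqI; simp add: divided_linear lookup_add lookup_poly_scale[OF alg])+
  show "flow (u * w) = flow u * flow w"
    by (rule poly_mapping_eqI) (simp add: divided_mult lookup_poly_mult)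
  have "\<delta> 1 = 0" using deriv_simps(5)[of 1 1] by simp
  then have "(\<delta> ^^ Suc n) 1 = 0" for n by (induction n) (simp_all add: deriv_simps)
  then have "divided n 1 = (if n = 0 then 1 else 0)" for n by (cases n) (simp_all add: divided_def del: funpow.simps)
  then show "flow 1 = 1" by (intro poly_mapping_eqI) (simp add: lookup_one when_def)
qed

interpretation C: explicit_algebra "poly_scale scale" "(*)" 1
  by (rule unital_algebra.explicit_algebra[OF poly_alg])

definition exponential :: "(nat \<Rightarrow>\<^sub>0 'b) \<Rightarrow> (nat \<Rightarrow>\<^sub>0 'b)" where
  "exponential = explicit_algebra.poly_ext (*) 1 flow poly_var"

lemmas exponential_hom =
  C.poly_ext_add[OF alg flow_hom poly_var_central, folded exponential_def]
  C.poly_ext_scale[OF alg flow_hom poly_var_central, folded exponential_def]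
  C.poly_ext_mult[OF alg flow_hom poly_var_central, folded exponential_def]
  C.poly_ext_one[OF alg flow_hom poly_var_central, folded exponential_def]
  C.poly_ext_const[OF alg flow_hom poly_var_central, folded exponential_def]
  C.poly_ext_var[OF alg flow_hom poly_var_central, folded exponential_def]

lemma exponential_zero: "exponential 0 = 0"
  using exponential_hom(1)[of 0 0] by simp

lemma exponential_sum: "exponential (\<Sum>i\<in>I. f i) = (\<Sum>i\<in>I. exponential (f i))"
  by (induction I rule: infinite_finite_induct) (simp_all add: exponential_zero exponential_hom(1))

lemma exponential_var_power: "exponential (poly_var ^ i) = poly_var ^ i"
  by (induction i) (simp_all add: exponential_hom)

text \<open>The exponential does not change the lowest coefficient.\<close>

lemma exponential_inj: "inj exponential"
proof -
  have "F = 0" if "exponential F = 0" for F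
  proof (rule ccontr)
    assume "F \<noteq> 0"
    let ?m = "Min (keys F)"
    have m: "?m \<in> keys F" using \<open>F \<noteq> 0\<close> by (intro Min_in) simp_all
    have "exponential F = (\<Sum>i\<in>keys F. flow (lookup F i) * poly_var ^ i)"
      using arg_cong[OF poly_expansion[of F], of exponential]
      by (simp only: exponential_sum exponential_hom exponential_var_power)
    then have "lookup (exponential F) ?m =
        (\<Sum>i\<in>keys F. lookup (flow (lookup F i) * poly_var ^ i) ?m)"
      by (simp add: lookup_sum)
    also have "\<dots> = (\<Sum>i\<in>keys F. if i = ?m then lookup F ?m else 0)"
    proof (intro sum.cong refl)
      fix i assume "i \<in> keys F"
      then have "?m \<le> i" by simp
      then show "lookup (flow (lookup F i) * poly_var ^ i) ?m =
          (if i = ?m then lookup F ?m else 0)"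
        by (auto simp: lookup_mult_var_power)
    qed
    also have "\<dots> = lookup F ?m" using m by simp
    finally show False using m that by (simp add: in_keys_iff)
  qed
  moreover have "exponential (F - G) = exponential F - exponential G" for F G
    using exponential_hom(1)[of "F - G" G] by (simp add: eq_diff_eq)
  ultimately show ?thesis by (metis eq_iff_diff_eq_0 injI)
qed

text \<open>It suffices to reach the constants. The flow of \<open>u\<close> differs from \<open>u\<close> by terms whose coefficients are
  annihilated by a smaller power of \<open>\<delta>\<close> than \<open>u\<close> is.\<close>

lemma exponential_surj: "surj exponential"
proof -
  have add: "F + G \<in> range exponential" if FG: "F \<in> range exponential" "G \<in> range exponential" for F G
  proof -
    obtain F' G' where "F = exponential F'" "G = exponential G'" using FG by blast
    then have "F + G = exponential (F' + G')" by (simp add: exponential_hom)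
    then show ?thesis by blast
  qed
  have mult: "F * poly_var ^ i \<in> range exponential" if F: "F \<in> range exponential" for F i
  proof -
    obtain F' where "F = exponential F'" using F by blast
    then have "F * poly_var ^ i = exponential (F' * poly_var ^ i)"
      by (simp add: exponential_hom exponential_var_power)
    then show ?thesis by blast
  qed
  have zero: "0 \<in> range exponential" by (rule range_eqI[of _ _ 0]) (simp add: exponential_zero)
  have uminus: "- F \<in> range exponential" if F: "F \<in> range exponential" for F
  proof -
    obtain F' where F': "F = exponential F'" using F by blast
    have "exponential (- F') + exponential F' = 0" by (simp add: exponential_zero flip: exponential_hom(1))
    then have "exponential (- F') = - exponential F'" by (simp add: eq_neg_iff_add_eq_0)
    then have "- F = exponential (- F')" by (simp add: F')
    then show ?thesis by blast
  qed
  have sum: "(\<Sum>i\<in>I. f i) \<in> range exponential" if "\<And>i. i \<in> I \<Longrightarrow> f i \<in> range exponential" for f and I :: "nat set"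
    using that by (induction I rule: infinite_finite_induct) (simp_all add: add zero)
  have const: "(\<delta> ^^ N) u = 0 \<Longrightarrow> poly_const u \<in> range exponential" for N u
  proof (induction N arbitrary: u rule: less_induct)
    case (less N)
    have tail: "single i (divided i u) \<in> range exponential" if "i \<noteq> 0" for i
    proof (cases "divided i u = 0")
      case True
      then show ?thesis using zero by simp
    next
      case False
      then have "i < N"
      proof -
        have "(\<delta> ^^ i) u \<noteq> 0" using False by (auto simp: divided_def)
        moreover have "(\<delta> ^^ (N + k)) u = 0" for k
          by (induction k) (simp_all add: less.prems deriv_simps)
        ultimately show ?thesis by (metis le_add_diff_inverse linorder_not_le)
      qed
      have lin: "(\<delta> ^^ k) (scale c w) = scale c ((\<delta> ^^ k) w)" for k c w
        by (induction k) (simp_all add: deriv_simps)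
      have "(\<delta> ^^ (N - i)) (divided i u) = scale (inverse (of_nat (fact i))) ((\<delta> ^^ (N - i + i)) u)"
        by (simp only: divided_def lin funpow_add comp_apply)
      also have "\<dots> = 0" using \<open>i < N\<close> less.prems by simp
      finally have "poly_const (divided i u) \<in> range exponential"
        using less.IH[of "N - i"] that \<open>i < N\<close> by simp
      then show ?thesis unfolding single_eq_const_var by (rule mult)
    qed
    define K where "K = keys (flow u) - {0}"
    have "flow u = poly_const u + (\<Sum>i\<in>K. single i (divided i u))"
      by (rule poly_mapping_eqI)
        (auto simp: K_def lookup_add lookup_sum poly_const_def lookup_single when_def in_keys_iff)
    then have "poly_const u = flow u + - (\<Sum>i\<in>K. single i (divided i u))"
      by simp
    moreover have "flow u \<in> range exponential" by (metis exponential_hom(5) rangeI)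
    moreover have "- (\<Sum>i\<in>K. single i (divided i u)) \<in> range exponential"
      using tail by (intro uminus sum) (simp add: K_def)
    ultimately show ?case using add by metis
  qed
  have "F \<in> range exponential" for F
  proof (induction F rule: poly_mapping_additive_induct)
    case (single k c)
    show ?case unfolding single_eq_const_var
      using const nilpotent[of c] by (intro mult) blast
  qed (rule add)
  then show ?thesis by blast
qed

lemma locally_nilpotent_zero: "\<delta> u = 0"
proof -
  have "exponential \<in> alg_aut (poly_scale scale)"
    using exponential_inj exponential_surj by (intro alg_autI[OF poly_alg exponential_hom(1-4)]) (simp add: bij_def)
  from alg_aut_const[OF this, of u] obtain w where "flow u = poly_const w"
    by (auto simp: exponential_hom)
  from arg_cong[OF this, of "\<lambda>F. lookup F 1"] show ?thesis
    by (simp add: divided_def poly_const_def lookup_single)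
qed

end

end

section \<open>Semidirect products with a group of order two\<close>

lemma Z2_cases: "e \<in> carrier Z2 \<Longrightarrow> e = 0 \<or> e = 1"
  by (auto simp: carrier_integer_mod_group)

text \<open>Let \<open>\<tau>\<close> be an involution outside the image of \<open>N\<close> that normalises this image. Then conjugation by \<open>\<tau>\<close>
  defines the action, and \<open>(e, n)\<close> is mapped to \<open>j n \<tau>\<^sup>e\<close>. The image is stated explicitly, so that the
  construction can be iterated inside a larger group.\<close>

lemma (in group) semidirect_embedding:
  assumes N: "group N" and j: "j \<in> hom N G" and inj: "inj_on j (carrier N)"
    and \<tau>: "\<tau> \<in> carrier G" "\<tau> \<otimes> \<tau> = \<one>" "\<tau> \<notin> j ` carrier N"
    and conj: "\<And>n. n \<in> carrier N \<Longrightarrow> \<tau> \<otimes> j n \<otimes> \<tau> \<in> j ` carrier N"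
  obtains \<theta> J where "\<theta> \<in> hom Z2 (AutoGroup N)" "J \<in> hom (semidirect Z2 N \<theta>) G"
    "inj_on J (carrier (semidirect Z2 N \<theta>))"
    "J ` carrier (semidirect Z2 N \<theta>) = j ` carrier N \<union> (\<lambda>u. u \<otimes> \<tau>) ` j ` carrier N"
proof -
  interpret N: group N by fact
  have jc: "j n \<in> carrier G" if "n \<in> carrier N" for n using j that by (auto simp: hom_def)
  have jm: "j (m \<otimes>\<^bsub>N\<^esub> n) = j m \<otimes> j n" if "m \<in> carrier N" "n \<in> carrier N" for m n
    using j that by (auto simp: hom_def)
  have \<tau>\<tau>: "\<tau> \<otimes> (\<tau> \<otimes> u) = u" if "u \<in> carrier G" for u
    using that \<tau> by (simp flip: m_assoc)
  define c where "c = (\<lambda>n\<in>carrier N. inv_into (carrier N) j (\<tau> \<otimes> j n \<otimes> \<tau>))"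
  have cc: "c n \<in> carrier N" and jcn: "j (c n) = \<tau> \<otimes> j n \<otimes> \<tau>" if "n \<in> carrier N" for n
    using conj[OF that] that by (simp_all add: c_def inv_into_into f_inv_into_f)
  have eqI: "m = n" if "j m = j n" "m \<in> carrier N" "n \<in> carrier N" for m n
    using inj that by (rule inj_onD)
  have c_mult: "c (m \<otimes>\<^bsub>N\<^esub> n) = c m \<otimes>\<^bsub>N\<^esub> c n" if "m \<in> carrier N" "n \<in> carrier N" for m n
    using that by (intro eqI) (simp_all add: jm jcn cc jc m_assoc \<tau> \<tau>\<tau>)
  have c_invol: "c (c n) = n" if "n \<in> carrier N" for n
    using that by (intro eqI) (simp_all add: jcn cc jc m_assoc \<tau> \<tau>\<tau>)
  have "bij_betw c (carrier N) (carrier N)"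
    by (rule bij_betw_byWitness[of _ c]) (auto simp: c_invol cc)
  moreover have ext: "c \<in> extensional (carrier N)" by (simp add: c_def)
  ultimately have c_auto: "c \<in> auto N"
    by (auto simp: auto_def Bij_def hom_def cc c_mult)
  have id_auto: "(\<lambda>n\<in>carrier N. n) \<in> auto N" by (rule N.id_in_auto)
  have comp: "compose (carrier N) c c = (\<lambda>n\<in>carrier N. n)"
    by (auto simp: compose_def c_invol cong: restrict_cong)
  have comp': "compose (carrier N) c (\<lambda>n\<in>carrier N. n) = c"
    by (rule extensionalityI[of _ "carrier N"]) (simp_all add: ext compose_eq)
  have bij: "c \<in> Bij (carrier N)" "(\<lambda>n\<in>carrier N. n) \<in> Bij (carrier N)"
    using c_auto id_auto by (simp_all add: auto_def)
  define \<theta> where "\<theta> e = (if e = 0 then (\<lambda>n\<in>carrier N. n) else c)" for e :: int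
  have \<theta>_hom: "\<theta> \<in> hom Z2 (AutoGroup N)"
  proof (rule homI)
    fix a assume "a \<in> carrier Z2"
    then show "\<theta> a \<in> carrier (AutoGroup N)"
      using c_auto id_auto by (auto simp: \<theta>_def AutoGroup_def)
  next
    fix a b assume "a \<in> carrier Z2" "b \<in> carrier Z2"
    then show "\<theta> (a \<otimes>\<^bsub>Z2\<^esub> b) = \<theta> a \<otimes>\<^bsub>AutoGroup N\<^esub> \<theta> b"
      using Z2_cases[of a] Z2_cases[of b] bij ext
      by (auto simp: \<theta>_def AutoGroup_def BijGroup_def comp comp' compose_Id Id_compose Bij_imp_funcset)
  qed
  define J where "J = (\<lambda>(e :: int, n). j n \<otimes> (if e = 0 then \<one> else \<tau>))"
  have J_hom: "J \<in> hom (semidirect Z2 N \<theta>) G"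
  proof (rule homI)
    fix u assume "u \<in> carrier (semidirect Z2 N \<theta>)"
    then show "J u \<in> carrier G" using \<tau> by (auto simp: J_def semidirect_def jc)
  next
    fix u w assume u: "u \<in> carrier (semidirect Z2 N \<theta>)" and w: "w \<in> carrier (semidirect Z2 N \<theta>)"
    obtain a m where u': "u = (a, m)" "a = 0 \<or> a = 1" "m \<in> carrier N"
      using u Z2_cases by (auto simp: semidirect_def)
    obtain b n where w': "w = (b, n)" "b = 0 \<or> b = 1" "n \<in> carrier N"
      using w Z2_cases by (auto simp: semidirect_def)
    show "J (u \<otimes>\<^bsub>semidirect Z2 N \<theta>\<^esub> w) = J u \<otimes> J w"
      using u'(2,3) w'(2,3) \<tau>
      by (elim disjE) (simp_all add: u' w' J_def semidirect_def \<theta>_def jm jcn cc jc m_assoc \<tau>\<tau>)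
  qed
  have J_inj: "inj_on J (carrier (semidirect Z2 N \<theta>))"
  proof (rule inj_onI)
    fix u w assume u: "u \<in> carrier (semidirect Z2 N \<theta>)" and w: "w \<in> carrier (semidirect Z2 N \<theta>)"
      and eq: "J u = J w"
    obtain a m where u': "u = (a, m)" "a = 0 \<or> a = 1" "m \<in> carrier N"
      using u Z2_cases by (auto simp: semidirect_def)
    obtain b n where w': "w = (b, n)" "b = 0 \<or> b = 1" "n \<in> carrier N"
      using w Z2_cases by (auto simp: semidirect_def)
    have no: "j m \<noteq> j n \<otimes> \<tau>" if "m \<in> carrier N" "n \<in> carrier N" for m n
    proof
      assume eq: "j m = j n \<otimes> \<tau>"
      have "j (inv\<^bsub>N\<^esub> n) \<otimes> j n = \<one>"
        using that hom_one[OF j N] by (simp flip: jm)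
      then have "j (inv\<^bsub>N\<^esub> n \<otimes>\<^bsub>N\<^esub> m) = \<tau>"
        using that \<tau>(1) by (simp add: jm eq jc flip: m_assoc)
      then show False using \<tau>(3) that by (metis N.inv_closed N.m_closed imageI)
    qed
    show "u = w"
      using u'(2,3) w'(2,3) eq no[of m n] no[of n m] \<tau>(1) eqI[of m n]
      by (elim disjE) (auto simp: u' w' J_def jc)
  qed
  have "J ` carrier (semidirect Z2 N \<theta>) = j ` carrier N \<union> (\<lambda>u. u \<otimes> \<tau>) ` j ` carrier N"
  proof (intro equalityI subsetI)
    fix g assume "g \<in> J ` carrier (semidirect Z2 N \<theta>)"
    then obtain a m where "g = J (a, m)" "a = 0 \<or> a = 1" "m \<in> carrier N"
      using Z2_cases by (auto simp: semidirect_def)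
    then show "g \<in> j ` carrier N \<union> (\<lambda>u. u \<otimes> \<tau>) ` j ` carrier N"
      by (auto simp: J_def jc)
  next
    fix g assume "g \<in> j ` carrier N \<union> (\<lambda>u. u \<otimes> \<tau>) ` j ` carrier N"
    then obtain n where n: "n \<in> carrier N" "g = j n \<or> g = j n \<otimes> \<tau>" by blast
    then have "g = J (0, n) \<or> g = J (1, n)" by (auto simp: J_def jc)
    moreover have "(0, n) \<in> carrier (semidirect Z2 N \<theta>)" "(1, n) \<in> carrier (semidirect Z2 N \<theta>)"
      using n(1) by (simp_all add: semidirect_def)
    ultimately show "g \<in> J ` carrier (semidirect Z2 N \<theta>)" by blast
  qed
  with \<theta>_hom J_hom J_inj that show ?thesis by blast
qed

lemma iso_from_hom:
  assumes "group N" "J \<in> hom N A" "inj_on J (carrier N)" "J ` carrier N = carrier A"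
  shows "A \<cong> N"
proof -
  have "J \<in> iso N A" using assms by (simp add: iso_def bij_betw_def)
  then have "N \<cong> A" by (auto simp: is_iso_def)
  then show ?thesis by (rule group.iso_sym[OF assms(1)])
qed

lemma group_unit_group: "group (unit_group :: 'k::field monoid)"
proof (rule groupI)
  fix a :: 'k assume "a \<in> carrier unit_group"
  then show "\<exists>b\<in>carrier unit_group. b \<otimes>\<^bsub>unit_group\<^esub> a = \<one>\<^bsub>unit_group\<^esub>"
    by (intro bexI[of _ "inverse a"]) (simp_all add: unit_group_def)
qed (auto simp: unit_group_def mult.assoc)

lemma group_torus3: "group (torus3 :: ('k::field \<times> 'k \<times> 'k) monoid)"
  by (intro DirProd_group group_unit_group)

section \<open>The automorphism groups\<close>

context Apq_algebra
begin

abbreviation torus :: "('k \<times> 'k \<times> 'k) monoid" where "torus \<equiv> torus3"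

lemmas rels = is_Apq_relations(2-7)[OF Apq]

text \<open>Algebra endomorphisms; they are compared on generators before bijectivity is known.\<close>

definition endo :: "('b \<Rightarrow> 'b) \<Rightarrow> bool" where
  "endo f \<longleftrightarrow> (\<forall>u w. f (u + w) = f u + f w) \<and> (\<forall>c u. f (scale c u) = scale c (f u)) \<and>
     (\<forall>u w. f (u * w) = f u * f w) \<and> f 1 = 1"

lemma endo_alg_aut: "g \<in> alg_aut scale \<Longrightarrow> endo g"
  using alg_autD[OF alg] by (simp add: endo_def)

lemma endo_comp: "endo f \<Longrightarrow> endo g \<Longrightarrow> endo (f \<circ> g)"
  by (simp add: endo_def)

lemma endo_ext:
  assumes f: "endo f" and g: "endo g" and eq: "f x = g x" "f y = g y" "f s = g s" "f t = g t"
  shows "f = g"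
proof
  fix u
  show "f u = g u"
    using Apq by (induction u rule: is_Apq_induct) (use f g eq in \<open>simp_all add: endo_def\<close>)
qed

lemma endo_exists:
  assumes "X * Y = scale p (Y * X) + 1" "S * T = scale q (T * S)"
    "S * X = X * S" "S * Y = Y * S" "T * X = X * T" "T * Y = Y * T"
  obtains f where "endo f" "f x = X" "f y = Y" "f s = S" "f t = T"
proof -
  obtain f where f: "\<And>u w. f (u + w) = f u + f w" "\<And>c u. f (scale c u) = scale c (f u)"
    "\<And>u w. f (u * w) = f u * f w" "f 1 = 1" "f x = X" "f y = Y" "f s = S" "f t = T"
    using is_Apq_hom[OF Apq explicit_algebra assms] by blast
  show ?thesis by (rule that[of f]) (simp_all add: endo_def f)
qed

lemma alg_aut_of_endo:
  assumes f: "endo f" and g: "endo g"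
    and "f (g x) = x" "f (g y) = y" "f (g s) = s" "f (g t) = t"
    and "g (f x) = x" "g (f y) = y" "g (f s) = s" "g (f t) = t"
  shows "f \<in> alg_aut scale"
proof -
  have "endo id" by (simp add: endo_def)
  with endo_comp[OF f g] endo_comp[OF g f] assms(3-) have "f \<circ> g = id" "g \<circ> f = id"
    by (auto intro!: endo_ext)
  then have "bij f" using o_bij by blast
  with f show ?thesis by (intro alg_autI[OF alg]) (simp_all add: endo_def)
qed

lemma diagonal_endo:
  assumes "a \<noteq> 0"
  obtains f where "endo f" "f x = scale a x" "f y = scale (inverse a) y" "f s = scale b s" "f t = scale c t"
proof (rule endo_exists)
  show "scale a x * scale (inverse a) y = scale p (scale (inverse a) y * scale a x) + 1"
    "scale b s * scale c t = scale q (scale c t * scale b s)"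
    using assms by (simp_all add: rels mult.commute flip: scale_mult_left scale_mult_right)
qed (use that in \<open>simp_all add: rels mult.commute flip: scale_mult_left scale_mult_right\<close>)

lemma diagonal_exists:
  assumes nz: "a \<noteq> 0" "b \<noteq> 0" "c \<noteq> 0"
  shows "\<exists>f\<in>alg_aut scale. f x = scale a x \<and> f y = scale (inverse a) y \<and> f s = scale b s \<and> f t = scale c t"
proof -
  obtain f where f: "endo f" "f x = scale a x" "f y = scale (inverse a) y" "f s = scale b s" "f t = scale c t"
    using diagonal_endo[OF nz(1)] by metis
  obtain g where g: "endo g" "g x = scale (inverse a) x" "g y = scale (inverse (inverse a)) y"
    "g s = scale (inverse b) s" "g t = scale (inverse c) t"
    using diagonal_endo[of "inverse a"] nz(1) by (metis inverse_nonzero_iff_nonzero)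
  have "f (scale r u) = scale r (f u)" "g (scale r u) = scale r (g u)" for r u
    using f(1) g(1) by (simp_all add: endo_def)
  with f g nz have "f \<in> alg_aut scale" by (intro alg_aut_of_endo[OF f(1) g(1)]) simp_all
  with f show ?thesis by blast
qed

text \<open>The diagonal automorphism \<open>x \<mapsto> a x\<close>, \<open>y \<mapsto> y/a\<close>, \<open>s \<mapsto> b s\<close>, \<open>t \<mapsto> c t\<close>, which exists for nonzero
  parameters and is determined by these values.\<close>

definition diag :: "'k \<times> 'k \<times> 'k \<Rightarrow> 'b \<Rightarrow> 'b" where
  "diag = (\<lambda>(a, b, c). SOME f. f \<in> alg_aut scale \<and>
     f x = scale a x \<and> f y = scale (inverse a) y \<and> f s = scale b s \<and> f t = scale c t)"

lemma diag:
  assumes "a \<noteq> 0" "b \<noteq> 0" "c \<noteq> 0"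
  shows "diag (a, b, c) \<in> alg_aut scale" "diag (a, b, c) x = scale a x"
    "diag (a, b, c) y = scale (inverse a) y" "diag (a, b, c) s = scale b s" "diag (a, b, c) t = scale c t"
proof -
  have "\<exists>f. f \<in> alg_aut scale \<and>
     f x = scale a x \<and> f y = scale (inverse a) y \<and> f s = scale b s \<and> f t = scale c t"
    using diagonal_exists[OF assms] by blast
  from someI_ex[OF this]
  show "diag (a, b, c) \<in> alg_aut scale" "diag (a, b, c) x = scale a x"
    "diag (a, b, c) y = scale (inverse a) y" "diag (a, b, c) s = scale b s" "diag (a, b, c) t = scale c t"
    by (simp_all add: diag_def)
qed

lemma swap_xy_exists:
  assumes "p = -1"
  obtains f where "f \<in> alg_aut scale" "f x = y" "f y = x" "f s = s" "f t = t"
proof -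
  obtain f where f: "endo f" "f x = y" "f y = x" "f s = s" "f t = t"
  proof (rule endo_exists[of y x s t])
    show "y * x = scale p (x * y) + 1" by (simp add: rels(1) assms)
  qed (use that in \<open>simp_all add: rels\<close>)
  then have "f \<in> alg_aut scale" by (intro alg_aut_of_endo[OF f(1) f(1)]) simp_all
  with f that show ?thesis by blast
qed

lemma swap_st_exists:
  assumes "q = -1"
  obtains f where "f \<in> alg_aut scale" "f x = x" "f y = y" "f s = t" "f t = s"
proof -
  obtain f where f: "endo f" "f x = x" "f y = y" "f s = t" "f t = s"
  proof (rule endo_exists[of x y t s])
    show "t * s = scale q (s * t)" by (simp add: rels(2) assms)
  qed (use that in \<open>simp_all add: rels\<close>)
  then have "f \<in> alg_aut scale" by (intro alg_aut_of_endo[OF f(1) f(1)]) simp_all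
  with f that show ?thesis by blast
qed

lemma generators_independent:
  "scale a x = scale b y \<Longrightarrow> a = 0" "scale a s = scale b t \<Longrightarrow> a = 0"
  "scale a x = scale b x \<Longrightarrow> a = b" "scale a s = scale b s \<Longrightarrow> a = b" "scale a t = scale b t \<Longrightarrow> a = b"
proof -
  have lin: "poly_const (scale b x) = A.lin 0 b 0 0 0" "poly_const (scale b y) = A.lin 0 0 b 0 0"
    "poly_const (scale b s) = A.lin 0 0 0 b 0" "poly_const (scale b t) = A.lin 0 0 0 0 b" for b
    by (simp_all add: A.lin_def poly_scale_const[OF alg] poly_const_simps(5))
  show "a = 0" if "scale a x = scale b y"
    using arg_cong[OF that, of poly_const] unfolding lin by (auto dest: A.lin_inject)
  show "a = 0" if "scale a s = scale b t"
    using arg_cong[OF that, of poly_const] unfolding lin by (auto dest: A.lin_inject)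
  show "a = b" if "scale a x = scale b x"
    using arg_cong[OF that, of poly_const] unfolding lin by (auto dest: A.lin_inject)
  show "a = b" if "scale a s = scale b s"
    using arg_cong[OF that, of poly_const] unfolding lin by (auto dest: A.lin_inject)
  show "a = b" if "scale a t = scale b t"
    using arg_cong[OF that, of poly_const] unfolding lin by (auto dest: A.lin_inject)
qed

lemma alg_aut_comp: "f \<in> alg_aut scale \<Longrightarrow> g \<in> alg_aut scale \<Longrightarrow> f \<circ> g \<in> alg_aut scale"
  by (intro alg_autI[OF alg]) (simp_all add: alg_autD[OF alg] bij_comp, simp add: alg_aut_def bij_comp)

lemma alg_aut_ext:
  assumes "f \<in> alg_aut scale" "g \<in> alg_aut scale" "f x = g x" "f y = g y" "f s = g s" "f t = g t"
  shows "f = g"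
  using assms by (intro endo_ext endo_alg_aut)

lemma carrier_torus: "(a, b, c) \<in> carrier torus \<longleftrightarrow> a \<noteq> 0 \<and> b \<noteq> 0 \<and> c \<noteq> 0"
  by (simp add: unit_group_def)

lemma torusE:
  assumes "n \<in> carrier torus"
  obtains a b c where "n = (a, b, c)" "a \<noteq> 0" "b \<noteq> 0" "c \<noteq> 0"
  using assms by (cases n) (simp add: unit_group_def)

lemma diag_hom: "diag \<in> hom torus (aut_group scale)"
proof (rule homI)
  fix n assume "n \<in> carrier torus"
  then obtain a b c where "n = (a, b, c)" "a \<noteq> 0" "b \<noteq> 0" "c \<noteq> 0" by (rule torusE)
  then show "diag n \<in> carrier (aut_group scale)" by (simp add: aut_group_def diag)
next
  fix m n assume m: "m \<in> carrier torus" and n: "n \<in> carrier torus"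
  obtain a b c where m': "m = (a, b, c)" "a \<noteq> 0" "b \<noteq> 0" "c \<noteq> 0" using m by (rule torusE)
  obtain a' b' c' where n': "n = (a', b', c')" "a' \<noteq> 0" "b' \<noteq> 0" "c' \<noteq> 0" using n by (rule torusE)
  have "diag (a * a', b * b', c * c') = diag (a, b, c) \<circ> diag (a', b', c')"
    using m' n' by (intro alg_aut_ext alg_aut_comp diag)
      (simp_all add: diag alg_autD(2)[OF alg diag(1)] mult.commute)
  then show "diag (m \<otimes>\<^bsub>torus\<^esub> n) = diag m \<otimes>\<^bsub>aut_group scale\<^esub> diag n"
    by (simp add: m' n' unit_group_def aut_group_def)
qed

lemma diag_inj: "inj_on diag (carrier torus)"
proof (rule inj_onI)
  fix m n assume m: "m \<in> carrier torus" and n: "n \<in> carrier torus"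
    and eq: "diag m = diag n"
  obtain a b c where m': "m = (a, b, c)" "a \<noteq> 0" "b \<noteq> 0" "c \<noteq> 0" using m by (rule torusE)
  obtain a' b' c' where n': "n = (a', b', c')" "a' \<noteq> 0" "b' \<noteq> 0" "c' \<noteq> 0" using n by (rule torusE)
  show "m = n"
    using generators_independent(3)[of a a'] generators_independent(4)[of b b'] generators_independent(5)[of c c']
      fun_cong[OF eq, of x] fun_cong[OF eq, of s] fun_cong[OF eq, of t] m' n'
    by (simp add: diag)
qed

text \<open>With the exchanges \<open>\<tau>\<close> of \<open>x\<close> and \<open>y\<close> and \<open>\<upsilon>\<close> of \<open>s\<close> and \<open>t\<close>, the classification says that every
  automorphism is diagonal up to the available exchanges.\<close>

lemma alg_aut_cases:
  assumes g: "g \<in> alg_aut scale"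
    and \<tau>: "p = -1 \<Longrightarrow> \<tau> \<in> alg_aut scale \<and> \<tau> x = y \<and> \<tau> y = x \<and> \<tau> s = s \<and> \<tau> t = t"
    and \<upsilon>: "q = -1 \<Longrightarrow> \<upsilon> \<in> alg_aut scale \<and> \<upsilon> x = x \<and> \<upsilon> y = y \<and> \<upsilon> s = t \<and> \<upsilon> t = s"
  obtains n where "n \<in> carrier torus" "g = diag n"
  | n where "p = -1" "n \<in> carrier torus" "g = diag n \<circ> \<tau>"
  | n where "q = -1" "n \<in> carrier torus" "g = diag n \<circ> \<upsilon>"
  | n where "p = -1" "q = -1" "n \<in> carrier torus" "g = diag n \<circ> \<tau> \<circ> \<upsilon>"
proof -
  obtain a where a: "a \<noteq> 0" "g x = scale a x \<and> g y = scale (inverse a) y \<or>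
      p = -1 \<and> g x = scale a y \<and> g y = scale (inverse a) x"
    using aut_generators[OF g] by blast
  obtain b c where bc: "b \<noteq> 0" "c \<noteq> 0" "g s = scale b s \<and> g t = scale c t \<or>
      q = -1 \<and> g s = scale b t \<and> g t = scale c s"
    using aut_generators[OF g] by blast
  have a': "inverse a \<noteq> 0" using a(1) by simp
  note ext = alg_aut_ext[OF g]
  from a(2) bc(3) consider
      "g x = scale a x" "g y = scale (inverse a) y" "g s = scale b s" "g t = scale c t"
    | "p = -1" "g x = scale a y" "g y = scale (inverse a) x" "g s = scale b s" "g t = scale c t"
    | "q = -1" "g x = scale a x" "g y = scale (inverse a) y" "g s = scale b t" "g t = scale c s"
    | "p = -1" "q = -1" "g x = scale a y" "g y = scale (inverse a) x" "g s = scale b t" "g t = scale c s"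
    by blast
  then show ?thesis
  proof cases
    case 1
    then have "g = diag (a, b, c)" using a(1) bc(1,2) by (intro ext) (simp_all add: diag)
    with a(1) bc(1,2) that(1) show ?thesis using carrier_torus by blast
  next
    case 2
    then have "g = diag (inverse a, b, c) \<circ> \<tau>"
      using a(1) a' bc(1,2) \<tau> by (intro ext alg_aut_comp) (simp_all add: diag)
    with a' bc(1,2) that(2) 2(1) show ?thesis using carrier_torus by blast
  next
    case 3
    then have "g = diag (a, c, b) \<circ> \<upsilon>"
      using a(1) bc(1,2) \<upsilon> by (intro ext alg_aut_comp) (simp_all add: diag)
    with a(1) bc(1,2) that(3) 3(1) show ?thesis using carrier_torus by blast
  next
    case 4
    then have "g = diag (inverse a, c, b) \<circ> \<tau> \<circ> \<upsilon>"
      using a(1) a' bc(1,2) \<tau> \<upsilon> by (intro ext alg_aut_comp) (simp_all add: diag)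
    with a' bc(1,2) that(4) 4(1,2) show ?thesis using carrier_torus by blast
  qed
qed

lemma diag_swap_xy:
  assumes \<tau>: "\<tau> \<in> alg_aut scale" "\<tau> x = y" "\<tau> y = x" "\<tau> s = s" "\<tau> t = t"
  shows "\<forall>n\<in>carrier torus. \<tau> \<circ> diag n \<circ> \<tau> \<in> diag ` carrier torus"
proof
  fix n assume n: "n \<in> carrier torus"
  obtain a b c where n': "n = (a, b, c)" "a \<noteq> 0" "b \<noteq> 0" "c \<noteq> 0" using n by (rule torusE)
  have "\<tau> \<circ> diag n \<circ> \<tau> = diag (inverse a, b, c)"
    using n' \<tau> by (intro alg_aut_ext alg_aut_comp) (simp_all add: diag alg_autD(2)[OF alg \<tau>(1)])
  then show "\<tau> \<circ> diag n \<circ> \<tau> \<in> diag ` carrier torus"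
    using n' carrier_torus by (metis image_eqI inverse_nonzero_iff_nonzero)
qed

lemma diag_swap_st:
  assumes \<upsilon>: "\<upsilon> \<in> alg_aut scale" "\<upsilon> x = x" "\<upsilon> y = y" "\<upsilon> s = t" "\<upsilon> t = s"
  shows "\<forall>n\<in>carrier torus. \<upsilon> \<circ> diag n \<circ> \<upsilon> \<in> diag ` carrier torus"
proof
  fix n assume n: "n \<in> carrier torus"
  obtain a b c where n': "n = (a, b, c)" "a \<noteq> 0" "b \<noteq> 0" "c \<noteq> 0" using n by (rule torusE)
  have "\<upsilon> \<circ> diag n \<circ> \<upsilon> = diag (a, c, b)"
    using n' \<upsilon> by (intro alg_aut_ext alg_aut_comp) (simp_all add: diag alg_autD(2)[OF alg \<upsilon>(1)])
  then show "\<upsilon> \<circ> diag n \<circ> \<upsilon> \<in> diag ` carrier torus"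
    using n' carrier_torus by (metis image_eqI)
qed

lemma id_alg_aut: "id \<in> alg_aut scale"
  by (intro alg_autI[OF alg]) simp_all

lemma swap_xy_involution:
  "\<tau> \<in> alg_aut scale \<Longrightarrow> \<tau> x = y \<Longrightarrow> \<tau> y = x \<Longrightarrow> \<tau> s = s \<Longrightarrow> \<tau> t = t \<Longrightarrow> \<tau> \<circ> \<tau> = id"
  by (intro alg_aut_ext alg_aut_comp id_alg_aut) simp_all

lemma swap_st_involution:
  "\<upsilon> \<in> alg_aut scale \<Longrightarrow> \<upsilon> x = x \<Longrightarrow> \<upsilon> y = y \<Longrightarrow> \<upsilon> s = t \<Longrightarrow> \<upsilon> t = s \<Longrightarrow> \<upsilon> \<circ> \<upsilon> = id"
  by (intro alg_aut_ext alg_aut_comp id_alg_aut) simp_all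

lemma swap_xy_not_diag:
  assumes "\<tau> x = y"
  shows "\<tau> \<notin> diag ` carrier torus"
proof
  assume "\<tau> \<in> diag ` carrier torus"
  then obtain a b c where "\<tau> = diag (a, b, c)" "a \<noteq> 0" "b \<noteq> 0" "c \<noteq> 0" using torusE by blast
  with assms generators_independent(1)[of a 1] show False by (simp add: diag)
qed

lemma swap_st_not_diag:
  assumes "\<upsilon> s = t"
  shows "\<upsilon> \<notin> diag ` carrier torus"
proof
  assume "\<upsilon> \<in> diag ` carrier torus"
  then obtain a b c where "\<upsilon> = diag (a, b, c)" "a \<noteq> 0" "b \<noteq> 0" "c \<noteq> 0" using torusE by blast
  with assms generators_independent(2)[of b 1] show False by (simp add: diag)
qed

lemma aut_group_simps:
  "carrier (aut_group scale) = alg_aut scale" "f \<otimes>\<^bsub>aut_group scale\<^esub> g = f \<circ> g" "\<one>\<^bsub>aut_group scale\<^esub> = id"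
  by (simp_all add: aut_group_def)

lemmas aut_group = group_aut_group[OF alg]

lemma diag_in_aut: "n \<in> carrier torus \<Longrightarrow> diag n \<in> alg_aut scale"
  using diag_hom by (auto simp: hom_def aut_group_simps)

lemma aut_group_generic:
  assumes "p \<noteq> -1" "q \<noteq> -1"
  shows "aut_group scale \<cong> torus"
proof (rule iso_from_hom[OF group_torus3 diag_hom diag_inj])
  show "diag ` carrier torus = carrier (aut_group scale)"
  proof (intro equalityI subsetI)
    fix g assume "g \<in> carrier (aut_group scale)"
    then have "g \<in> alg_aut scale" by (simp add: aut_group_simps)
    then show "g \<in> diag ` carrier torus"
      using assms alg_aut_cases[of g id id] by blast
  qed (auto simp: aut_group_simps diag_in_aut simp del: carrier_DirProd)
qed

lemma aut_group_embedding:
  assumes N: "group N" "j \<in> hom N (aut_group scale)" "inj_on j (carrier N)"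
    and \<tau>: "\<tau> \<in> alg_aut scale" "\<tau> \<circ> \<tau> = id" "\<tau> \<notin> j ` carrier N"
    and conj: "\<forall>n\<in>carrier N. \<tau> \<circ> j n \<circ> \<tau> \<in> j ` carrier N"
  obtains \<theta> J where "\<theta> \<in> hom Z2 (AutoGroup N)"
    "J \<in> hom (semidirect Z2 N \<theta>) (aut_group scale)" "inj_on J (carrier (semidirect Z2 N \<theta>))"
    "J ` carrier (semidirect Z2 N \<theta>) = j ` carrier N \<union> (\<lambda>u. u \<circ> \<tau>) ` j ` carrier N"
proof -
  have \<tau>': "\<tau> \<in> carrier (aut_group scale)" "\<tau> \<otimes>\<^bsub>aut_group scale\<^esub> \<tau> = \<one>\<^bsub>aut_group scale\<^esub>"
    using \<tau>(1,2) by (simp_all only: aut_group_simps)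
  have conj': "\<tau> \<otimes>\<^bsub>aut_group scale\<^esub> j n \<otimes>\<^bsub>aut_group scale\<^esub> \<tau> \<in> j ` carrier N" if "n \<in> carrier N" for n
    using bspec[OF conj that] by (simp only: aut_group_simps)
  obtain \<theta> J where J: "\<theta> \<in> hom Z2 (AutoGroup N)"
    "J \<in> hom (semidirect Z2 N \<theta>) (aut_group scale)" "inj_on J (carrier (semidirect Z2 N \<theta>))"
    "J ` carrier (semidirect Z2 N \<theta>) = j ` carrier N \<union> (\<lambda>u. u \<otimes>\<^bsub>aut_group scale\<^esub> \<tau>) ` j ` carrier N"
    by (rule group.semidirect_embedding[OF aut_group N \<tau>' \<tau>(3) conj'])
  show ?thesis by (rule that[OF J(1-3)]) (use J(4) in \<open>simp only: aut_group_simps\<close>)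
qed

lemma aut_group_swap_iso:
  assumes \<tau>: "\<tau> \<in> alg_aut scale" "\<tau> \<circ> \<tau> = id" "\<tau> \<notin> diag ` carrier torus"
    and conj: "\<forall>n\<in>carrier torus. \<tau> \<circ> diag n \<circ> \<tau> \<in> diag ` carrier torus"
    and all: "alg_aut scale \<subseteq> diag ` carrier torus \<union> (\<lambda>u. u \<circ> \<tau>) ` diag ` carrier torus"
  shows "\<exists>\<theta>\<in>hom Z2 (AutoGroup torus). aut_group scale \<cong> semidirect Z2 torus \<theta>"
proof -
  obtain \<theta> J where J: "\<theta> \<in> hom Z2 (AutoGroup torus)"
    "J \<in> hom (semidirect Z2 torus \<theta>) (aut_group scale)" "inj_on J (carrier (semidirect Z2 torus \<theta>))"
    "J ` carrier (semidirect Z2 torus \<theta>) = diag ` carrier torus \<union> (\<lambda>u. u \<circ> \<tau>) ` diag ` carrier torus"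
    by (rule aut_group_embedding[OF group_torus3 diag_hom diag_inj \<tau> conj])
  have "J ` carrier (semidirect Z2 torus \<theta>) = carrier (aut_group scale)"
    using J(4) all hom_carrier[OF J(2)] by (auto simp: aut_group_simps simp del: carrier_DirProd)
  from iso_from_hom[OF group_semidirect[OF _ group_torus3 J(1)] J(2,3) this] J(1)
  show ?thesis by auto
qed

lemma aut_group_p:
  assumes "p = -1" "q \<noteq> -1"
  shows "\<exists>\<theta>\<in>hom Z2 (AutoGroup torus). aut_group scale \<cong> semidirect Z2 torus \<theta>"
proof -
  obtain \<tau> where \<tau>: "\<tau> \<in> alg_aut scale" "\<tau> x = y" "\<tau> y = x" "\<tau> s = s" "\<tau> t = t"
    by (rule swap_xy_exists[OF assms(1)])
  show ?thesis
  proof (rule aut_group_swap_iso[OF \<tau>(1) swap_xy_involution[OF \<tau>] swap_xy_not_diag[of \<tau>, OF \<tau>(2)] diag_swap_xy[OF \<tau>]])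
    show "alg_aut scale \<subseteq> diag ` carrier torus \<union> (\<lambda>u. u \<circ> \<tau>) ` diag ` carrier torus"
      using assms \<tau> alg_aut_cases[of _ \<tau> id] by blast
  qed
qed

lemma aut_group_q:
  assumes "p \<noteq> -1" "q = -1"
  shows "\<exists>\<theta>\<in>hom Z2 (AutoGroup torus). aut_group scale \<cong> semidirect Z2 torus \<theta>"
proof -
  obtain \<upsilon> where \<upsilon>: "\<upsilon> \<in> alg_aut scale" "\<upsilon> x = x" "\<upsilon> y = y" "\<upsilon> s = t" "\<upsilon> t = s"
    by (rule swap_st_exists[OF assms(2)])
  show ?thesis
  proof (rule aut_group_swap_iso[OF \<upsilon>(1) swap_st_involution[OF \<upsilon>] swap_st_not_diag[of \<upsilon>, OF \<upsilon>(4)] diag_swap_st[OF \<upsilon>]])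
    show "alg_aut scale \<subseteq> diag ` carrier torus \<union> (\<lambda>u. u \<circ> \<upsilon>) ` diag ` carrier torus"
      using assms \<upsilon> alg_aut_cases[of _ id \<upsilon>] by blast
  qed
qed

text \<open>The two exchanges commute, so the second one normalises the group generated by the first one and
  the torus, and the construction applies twice.\<close>

lemma aut_group_pq:
  assumes "p = -1" "q = -1"
  shows "\<exists>\<theta>\<in>hom Z2 (AutoGroup torus).
    \<exists>\<eta>\<in>hom Z2 (AutoGroup (semidirect Z2 torus \<theta>)).
      aut_group scale \<cong> semidirect Z2 (semidirect Z2 torus \<theta>) \<eta>"
proof -
  obtain \<tau> where \<tau>: "\<tau> \<in> alg_aut scale" "\<tau> x = y" "\<tau> y = x" "\<tau> s = s" "\<tau> t = t"
    by (rule swap_xy_exists[OF assms(1)])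
  obtain \<upsilon> where \<upsilon>: "\<upsilon> \<in> alg_aut scale" "\<upsilon> x = x" "\<upsilon> y = y" "\<upsilon> s = t" "\<upsilon> t = s"
    by (rule swap_st_exists[OF assms(2)])
  let ?D = "diag ` carrier torus"
  obtain \<theta> J where J: "\<theta> \<in> hom Z2 (AutoGroup torus)"
    "J \<in> hom (semidirect Z2 torus \<theta>) (aut_group scale)" "inj_on J (carrier (semidirect Z2 torus \<theta>))"
    "J ` carrier (semidirect Z2 torus \<theta>) = ?D \<union> (\<lambda>u. u \<circ> \<tau>) ` ?D"
    by (rule aut_group_embedding[OF group_torus3 diag_hom diag_inj \<tau>(1) swap_xy_involution[OF \<tau>] swap_xy_not_diag[of \<tau>, OF \<tau>(2)] diag_swap_xy[OF \<tau>]])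
  have N: "group (semidirect Z2 torus \<theta>)"
    by (rule group_semidirect[OF group_integer_mod_group group_torus3 J(1)])
  have "\<upsilon> \<notin> (\<lambda>u. u \<circ> \<tau>) ` ?D"
  proof
    assume "\<upsilon> \<in> (\<lambda>u. u \<circ> \<tau>) ` ?D"
    then obtain n where n: "n \<in> carrier torus" "\<upsilon> = diag n \<circ> \<tau>" by blast
    then obtain a b c where "n = (a, b, c)" "a \<noteq> 0" "b \<noteq> 0" "c \<noteq> 0" using torusE by blast
    with n(2) have "\<upsilon> s = scale b s" by (simp add: \<tau> diag)
    with \<upsilon>(4) generators_independent(2)[of b 1] \<open>b \<noteq> 0\<close> show False by simp
  qed
  then have not_in: "\<upsilon> \<notin> J ` carrier (semidirect Z2 torus \<theta>)"
    using J(4) swap_st_not_diag[of \<upsilon>, OF \<upsilon>(4)] by blast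
  have comm: "\<tau> \<circ> \<upsilon> = \<upsilon> \<circ> \<tau>"
    using \<tau> \<upsilon> by (intro alg_aut_ext alg_aut_comp) simp_all
  have conj: "\<forall>n\<in>carrier (semidirect Z2 torus \<theta>). \<upsilon> \<circ> J n \<circ> \<upsilon> \<in> J ` carrier (semidirect Z2 torus \<theta>)"
  proof
    fix n assume "n \<in> carrier (semidirect Z2 torus \<theta>)"
    then have "J n \<in> ?D \<union> (\<lambda>u. u \<circ> \<tau>) ` ?D" using J(4) by blast
    then obtain m where m: "m \<in> carrier torus" "J n = diag m \<or> J n = diag m \<circ> \<tau>" by blast
    have D: "\<upsilon> \<circ> diag m \<circ> \<upsilon> \<in> ?D" using diag_swap_st[OF \<upsilon>] m(1) by blast
    have "\<upsilon> \<circ> (diag m \<circ> \<tau>) \<circ> \<upsilon> = (\<upsilon> \<circ> diag m \<circ> \<upsilon>) \<circ> \<tau>"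
      by (simp only: comp_assoc comm)
    with m(2) D have "\<upsilon> \<circ> J n \<circ> \<upsilon> \<in> ?D \<union> (\<lambda>u. u \<circ> \<tau>) ` ?D" by auto
    then show "\<upsilon> \<circ> J n \<circ> \<upsilon> \<in> J ` carrier (semidirect Z2 torus \<theta>)" by (simp only: J(4))
  qed
  obtain \<eta> J' where J': "\<eta> \<in> hom Z2 (AutoGroup (semidirect Z2 torus \<theta>))"
    "J' \<in> hom (semidirect Z2 (semidirect Z2 torus \<theta>) \<eta>) (aut_group scale)"
    "inj_on J' (carrier (semidirect Z2 (semidirect Z2 torus \<theta>) \<eta>))"
    "J' ` carrier (semidirect Z2 (semidirect Z2 torus \<theta>) \<eta>) =
      J ` carrier (semidirect Z2 torus \<theta>) \<union> (\<lambda>u. u \<circ> \<upsilon>) ` J ` carrier (semidirect Z2 torus \<theta>)"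
    by (rule aut_group_embedding[OF N J(2,3) \<upsilon>(1) swap_st_involution[OF \<upsilon>] not_in conj])
  have "g \<in> J' ` carrier (semidirect Z2 (semidirect Z2 torus \<theta>) \<eta>)" if "g \<in> alg_aut scale" for g
    unfolding J'(4) J(4)
  proof (rule alg_aut_cases[OF that, of \<tau> \<upsilon>])
    fix n assume n: "n \<in> carrier torus"
    have D: "diag n \<in> ?D" using n by (rule imageI)
    have D': "diag n \<circ> \<tau> \<in> (\<lambda>u. u \<circ> \<tau>) ` ?D" using D by (rule imageI)
    let ?R = "?D \<union> (\<lambda>u. u \<circ> \<tau>) ` ?D \<union> (\<lambda>u. u \<circ> \<upsilon>) ` (?D \<union> (\<lambda>u. u \<circ> \<tau>) ` ?D)"
    show "g \<in> ?R" if "g = diag n" using D that by simp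
    show "g \<in> ?R" if "g = diag n \<circ> \<tau>" using D' that by simp
    show "g \<in> ?R" if "g = diag n \<circ> \<upsilon>"
      unfolding that by (intro UnI2 imageI UnI1 D)
    show "g \<in> ?R" if "g = diag n \<circ> \<tau> \<circ> \<upsilon>"
      unfolding that by (rule UnI2, rule imageI, rule UnI2, rule D')
  qed (use \<tau> \<upsilon> in simp_all)
  then have "J' ` carrier (semidirect Z2 (semidirect Z2 torus \<theta>) \<eta>) = carrier (aut_group scale)"
    using hom_carrier[OF J'(2)] by (auto simp: aut_group_simps)
  from iso_from_hom[OF group_semidirect[OF group_integer_mod_group N J'(1)] J'(2,3) this] J(1) J'(1)
  show ?thesis by blast
qed

lemma alg_aut_affine:
  assumes g: "g \<in> alg_aut scale"
  shows "affine_map scale {x, y, s, t} g"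
proof -
  let ?S = "span (insert 1 {x, y, s, t})"
  have "{prod_list us | us. length us = 1 \<and> set us \<subseteq> ?S} = ?S"
    by (auto simp: length_Suc_conv) (metis (no_types, lifting) empty_set empty_subsetI insert_subset list.simps(15)
      prod_list.Cons prod_list.Nil mult_1_right)
  then have F1: "std_filtration scale {x, y, s, t} 1 = ?S"
    by (simp add: std_filtration_def span_span)
  interpret g: Vector_Spaces.linear scale scale g using g by (simp add: alg_aut_def)
  have gens: "scale c u \<in> ?S" if "u \<in> {x, y, s, t}" for c u
    using that by (intro span_scale span_base) blast
  have "g ` insert 1 {x, y, s, t} \<subseteq> ?S"
    using aut_generators[OF g] gens span_base[of 1 "insert 1 {x, y, s, t}"] alg_autD(4)[OF alg g]
    by auto
  then have "g ` ?S \<subseteq> ?S"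
    by (metis g.span_image span_minimal subspace_span)
  then show ?thesis unfolding affine_map_def F1 .
qed

end

theorem theorem4p2:
  fixes scale :: "'k::field \<Rightarrow> 'b::ring_1 \<Rightarrow> 'b" and p q :: 'k and x y s t :: 'b
  assumes "p \<noteq> 0" and "q \<noteq> 0" and "p \<noteq> 1" and "q \<noteq> 1"
    and "is_Apq scale p q x y s t"
  shows
    "((\<forall>g\<in>alg_aut scale. affine_map scale {x, y, s, t} g) \<and>
      (p \<noteq> -1 \<and> q \<noteq> -1 \<longrightarrow> aut_group scale \<cong> (torus3 :: ('k \<times> 'k \<times> 'k) monoid)) \<and>
      (p = -1 \<and> q \<noteq> -1 \<longrightarrow>
        (\<exists>\<theta>\<in>hom Z2 (AutoGroup (torus3 :: ('k \<times> 'k \<times> 'k) monoid)).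
          aut_group scale \<cong> semidirect Z2 torus3 \<theta>)) \<and>
      (p \<noteq> -1 \<and> q = -1 \<longrightarrow>
        (\<exists>\<theta>\<in>hom Z2 (AutoGroup (torus3 :: ('k \<times> 'k \<times> 'k) monoid)).
          aut_group scale \<cong> semidirect Z2 torus3 \<theta>)) \<and>
      (p = -1 \<and> q = -1 \<longrightarrow>
        (\<exists>\<theta>\<in>hom Z2 (AutoGroup (torus3 :: ('k \<times> 'k \<times> 'k) monoid)).
         \<exists>\<eta>\<in>hom Z2 (AutoGroup (semidirect Z2 (torus3 :: ('k \<times> 'k \<times> 'k) monoid) \<theta>)).
          aut_group scale \<cong> semidirect Z2 (semidirect Z2 torus3 \<theta>) \<eta>))) \<and>
     (\<forall>\<phi>\<in>alg_aut (poly_scale scale).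
        triangular scale \<phi> \<and>
        (\<exists>\<phi>\<^sub>0\<in>alg_aut scale. \<exists>b\<in>ring_center. \<exists>a. a \<noteq> 0 \<and>
          \<phi> (poly_const x) = poly_const (\<phi>\<^sub>0 x) \<and> \<phi> (poly_const y) = poly_const (\<phi>\<^sub>0 y) \<and>
          \<phi> (poly_const s) = poly_const (\<phi>\<^sub>0 s) \<and> \<phi> (poly_const t) = poly_const (\<phi>\<^sub>0 t) \<and>
          \<phi> poly_var = poly_scale scale a poly_var + poly_const b)) \<and>
     (CHAR('k) = 0 \<longrightarrow> LNDer scale = {\<lambda>_. 0})"
proof -
  interpret Apq_algebra scale p q x y s t
    by (rule Apq_algebra.intro) fact+
  have poly: "triangular scale \<phi> \<and>
      (\<exists>\<phi>\<^sub>0\<in>alg_aut scale. \<exists>b\<in>ring_center. \<exists>a. a \<noteq> 0 \<and>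
        \<phi> (poly_const x) = poly_const (\<phi>\<^sub>0 x) \<and> \<phi> (poly_const y) = poly_const (\<phi>\<^sub>0 y) \<and>
        \<phi> (poly_const s) = poly_const (\<phi>\<^sub>0 s) \<and> \<phi> (poly_const t) = poly_const (\<phi>\<^sub>0 t) \<and>
        \<phi> poly_var = poly_scale scale a poly_var + poly_const b)"
    if \<phi>: "\<phi> \<in> alg_aut (poly_scale scale)" for \<phi>
  proof -
    obtain g a b where g: "g \<in> alg_aut scale" "\<forall>u. \<phi> (poly_const u) = poly_const (g u)" "a \<noteq> 0"
      "b \<in> ring_center" "\<phi> poly_var = poly_scale scale a poly_var + poly_const b"
      by (rule alg_aut_poly[OF \<phi>])
    have "triangular scale \<phi>" unfolding triangular_def using g by blast
    with g show ?thesis by blast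
  qed
  have "LNDer scale = {\<lambda>_. 0}" if "CHAR('k) = 0"
  proof -
    have "(\<lambda>_. 0) \<in> LNDer scale"
    proof -
      have "Vector_Spaces.linear scale scale (\<lambda>_. 0)"
        by (intro linear_module_homI module_hom.intro module_hom_axioms.intro module_axioms) simp_all
      then show ?thesis by (auto simp: LNDer_def derivations_def intro: exI[of _ 1])
    qed
    moreover have "\<delta> = (\<lambda>_. 0)" if "\<delta> \<in> LNDer scale" for \<delta>
      using locally_nilpotent_zero[OF \<open>CHAR('k) = 0\<close> that] by blast
    ultimately show ?thesis by blast
  qed
  then show ?thesis
    using alg_aut_affine aut_group_generic aut_group_p aut_group_q aut_group_pq poly by simp
qed

end
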